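(* Let $(A,C,\psi)$ be an entwining structure over a field $k$. Then $((\Omega^\bullet A,d^\bullet),C,\hat\psi)$, together with the identity $A\to\Omega^0A=A$, is a dg-entwining structure over $(A,C,\psi)$.
   Context: Let $k$ be a field; $\otimes$ is over $k$. An entwining structure $(A,C,\psi)$ over $k$ consists of a unital associative $k$-algebra $A$ with product $\theta$, a counital coassociative $k$-coalgebra $C$ (coproduct $\Delta$, counit $\varepsilon$), and a $k$-linear map $\psi:C\otimes A\to A\otimes C$, written $\psi(c\otimes a)=a_\psi\otimes c^\psi$ with summation suppressed, such that: (i) $\psi\circ(id_C\otimes\theta)=(\theta\otimes id_C)\circ(id_A\otimes\psi)\circ(\psi\otimes id_A)$; (ii) $(id_A\otimes\Delta)\circ\psi=(\psi\otimes id_C)\circ(id_C\otimes\psi)\circ(\Delta\otimes id_A)$; (iii) $a_\psi\,\varepsilon(c^\psi)=\varepsilon(c)a$; (iv) $1_\psi\otimes c^\psi=1\otimes c$. For a non-unital algebra, "entwining structure" means (i)–(iii) only. Iterating, $a_{1\psi}\otimes\cdots\otimes a_{m\psi}\otimes c^{\psi^m}$ denotes the image of $c\otimes a_1\otimes\cdots\otimes a_m$ under the map $C\otimes A^{\otimes m}\to A^{\otimes m}\otimes C$ that moves $C$ past $a_1$, then $a_2$, ..., then $a_m$ by $\psi$. A dg-entwining structure $((R^\bullet,D^\bullet),C,\Psi^\bullet)$ consists of a non-negatively graded, not necessarily unital, differential graded $k$-algebra $(R^\bullet,D^\bullet)$ (differential of degree $+1$), a counital coalgebra $C$ and a degree-zero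 $k$-linear map $\Psi^\bullet:C\otimes R^\bullet\to R^\bullet\otimes C$ with $(D\otimes id_C)\circ\Psi=\Psi\circ(id_C\otimes D)$ and such that $(R,C,\Psi)$ is an entwining structure (in the possibly non-unital sense). A dg-entwining structure over $(A,C,\psi)$ is such a structure together with a (not necessarily unital) $k$-algebra morphism $\rho:A\to R^0$ satisfying $(\rho\otimes id_C)\circ\psi=\Psi^0\circ(id_C\otimes\rho)$. Universal dg-algebra: let $\tilde A=A\oplus k$ with $(a+\mu)(a'+\nu)=(aa'+\mu a'+\nu a)+\mu\nu$. Put $\Omega^0A=A$ and $\Omega^nA=\tilde A\otimes A^{\otimes n}$ for $n>0$; the element $(a_0+\mu)\otimes a_1\otimes\cdots\otimes a_n$ is written $(a_0+\mu)da_1\cdots da_n$ (with $\mu=0$ understood when $n=0$). The product is determined by $a_0da_1\cdots da_n=(a_0)\cdot(da_1)\cdots(da_n)$, $da_1\cdots da_n=(da_1)\cdots(da_n)$ and $(da)\cdot a'=d(aa')-a(da')$; explicitly, for $i\ge1$, $$((p_0+\mu)dp_1\cdots dp_i)\cdot((q_0+\nu)dq_1\cdots dq_j)=(p_0+\mu)\Big(dp_1\cdots dp_{i-1}d(p_iq_0)dq_1\cdots dq_j+\sum_{l=1}^{i-1}(-1)^{i-l}dp_1\cdots d(p_lp_{l+1})\cdots dp_i\,dq_0\cdots dq_j\Big)$$ $$+(-1)^i(p_0+\mu)p_1dp_2\cdots dp_i\,dq_0\cdots dq_j+\nu(p_0+\mu)dp_1\cdots dp_idq_1\cdots dq_j,$$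 and $p_0\cdot((q_0+\nu)dq_1\cdots dq_j)=(p_0q_0+\nu p_0)dq_1\cdots dq_j$. The differential is $d((a_0+\mu)da_1\cdots da_n)=da_0da_1\cdots da_n$. The map $\hat\psi:C\otimes\Omega A\to\Omega A\otimes C$ is $$\hat\psi(c\otimes(a_0+\mu)da_1\cdots da_n)=(a_{0\psi}da_{1\psi}\cdots da_{n\psi})\otimes c^{\psi^{n+1}}+\mu(da_{1\psi}\cdots da_{n\psi})\otimes c^{\psi^n}.$$ *)

theory Defs
  imports "HOL-Algebra.Module" "HOL-Algebra.AbelCoset"
begin

section \<open>Linear algebra over a field \<open>K\<close>\<close>

text \<open>
  Vector spaces are HOL-Algebra modules over a field. The record type of modules extends that of
  rings; the fields \<open>mult\<close> and \<open>one\<close> are left unspecified when only the vector space matters.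
  Maps are functions on the whole HOL type; only their values on the carrier are meaningful.
\<close>

definition linear_map ::
  "'k ring \<Rightarrow> ('k, 'm) module \<Rightarrow> ('k, 'n) module \<Rightarrow> ('m \<Rightarrow> 'n) \<Rightarrow> bool" where
  "linear_map K M N f \<longleftrightarrow>
     f \<in> hom (add_monoid M) (add_monoid N) \<and>
     (\<forall>r \<in> carrier K. \<forall>x \<in> carrier M. f (r \<odot>\<^bsub>M\<^esub> x) = r \<odot>\<^bsub>N\<^esub> f x)"

definition ground :: "'k ring \<Rightarrow> ('k, 'k) module" where
  "ground K = \<lparr>carrier = carrier K, monoid.mult = monoid.mult K, one = one K,
     zero = zero K, add = add K, smult = monoid.mult K\<rparr>"

definition lin_span :: "'k ring \<Rightarrow> ('k, 'm) module \<Rightarrow> 'm set \<Rightarrow> 'm set" where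
  "lin_span K M S = \<Inter> {N. submodule N K M \<and> S \<subseteq> N}"

definition quot_module :: "('k, 'm) module \<Rightarrow> 'm set \<Rightarrow> ('k, 'm set) module" where
  "quot_module M N = \<lparr>carrier = a_rcosets\<^bsub>M\<^esub> N, monoid.mult = undefined, one = undefined,
     zero = N, add = (\<lambda>S T. S <+>\<^bsub>M\<^esub> T),
     smult = (\<lambda>r S. \<Union>x\<in>S. N +>\<^bsub>M\<^esub> (r \<odot>\<^bsub>M\<^esub> x))\<rparr>"

definition free_module :: "'k ring \<Rightarrow> 'x set \<Rightarrow> ('k, 'x \<Rightarrow> 'k) module" where
  "free_module K X =
     \<lparr>carrier = {u. (\<forall>x\<in>X. u x \<in> carrier K) \<and> (\<forall>x. x \<notin> X \<longrightarrow> u x = \<zero>\<^bsub>K\<^esub>) \<and>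
                    finite {x. u x \<noteq> \<zero>\<^bsub>K\<^esub>}},
      monoid.mult = undefined, one = undefined, zero = (\<lambda>_. \<zero>\<^bsub>K\<^esub>),
      add = (\<lambda>u v x. u x \<oplus>\<^bsub>K\<^esub> v x), smult = (\<lambda>r u x. r \<otimes>\<^bsub>K\<^esub> u x)\<rparr>"

definition unit_vec :: "'k ring \<Rightarrow> 'x \<Rightarrow> 'x \<Rightarrow> 'k" where
  "unit_vec K x = (\<lambda>y. if y = x then \<one>\<^bsub>K\<^esub> else \<zero>\<^bsub>K\<^esub>)"

text \<open>The vector space with generators \<open>X\<close> and relators \<open>Rel\<close>, and its generators.\<close>

definition presented :: "'k ring \<Rightarrow> 'x set \<Rightarrow> ('x \<Rightarrow> 'k) set \<Rightarrow> ('k, ('x \<Rightarrow> 'k) set) module" where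
  "presented K X Rel = quot_module (free_module K X) (lin_span K (free_module K X) Rel)"

definition gen :: "'k ring \<Rightarrow> 'x set \<Rightarrow> ('x \<Rightarrow> 'k) set \<Rightarrow> 'x \<Rightarrow> ('x \<Rightarrow> 'k) set" where
  "gen K X Rel x = lin_span K (free_module K X) Rel +>\<^bsub>free_module K X\<^esub> unit_vec K x"

text \<open>
  The linear map out of a presented space with prescribed values \<open>g\<close> on the generators, computed
  on some representative of the coset. It is well defined when the linear extension of \<open>g\<close> to the
  free module kills the relators, as is the case in all uses below.
\<close>

definition lift :: "'k ring \<Rightarrow> ('k, 'p) module \<Rightarrow> ('x \<Rightarrow> 'p) \<Rightarrow> ('x \<Rightarrow> 'k) set \<Rightarrow> 'p" where
  "lift K P g S =
     (let u = (SOME u. u \<in> S) in \<Oplus>\<^bsub>P\<^esub>x\<in>{x. u x \<noteq> \<zero>\<^bsub>K\<^esub>}. u x \<odot>\<^bsub>P\<^esub> g x)"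

text \<open>External direct sum of a sequence of vector spaces.\<close>

definition dsum :: "(nat \<Rightarrow> ('k, 'm) module) \<Rightarrow> ('k, nat \<Rightarrow> 'm) module" where
  "dsum M =
     \<lparr>carrier = {f. (\<forall>n. f n \<in> carrier (M n)) \<and> finite {n. f n \<noteq> \<zero>\<^bsub>M n\<^esub>}},
      monoid.mult = undefined, one = undefined, zero = (\<lambda>n. \<zero>\<^bsub>M n\<^esub>),
      add = (\<lambda>f g n. f n \<oplus>\<^bsub>M n\<^esub> g n), smult = (\<lambda>r f n. r \<odot>\<^bsub>M n\<^esub> f n)\<rparr>"

text \<open>Transport of structure along an injection \<open>f\<close> with left inverse \<open>g\<close>.\<close>

definition transport :: "('m \<Rightarrow> 'n) \<Rightarrow> ('n \<Rightarrow> 'm) \<Rightarrow> ('k, 'm) module \<Rightarrow> ('k, 'n) module" where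
  "transport f g M =
     \<lparr>carrier = f ` carrier M, monoid.mult = (\<lambda>x y. f (g x \<otimes>\<^bsub>M\<^esub> g y)), one = f \<one>\<^bsub>M\<^esub>,
      zero = f \<zero>\<^bsub>M\<^esub>, add = (\<lambda>x y. f (g x \<oplus>\<^bsub>M\<^esub> g y)), smult = (\<lambda>r x. f (r \<odot>\<^bsub>M\<^esub> g x))\<rparr>"


section \<open>Tensor products\<close>

type_synonym ('k, 'm, 'n) tens = "('m \<times> 'n \<Rightarrow> 'k) set"
type_synonym ('k, 'm) tpow = "('m list \<Rightarrow> 'k) set"

definition tensor_relators ::
  "'k ring \<Rightarrow> ('k, 'm) module \<Rightarrow> ('k, 'n) module \<Rightarrow> ('m \<times> 'n \<Rightarrow> 'k) set" where
  "tensor_relators K M N =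
    (let F = free_module K (carrier M \<times> carrier N); e = unit_vec K in
      {e (x \<oplus>\<^bsub>M\<^esub> x', y) \<ominus>\<^bsub>F\<^esub> (e (x, y) \<oplus>\<^bsub>F\<^esub> e (x', y)) | x x' y.
         x \<in> carrier M \<and> x' \<in> carrier M \<and> y \<in> carrier N} \<union>
      {e (x, y \<oplus>\<^bsub>N\<^esub> y') \<ominus>\<^bsub>F\<^esub> (e (x, y) \<oplus>\<^bsub>F\<^esub> e (x, y')) | x y y'.
         x \<in> carrier M \<and> y \<in> carrier N \<and> y' \<in> carrier N} \<union>
      {e (r \<odot>\<^bsub>M\<^esub> x, y) \<ominus>\<^bsub>F\<^esub> r \<odot>\<^bsub>F\<^esub> e (x, y) | r x y.
         r \<in> carrier K \<and> x \<in> carrier M \<and> y \<in> carrier N} \<union>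
      {e (x, r \<odot>\<^bsub>N\<^esub> y) \<ominus>\<^bsub>F\<^esub> r \<odot>\<^bsub>F\<^esub> e (x, y) | r x y.
         r \<in> carrier K \<and> x \<in> carrier M \<and> y \<in> carrier N})"

definition tensor ::
  "'k ring \<Rightarrow> ('k, 'm) module \<Rightarrow> ('k, 'n) module \<Rightarrow> ('k, ('k, 'm, 'n) tens) module" where
  "tensor K M N = presented K (carrier M \<times> carrier N) (tensor_relators K M N)"

definition pure ::
  "'k ring \<Rightarrow> ('k, 'm) module \<Rightarrow> ('k, 'n) module \<Rightarrow> 'm \<Rightarrow> 'n \<Rightarrow> ('k, 'm, 'n) tens" where
  "pure K M N x y = gen K (carrier M \<times> carrier N) (tensor_relators K M N) (x, y)"

text \<open>\<open>tmap K M' N' f g\<close> is \<open>f \<otimes> g : M \<otimes> N \<rightarrow> M' \<otimes> N'\<close>.\<close>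

definition tmap ::
  "'k ring \<Rightarrow> ('k, 'm2) module \<Rightarrow> ('k, 'n2) module \<Rightarrow> ('m \<Rightarrow> 'm2) \<Rightarrow> ('n \<Rightarrow> 'n2)
    \<Rightarrow> ('k, 'm, 'n) tens \<Rightarrow> ('k, 'm2, 'n2) tens" where
  "tmap K M' N' f g = lift K (tensor K M' N') (\<lambda>(x, y). pure K M' N' (f x) (g y))"

text \<open>The canonical map \<open>(M \<otimes> N) \<otimes> P \<rightarrow> M \<otimes> (N \<otimes> P)\<close> and its inverse.\<close>

definition assoc ::
  "'k ring \<Rightarrow> ('k, 'm) module \<Rightarrow> ('k, 'n) module \<Rightarrow> ('k, 'p) module
    \<Rightarrow> ('k, ('k, 'm, 'n) tens, 'p) tens \<Rightarrow> ('k, 'm, ('k, 'n, 'p) tens) tens" where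
  "assoc K M N P =
    (let T = tensor K M (tensor K N P) in
     lift K T (\<lambda>(t, z). lift K T (\<lambda>(x, y). pure K M (tensor K N P) x (pure K N P y z)) t))"

definition assoc_inv ::
  "'k ring \<Rightarrow> ('k, 'm) module \<Rightarrow> ('k, 'n) module \<Rightarrow> ('k, 'p) module
    \<Rightarrow> ('k, 'm, ('k, 'n, 'p) tens) tens \<Rightarrow> ('k, ('k, 'm, 'n) tens, 'p) tens" where
  "assoc_inv K M N P =
    (let T = tensor K (tensor K M N) P in
     lift K T (\<lambda>(x, t). lift K T (\<lambda>(y, z). pure K (tensor K M N) P (pure K M N x y) z) t))"

text \<open>The \<open>n\<close>-fold tensor power, generated by the lists \<open>[x\<^sub>1, \<dots>, x\<^sub>n]\<close> standing for
  \<open>x\<^sub>1 \<otimes> \<dots> \<otimes> x\<^sub>n\<close>, subject to linearity in each position.\<close>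

definition words :: "('k, 'm) module \<Rightarrow> nat \<Rightarrow> 'm list set" where
  "words M n = {xs. length xs = n \<and> set xs \<subseteq> carrier M}"

definition tpow_relators :: "'k ring \<Rightarrow> ('k, 'm) module \<Rightarrow> nat \<Rightarrow> ('m list \<Rightarrow> 'k) set" where
  "tpow_relators K M n =
    (let F = free_module K (words M n); e = unit_vec K in
      {e (xs @ [y \<oplus>\<^bsub>M\<^esub> y'] @ zs) \<ominus>\<^bsub>F\<^esub> (e (xs @ [y] @ zs) \<oplus>\<^bsub>F\<^esub> e (xs @ [y'] @ zs)) | xs y y' zs.
         xs @ [y] @ zs \<in> words M n \<and> xs @ [y'] @ zs \<in> words M n} \<union>
      {e (xs @ [r \<odot>\<^bsub>M\<^esub> y] @ zs) \<ominus>\<^bsub>F\<^esub> r \<odot>\<^bsub>F\<^esub> e (xs @ [y] @ zs) | r xs y zs.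
         r \<in> carrier K \<and> xs @ [y] @ zs \<in> words M n})"

definition tpow :: "'k ring \<Rightarrow> ('k, 'm) module \<Rightarrow> nat \<Rightarrow> ('k, ('k, 'm) tpow) module" where
  "tpow K M n = presented K (words M n) (tpow_relators K M n)"

definition tword :: "'k ring \<Rightarrow> ('k, 'm) module \<Rightarrow> 'm list \<Rightarrow> ('k, 'm) tpow" where
  "tword K M xs = gen K (words M (length xs)) (tpow_relators K M (length xs)) xs"

text \<open>\<open>x\<^sub>1 \<otimes> \<dots> \<otimes> x\<^sub>n \<mapsto> x \<otimes> x\<^sub>1 \<otimes> \<dots> \<otimes> x\<^sub>n\<close>\<close>

definition tcons :: "'k ring \<Rightarrow> ('k, 'm) module \<Rightarrow> nat \<Rightarrow> 'm \<Rightarrow> ('k, 'm) tpow \<Rightarrow> ('k, 'm) tpow" where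
  "tcons K M n x = lift K (tpow K M (Suc n)) (\<lambda>xs. tword K M (x # xs))"


section \<open>Algebras, coalgebras and entwining structures\<close>

locale nonunital_algebra = module K R
  for K :: "'k ring" and R :: "('k, 'r) module" +
  assumes field_K: "field K"
    and mult_closed: "\<lbrakk>x \<in> carrier R; y \<in> carrier R\<rbrakk> \<Longrightarrow> x \<otimes>\<^bsub>R\<^esub> y \<in> carrier R"
    and mult_assoc: "\<lbrakk>x \<in> carrier R; y \<in> carrier R; z \<in> carrier R\<rbrakk>
      \<Longrightarrow> (x \<otimes>\<^bsub>R\<^esub> y) \<otimes>\<^bsub>R\<^esub> z = x \<otimes>\<^bsub>R\<^esub> (y \<otimes>\<^bsub>R\<^esub> z)"
    and mult_l_distr: "\<lbrakk>x \<in> carrier R; y \<in> carrier R; z \<in> carrier R\<rbrakk>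
      \<Longrightarrow> (x \<oplus>\<^bsub>R\<^esub> y) \<otimes>\<^bsub>R\<^esub> z = x \<otimes>\<^bsub>R\<^esub> z \<oplus>\<^bsub>R\<^esub> y \<otimes>\<^bsub>R\<^esub> z"
    and mult_r_distr: "\<lbrakk>x \<in> carrier R; y \<in> carrier R; z \<in> carrier R\<rbrakk>
      \<Longrightarrow> z \<otimes>\<^bsub>R\<^esub> (x \<oplus>\<^bsub>R\<^esub> y) = z \<otimes>\<^bsub>R\<^esub> x \<oplus>\<^bsub>R\<^esub> z \<otimes>\<^bsub>R\<^esub> y"
    and mult_smult_l: "\<lbrakk>r \<in> carrier K; x \<in> carrier R; y \<in> carrier R\<rbrakk>
      \<Longrightarrow> (r \<odot>\<^bsub>R\<^esub> x) \<otimes>\<^bsub>R\<^esub> y = r \<odot>\<^bsub>R\<^esub> (x \<otimes>\<^bsub>R\<^esub> y)"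
    and mult_smult_r: "\<lbrakk>r \<in> carrier K; x \<in> carrier R; y \<in> carrier R\<rbrakk>
      \<Longrightarrow> x \<otimes>\<^bsub>R\<^esub> (r \<odot>\<^bsub>R\<^esub> y) = r \<odot>\<^bsub>R\<^esub> (x \<otimes>\<^bsub>R\<^esub> y)"

locale unital_algebra = nonunital_algebra K A
  for K :: "'k ring" and A :: "('k, 'a) module" +
  assumes unit_closed: "\<one>\<^bsub>A\<^esub> \<in> carrier A"
    and unit_l: "x \<in> carrier A \<Longrightarrow> \<one>\<^bsub>A\<^esub> \<otimes>\<^bsub>A\<^esub> x = x"
    and unit_r: "x \<in> carrier A \<Longrightarrow> x \<otimes>\<^bsub>A\<^esub> \<one>\<^bsub>A\<^esub> = x"

definition product_map :: "'k ring \<Rightarrow> ('k, 'r) module \<Rightarrow> ('k, 'r, 'r) tens \<Rightarrow> 'r" where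
  "product_map K R = lift K R (\<lambda>(x, y). x \<otimes>\<^bsub>R\<^esub> y)"

locale coalgebra = module K C
  for K :: "'k ring" and C :: "('k, 'c) module"
    and Delta :: "'c \<Rightarrow> ('k, 'c, 'c) tens" and eps :: "'c \<Rightarrow> 'k" +
  assumes base_field: "field K"
    and comult_linear: "linear_map K C (tensor K C C) Delta"
    and counit_linear: "linear_map K C (ground K) eps"
    and coassoc: "c \<in> carrier C \<Longrightarrow>
      assoc K C C C (tmap K (tensor K C C) C Delta (\<lambda>x. x) (Delta c)) =
      tmap K C (tensor K C C) (\<lambda>x. x) Delta (Delta c)"
    and counit_l: "c \<in> carrier C \<Longrightarrow> lift K C (\<lambda>(x, y). eps x \<odot>\<^bsub>C\<^esub> y) (Delta c) = c"
    and counit_r: "c \<in> carrier C \<Longrightarrow> lift K C (\<lambda>(x, y). eps y \<odot>\<^bsub>C\<^esub> x) (Delta c) = c"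

locale nonunital_entwining = nonunital_algebra K R + coalgebra K C Delta eps
  for K :: "'k ring" and R :: "('k, 'r) module"
    and C :: "('k, 'c) module" and Delta eps
    and Psi :: "('k, 'c, 'r) tens \<Rightarrow> ('k, 'r, 'c) tens" +
  assumes Psi_linear: "linear_map K (tensor K C R) (tensor K R C) Psi"
    and Psi_mult: "u \<in> carrier (tensor K (tensor K C R) R) \<Longrightarrow>
      Psi (tmap K C R (\<lambda>c. c) (product_map K R) (assoc K C R R u)) =
      tmap K R C (product_map K R) (\<lambda>c. c)
        (assoc_inv K R R C
          (tmap K R (tensor K R C) (\<lambda>x. x) Psi
            (assoc K R C R (tmap K (tensor K R C) R Psi (\<lambda>x. x) u))))"
    and Psi_comult: "t \<in> carrier (tensor K C R) \<Longrightarrow>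
      tmap K R (tensor K C C) (\<lambda>x. x) Delta (Psi t) =
      assoc K R C C
        (tmap K (tensor K R C) C Psi (\<lambda>c. c)
          (assoc_inv K C R C
            (tmap K C (tensor K R C) (\<lambda>c. c) Psi
              (assoc K C C R (tmap K (tensor K C C) R Delta (\<lambda>x. x) t)))))"
    and Psi_counit: "t \<in> carrier (tensor K C R) \<Longrightarrow>
      lift K R (\<lambda>(x, c). eps c \<odot>\<^bsub>R\<^esub> x) (Psi t) = lift K R (\<lambda>(c, x). eps c \<odot>\<^bsub>R\<^esub> x) t"

locale entwining_structure = unital_algebra K A + nonunital_entwining K A C Delta eps psi
  for K :: "'k ring" and A :: "('k, 'a) module"
    and C :: "('k, 'c) module" and Delta eps
    and psi :: "('k, 'c, 'a) tens \<Rightarrow> ('k, 'a, 'c) tens" +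
  assumes psi_unit: "c \<in> carrier C \<Longrightarrow> psi (pure K C A c \<one>\<^bsub>A\<^esub>) = pure K A C \<one>\<^bsub>A\<^esub> c"


section \<open>Differential graded entwining structures\<close>

definition sgn_pow :: "'k ring \<Rightarrow> nat \<Rightarrow> 'k" where
  "sgn_pow K n = (\<ominus>\<^bsub>K\<^esub> \<one>\<^bsub>K\<^esub>) [^]\<^bsub>K\<^esub> n"

text \<open>A graded algebra \<open>R\<close> is the internal direct sum of its homogeneous parts \<open>gr n\<close>.\<close>

locale dg_algebra = nonunital_algebra K R
  for K :: "'k ring" and R :: "('k, 'r) module"
    and gr :: "nat \<Rightarrow> 'r set" and D :: "'r \<Rightarrow> 'r" +
  assumes gr_submodule: "submodule (gr n) K R"
    and gr_direct_sum: "x \<in> carrier R \<Longrightarrow>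
      \<exists>!f. (\<forall>n. f n \<in> gr n) \<and> finite {n. f n \<noteq> \<zero>\<^bsub>R\<^esub>} \<and>
           x = (\<Oplus>\<^bsub>R\<^esub>n\<in>{n. f n \<noteq> \<zero>\<^bsub>R\<^esub>}. f n)"
    and gr_mult: "\<lbrakk>x \<in> gr m; y \<in> gr n\<rbrakk> \<Longrightarrow> x \<otimes>\<^bsub>R\<^esub> y \<in> gr (m + n)"
    and D_linear: "linear_map K R R D"
    and D_degree: "x \<in> gr n \<Longrightarrow> D x \<in> gr (Suc n)"
    and D_square: "x \<in> carrier R \<Longrightarrow> D (D x) = \<zero>\<^bsub>R\<^esub>"
    and D_Leibniz: "\<lbrakk>x \<in> gr n; y \<in> carrier R\<rbrakk> \<Longrightarrow>
      D (x \<otimes>\<^bsub>R\<^esub> y) = D x \<otimes>\<^bsub>R\<^esub> y \<oplus>\<^bsub>R\<^esub> sgn_pow K n \<odot>\<^bsub>R\<^esub> (x \<otimes>\<^bsub>R\<^esub> D y)"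

locale dg_entwining = dg_algebra K R gr D + nonunital_entwining K R C Delta eps Psi
  for K :: "'k ring" and R :: "('k, 'r) module" and gr D
    and C :: "('k, 'c) module" and Delta eps
    and Psi :: "('k, 'c, 'r) tens \<Rightarrow> ('k, 'r, 'c) tens" +
  assumes Psi_degree: "\<lbrakk>c \<in> carrier C; x \<in> gr n\<rbrakk> \<Longrightarrow>
      Psi (pure K C R c x) \<in>
        lin_span K (tensor K R C) {pure K R C x' c' | x' c'. x' \<in> gr n \<and> c' \<in> carrier C}"
    and Psi_D: "t \<in> carrier (tensor K C R) \<Longrightarrow>
      tmap K R C D (\<lambda>c. c) (Psi t) = Psi (tmap K C R (\<lambda>c. c) D t)"

locale dg_entwining_over =
    entwining_structure K A C Delta eps psi + dg: dg_entwining K R gr D C Delta eps Psi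
  for K :: "'k ring" and A :: "('k, 'a) module"
    and C :: "('k, 'c) module" and Delta eps
    and psi :: "('k, 'c, 'a) tens \<Rightarrow> ('k, 'a, 'c) tens"
    and R :: "('k, 'r) module" and gr D
    and Psi :: "('k, 'c, 'r) tens \<Rightarrow> ('k, 'r, 'c) tens"
    and rho :: "'a \<Rightarrow> 'r" +
  assumes rho_degree: "a \<in> carrier A \<Longrightarrow> rho a \<in> gr 0"
    and rho_linear: "linear_map K A R rho"
    and rho_mult: "\<lbrakk>a \<in> carrier A; b \<in> carrier A\<rbrakk> \<Longrightarrow> rho (a \<otimes>\<^bsub>A\<^esub> b) = rho a \<otimes>\<^bsub>R\<^esub> rho b"
    and rho_Psi: "t \<in> carrier (tensor K C A) \<Longrightarrow>
      tmap K R C rho (\<lambda>c. c) (psi t) = Psi (tmap K C R (\<lambda>c. c) rho t)"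


section \<open>The universal differential graded algebra \<open>\<Omega>A\<close>\<close>

text \<open>The pair \<open>(a, \<mu>)\<close> stands for \<open>a + \<mu>\<close> in \<open>A \<oplus> k\<close>.\<close>

definition unitization :: "'k ring \<Rightarrow> ('k, 'a) module \<Rightarrow> ('k, 'a \<times> 'k) module" where
  "unitization K A =
     \<lparr>carrier = carrier A \<times> carrier K,
      monoid.mult = (\<lambda>(a, \<mu>) (a', \<nu>). (a \<otimes>\<^bsub>A\<^esub> a' \<oplus>\<^bsub>A\<^esub> \<mu> \<odot>\<^bsub>A\<^esub> a' \<oplus>\<^bsub>A\<^esub> \<nu> \<odot>\<^bsub>A\<^esub> a, \<mu> \<otimes>\<^bsub>K\<^esub> \<nu>)),
      one = (\<zero>\<^bsub>A\<^esub>, \<one>\<^bsub>K\<^esub>), zero = (\<zero>\<^bsub>A\<^esub>, \<zero>\<^bsub>K\<^esub>),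
      add = (\<lambda>(a, \<mu>) (a', \<nu>). (a \<oplus>\<^bsub>A\<^esub> a', \<mu> \<oplus>\<^bsub>K\<^esub> \<nu>)),
      smult = (\<lambda>r (a, \<mu>). (r \<odot>\<^bsub>A\<^esub> a, r \<otimes>\<^bsub>K\<^esub> \<mu>))\<rparr>"

text \<open>The left summand of this type holds the elements of \<open>\<Omega>\<^sup>0A = A\<close>, the right one those
  of \<open>\<Omega>\<^sup>nA\<close> for \<open>n > 0\<close>.\<close>

type_synonym ('k, 'a) form = "'a + ('k, 'a \<times> 'k, ('k, 'a) tpow) tens"

definition Omega_deg :: "'k ring \<Rightarrow> ('k, 'a) module \<Rightarrow> nat \<Rightarrow> ('k, ('k, 'a) form) module" where
  "Omega_deg K A n =
     (if n = 0 then transport Inl projl A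
      else transport Inr projr (tensor K (unitization K A) (tpow K A n)))"

text \<open>\<open>form K A (a\<^sub>0, \<mu>) [a\<^sub>1, \<dots>, a\<^sub>n]\<close> is \<open>(a\<^sub>0 + \<mu>) da\<^sub>1 \<dots> da\<^sub>n\<close>; for \<open>n = 0\<close> it is used with
  \<open>\<mu> = 0\<close> only.\<close>

definition form :: "'k ring \<Rightarrow> ('k, 'a) module \<Rightarrow> 'a \<times> 'k \<Rightarrow> 'a list \<Rightarrow> ('k, 'a) form" where
  "form K A p as =
     (if as = [] then Inl (fst p)
      else Inr (pure K (unitization K A) (tpow K A (length as)) p (tword K A as)))"

text \<open>The linear map on \<open>\<Omega>\<^sup>nA\<close> (any \<open>n\<close>) sending \<open>(a\<^sub>0 + \<mu>) da\<^sub>1 \<dots> da\<^sub>n\<close> to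
  \<open>g (a\<^sub>0, \<mu>) [a\<^sub>1, \<dots>, a\<^sub>n]\<close>, with \<open>\<mu> = 0\<close> when \<open>n = 0\<close>.\<close>

definition form_lift ::
  "'k ring \<Rightarrow> ('k, 'p) module \<Rightarrow> ('a \<times> 'k \<Rightarrow> 'a list \<Rightarrow> 'p) \<Rightarrow> ('k, 'a) form \<Rightarrow> 'p" where
  "form_lift K P g w =
     (case w of Inl a \<Rightarrow> g (a, \<zero>\<^bsub>K\<^esub>) [] | Inr t \<Rightarrow> lift K P (\<lambda>(p, s). lift K P (g p) s) t)"

text \<open>\<open>merge A l [p\<^sub>1, \<dots>, p\<^sub>i] = [p\<^sub>1, \<dots>, p\<^sub>l p\<^sub>l\<^sub>+\<^sub>1, \<dots>, p\<^sub>i]\<close>, with \<open>1 \<le> l < i\<close>\<close>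

definition merge :: "('k, 'a) module \<Rightarrow> nat \<Rightarrow> 'a list \<Rightarrow> 'a list" where
  "merge A l ps = take (l - 1) ps @ [ps ! (l - 1) \<otimes>\<^bsub>A\<^esub> ps ! l] @ drop (l + 1) ps"

text \<open>The product of \<open>(p\<^sub>0 + \<mu>) dp\<^sub>1 \<dots> dp\<^sub>i\<close> and \<open>(q\<^sub>0 + \<nu>) dq\<^sub>1 \<dots> dq\<^sub>j\<close>.\<close>

definition form_mult ::
  "'k ring \<Rightarrow> ('k, 'a) module \<Rightarrow> 'a \<times> 'k \<Rightarrow> 'a list \<Rightarrow> 'a \<times> 'k \<Rightarrow> 'a list \<Rightarrow> ('k, 'a) form" where
  "form_mult K A p ps q qs =
    (let i = length ps; W = Omega_deg K A (i + length qs); (q0, \<nu>) = q in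
     if i = 0
     then form K A (fst p \<otimes>\<^bsub>A\<^esub> q0 \<oplus>\<^bsub>A\<^esub> \<nu> \<odot>\<^bsub>A\<^esub> fst p, \<zero>\<^bsub>K\<^esub>) qs
     else form K A p (butlast ps @ [last ps \<otimes>\<^bsub>A\<^esub> q0] @ qs)
       \<oplus>\<^bsub>W\<^esub> (\<Oplus>\<^bsub>W\<^esub>l\<in>{1..<i}. sgn_pow K (i - l) \<odot>\<^bsub>W\<^esub> form K A p (merge A l ps @ [q0] @ qs))
       \<oplus>\<^bsub>W\<^esub> sgn_pow K i \<odot>\<^bsub>W\<^esub>
             form K A (p \<otimes>\<^bsub>unitization K A\<^esub> (hd ps, \<zero>\<^bsub>K\<^esub>)) (tl ps @ [q0] @ qs)
       \<oplus>\<^bsub>W\<^esub> \<nu> \<odot>\<^bsub>W\<^esub> form K A p (ps @ qs))"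

definition Omega_mult ::
  "'k ring \<Rightarrow> ('k, 'a) module \<Rightarrow> nat \<Rightarrow> nat \<Rightarrow> ('k, 'a) form \<Rightarrow> ('k, 'a) form \<Rightarrow> ('k, 'a) form" where
  "Omega_mult K A i j x y =
    (let W = Omega_deg K A (i + j) in
     form_lift K W (\<lambda>p ps. form_lift K W (form_mult K A p ps) y) x)"

definition Omega :: "'k ring \<Rightarrow> ('k, 'a) module \<Rightarrow> ('k, nat \<Rightarrow> ('k, 'a) form) module" where
  "Omega K A = (dsum (Omega_deg K A))
     \<lparr>monoid.mult := (\<lambda>x y n. \<Oplus>\<^bsub>Omega_deg K A n\<^esub>i\<in>{..n}. Omega_mult K A i (n - i) (x i) (y (n - i)))\<rparr>"

definition Omega_incl ::
  "'k ring \<Rightarrow> ('k, 'a) module \<Rightarrow> nat \<Rightarrow> ('k, 'a) form \<Rightarrow> nat \<Rightarrow> ('k, 'a) form" where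
  "Omega_incl K A n w = (\<lambda>m. if m = n then w else \<zero>\<^bsub>Omega_deg K A m\<^esub>)"

definition Omega_gr :: "'k ring \<Rightarrow> ('k, 'a) module \<Rightarrow> nat \<Rightarrow> (nat \<Rightarrow> ('k, 'a) form) set" where
  "Omega_gr K A n = Omega_incl K A n ` carrier (Omega_deg K A n)"

definition Omega_d ::
  "'k ring \<Rightarrow> ('k, 'a) module \<Rightarrow> (nat \<Rightarrow> ('k, 'a) form) \<Rightarrow> nat \<Rightarrow> ('k, 'a) form" where
  "Omega_d K A x n = (case n of
       0 \<Rightarrow> \<zero>\<^bsub>Omega_deg K A 0\<^esub>
     | Suc m \<Rightarrow> form_lift K (Omega_deg K A n)
                 (\<lambda>p as. form K A (\<zero>\<^bsub>A\<^esub>, \<one>\<^bsub>K\<^esub>) (fst p # as)) (x m))"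

text \<open>The identity map \<open>A \<rightarrow> \<Omega>\<^sup>0A = A\<close>.\<close>

definition Omega_id :: "'k ring \<Rightarrow> ('k, 'a) module \<Rightarrow> 'a \<Rightarrow> nat \<Rightarrow> ('k, 'a) form" where
  "Omega_id K A a = Omega_incl K A 0 (Inl a)"


section \<open>The map \<open>\<psi>\<close>-hat\<close>

text \<open>\<open>psi_iter K A C psi [a\<^sub>1, \<dots>, a\<^sub>m] c\<close> is the image
  \<open>a\<^sub>1\<^sub>\<psi> \<otimes> \<dots> \<otimes> a\<^sub>m\<^sub>\<psi> \<otimes> c\<^sup>\<psi>\<close> of \<open>c \<otimes> a\<^sub>1 \<otimes> \<dots> \<otimes> a\<^sub>m\<close> under the \<open>m\<close>-fold iteration of \<open>psi\<close>,
  which moves \<open>c\<close> past \<open>a\<^sub>1\<close> first.\<close>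

primrec psi_iter ::
  "'k ring \<Rightarrow> ('k, 'a) module \<Rightarrow> ('k, 'c) module \<Rightarrow> (('k, 'c, 'a) tens \<Rightarrow> ('k, 'a, 'c) tens)
    \<Rightarrow> 'a list \<Rightarrow> 'c \<Rightarrow> ('k, ('k, 'a) tpow, 'c) tens" where
  "psi_iter K A C psi [] c = pure K (tpow K A 0) C (tword K A []) c"
| "psi_iter K A C psi (a # as) c =
    (let n = length as in
     lift K (tensor K (tpow K A (Suc n)) C)
       (\<lambda>(a', c'). tmap K (tpow K A (Suc n)) C (tcons K A n a') (\<lambda>x. x) (psi_iter K A C psi as c'))
       (psi (pure K C A c a)))"

text \<open>The value of \<open>\<psi>\<close>-hat on \<open>c \<otimes> (a\<^sub>0 + \<mu>) da\<^sub>1 \<dots> da\<^sub>n\<close>.\<close>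

definition psi_hat_form ::
  "'k ring \<Rightarrow> ('k, 'a) module \<Rightarrow> ('k, 'c) module \<Rightarrow> (('k, 'c, 'a) tens \<Rightarrow> ('k, 'a, 'c) tens)
    \<Rightarrow> 'c \<Rightarrow> 'a \<times> 'k \<Rightarrow> 'a list \<Rightarrow> ('k, nat \<Rightarrow> ('k, 'a) form, 'c) tens" where
  "psi_hat_form K A C psi c p as =
    (let n = length as; W = Omega K A; T = tensor K W C; (a0, \<mu>) = p in
     tmap K W C
       (lift K W (\<lambda>bs. Omega_incl K A n (form K A (hd bs, \<zero>\<^bsub>K\<^esub>) (tl bs)))) (\<lambda>x. x)
       (psi_iter K A C psi (a0 # as) c)
     \<oplus>\<^bsub>T\<^esub> \<mu> \<odot>\<^bsub>T\<^esub>
     tmap K W C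
       (lift K W (\<lambda>bs. Omega_incl K A n (form K A (\<zero>\<^bsub>A\<^esub>, \<one>\<^bsub>K\<^esub>) bs))) (\<lambda>x. x)
       (psi_iter K A C psi as c))"

definition psi_hat ::
  "'k ring \<Rightarrow> ('k, 'a) module \<Rightarrow> ('k, 'c) module \<Rightarrow> (('k, 'c, 'a) tens \<Rightarrow> ('k, 'a, 'c) tens)
    \<Rightarrow> ('k, 'c, nat \<Rightarrow> ('k, 'a) form) tens \<Rightarrow> ('k, nat \<Rightarrow> ('k, 'a) form, 'c) tens" where
  "psi_hat K A C psi =
    (let T = tensor K (Omega K A) C in
     lift K T (\<lambda>(c, x). \<Oplus>\<^bsub>T\<^esub>n\<in>{n. x n \<noteq> \<zero>\<^bsub>Omega_deg K A n\<^esub>}.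
                          form_lift K T (psi_hat_form K A C psi c) (x n)))"

end

theory Submission
  imports Defs
begin

text \<open>
  \<^bold>\<open>The product.\<close> Write \<open>L\<^sub>p\<close> for left multiplication by \<open>p \<in> A \<oplus> k\<close> on \<open>\<Omega>A\<close> (\<open>lop\<close>). Left
  multiplication by \<open>da\<close> has to be the commutator \<open>\<delta>\<^sub>a = d L\<^sub>a - L\<^sub>a d\<close> (\<open>delta\<close>), because
  \<open>da \<cdot> y = d(a y) - a dy\<close>. So \<open>(a\<^sub>0 + \<mu>) da\<^sub>1 \<dots> da\<^sub>n\<close> must act as the operator
  \<open>L\<^bsub>a\<^sub>0 + \<mu>\<^esub> \<delta>\<^bsub>a\<^sub>1\<^esub> \<dots> \<delta>\<^bsub>a\<^sub>n\<^esub>\<close> (\<open>lam\<close>). Expanding this operator on a form yields exactly the explicit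
  product formula (\<open>lam_wform\<close>), which shows at one stroke that the formula is well defined on the
  tensor products. Associativity then means that right multiplications commute with the
  operators \<open>L\<^sub>p\<close> and \<open>\<delta>\<^sub>a\<close>, and the only computation in it is
  \<open>\<delta>\<^sub>a L\<^bsub>q + \<nu>\<^esub> = \<delta>\<^bsub>aq\<^esub> - L\<^sub>a \<delta>\<^sub>q + \<nu> \<delta>\<^sub>a\<close> (\<open>delta_lop\<close>). The Leibniz rule comes from
  \<open>d \<delta>\<^sub>a = - \<delta>\<^sub>a d\<close> and \<open>d L\<^sub>a = \<delta>\<^sub>a + L\<^sub>a d\<close>.

  \<^bold>\<open>The entwining.\<close> Each entwining axiom can be read as a condition on one algebra element \<open>x\<close>, the
  other arguments being universally quantified. The elements satisfying the multiplicativity axiom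
  form a subalgebra (\<open>mult_law_mult\<close>); where that axiom holds throughout, so do the elements
  satisfying the comultiplication axiom or the counit axiom. As \<open>\<Omega>A\<close> is generated by \<open>A\<close> and \<open>dA\<close>
  (\<open>generation\<close>), it is enough to treat \<open>a\<close> and \<open>da\<close>. The map \<open>\<psi>\<close>-hat extends \<open>\<psi>\<close>, commutes with \<open>d\<close>
  and moves past \<open>L\<^sub>a\<close> (\<open>cross_iota\<close>, \<open>cross_d\<close>, \<open>cross_lop\<close>), hence also past \<open>\<delta>\<^sub>a\<close>; this is
  multiplicativity for \<open>a\<close> and \<open>da\<close>. The other two axioms are inherited along any linear map that is
  compatible with the entwining maps (\<open>entwining_morphism\<close>), which is applied to \<open>A \<rightarrow> \<Omega>\<^sup>0A\<close> and to \<open>d\<close>.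

  \<^bold>\<open>Calculating with tensors.\<close> For a bilinear \<open>\<beta>\<close> and \<open>t = \<Sum> x\<^sub>i \<otimes> y\<^sub>i\<close> the term \<open>tlift P \<beta> t\<close> denotes
  \<open>\<Sum> \<beta> x\<^sub>i y\<^sub>i\<close>, so that Sweedler-style sums become nested terms \<open>tlift\<close>. These are manipulated by
  moving linear maps inside (\<open>tlift_fusion\<close>), by exchanging independent sums (\<open>tlift_swap\<close>) and by
  comparing linear maps on pure tensors (\<open>tensor_eqI\<close>).
\<close>

section \<open>Vector spaces\<close>

locale scalars = cring K for K :: "'k ring"
begin

abbreviation vs :: "('k, 'm) module \<Rightarrow> bool" where
  "vs M \<equiv> module K M"

lemma vs_add: "vs M \<Longrightarrow> x \<in> carrier M \<Longrightarrow> y \<in> carrier M \<Longrightarrow> x \<oplus>\<^bsub>M\<^esub> y \<in> carrier M"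
  and vs_minus: "vs M \<Longrightarrow> x \<in> carrier M \<Longrightarrow> y \<in> carrier M \<Longrightarrow> x \<ominus>\<^bsub>M\<^esub> y \<in> carrier M"
  and vs_neg: "vs M \<Longrightarrow> x \<in> carrier M \<Longrightarrow> \<ominus>\<^bsub>M\<^esub> x \<in> carrier M"
  and vs_zero: "vs M \<Longrightarrow> \<zero>\<^bsub>M\<^esub> \<in> carrier M"
  and vs_smult: "vs M \<Longrightarrow> r \<in> carrier K \<Longrightarrow> x \<in> carrier M \<Longrightarrow> r \<odot>\<^bsub>M\<^esub> x \<in> carrier M"
  and vs_smult_zero: "vs M \<Longrightarrow> r \<in> carrier K \<Longrightarrow> r \<odot>\<^bsub>M\<^esub> \<zero>\<^bsub>M\<^esub> = \<zero>\<^bsub>M\<^esub>"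
  and vs_zero_smult: "vs M \<Longrightarrow> x \<in> carrier M \<Longrightarrow> \<zero>\<^bsub>K\<^esub> \<odot>\<^bsub>M\<^esub> x = \<zero>\<^bsub>M\<^esub>"
  and vs_one_smult: "vs M \<Longrightarrow> x \<in> carrier M \<Longrightarrow> \<one>\<^bsub>K\<^esub> \<odot>\<^bsub>M\<^esub> x = x"
  and vs_l_zero: "vs M \<Longrightarrow> x \<in> carrier M \<Longrightarrow> \<zero>\<^bsub>M\<^esub> \<oplus>\<^bsub>M\<^esub> x = x"
  and vs_r_zero: "vs M \<Longrightarrow> x \<in> carrier M \<Longrightarrow> x \<oplus>\<^bsub>M\<^esub> \<zero>\<^bsub>M\<^esub> = x"
  using module.axioms(2)[of K M]
  by (auto simp: module.smult_closed module.smult_r_null module.smult_l_null module.smult_one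
      abelian_group.minus_closed abelian_groupE abelian_group.a_inv_closed abelian_group_def
      abelian_monoid.r_zero)

lemmas vs_simps [simp] = vs_add vs_minus vs_neg vs_zero vs_smult vs_smult_zero vs_zero_smult
  vs_one_smult vs_l_zero vs_r_zero

lemma vsI:
  assumes "\<And>x y. x \<in> carrier M \<Longrightarrow> y \<in> carrier M \<Longrightarrow> x \<oplus>\<^bsub>M\<^esub> y \<in> carrier M"
    "\<zero>\<^bsub>M\<^esub> \<in> carrier M"
    "\<And>r x. r \<in> carrier K \<Longrightarrow> x \<in> carrier M \<Longrightarrow> r \<odot>\<^bsub>M\<^esub> x \<in> carrier M"
    "\<And>x y z. x \<in> carrier M \<Longrightarrow> y \<in> carrier M \<Longrightarrow> z \<in> carrier M
      \<Longrightarrow> (x \<oplus>\<^bsub>M\<^esub> y) \<oplus>\<^bsub>M\<^esub> z = x \<oplus>\<^bsub>M\<^esub> (y \<oplus>\<^bsub>M\<^esub> z)"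
    "\<And>x y. x \<in> carrier M \<Longrightarrow> y \<in> carrier M \<Longrightarrow> x \<oplus>\<^bsub>M\<^esub> y = y \<oplus>\<^bsub>M\<^esub> x"
    "\<And>x. x \<in> carrier M \<Longrightarrow> \<zero>\<^bsub>M\<^esub> \<oplus>\<^bsub>M\<^esub> x = x"
    "\<And>x. x \<in> carrier M \<Longrightarrow> (\<ominus>\<^bsub>K\<^esub> \<one>\<^bsub>K\<^esub>) \<odot>\<^bsub>M\<^esub> x \<oplus>\<^bsub>M\<^esub> x = \<zero>\<^bsub>M\<^esub>"
    "\<And>r s x. r \<in> carrier K \<Longrightarrow> s \<in> carrier K \<Longrightarrow> x \<in> carrier M
      \<Longrightarrow> (r \<oplus>\<^bsub>K\<^esub> s) \<odot>\<^bsub>M\<^esub> x = r \<odot>\<^bsub>M\<^esub> x \<oplus>\<^bsub>M\<^esub> s \<odot>\<^bsub>M\<^esub> x"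
    "\<And>r x y. r \<in> carrier K \<Longrightarrow> x \<in> carrier M \<Longrightarrow> y \<in> carrier M
      \<Longrightarrow> r \<odot>\<^bsub>M\<^esub> (x \<oplus>\<^bsub>M\<^esub> y) = r \<odot>\<^bsub>M\<^esub> x \<oplus>\<^bsub>M\<^esub> r \<odot>\<^bsub>M\<^esub> y"
    "\<And>r s x. r \<in> carrier K \<Longrightarrow> s \<in> carrier K \<Longrightarrow> x \<in> carrier M
      \<Longrightarrow> (r \<otimes>\<^bsub>K\<^esub> s) \<odot>\<^bsub>M\<^esub> x = r \<odot>\<^bsub>M\<^esub> (s \<odot>\<^bsub>M\<^esub> x)"
    "\<And>x. x \<in> carrier M \<Longrightarrow> \<one>\<^bsub>K\<^esub> \<odot>\<^bsub>M\<^esub> x = x"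
  shows "vs M"
proof (rule moduleI)
  show "abelian_group M"
    by (rule abelian_groupI; (rule assms; assumption)?) (use assms(3,7) a_inv_closed one_closed in blast)
qed (use assms is_cring in auto)

section \<open>Linear maps\<close>

text \<open>
  The two spaces are part of the predicate, so that one linearity fact carries all that is needed to
  apply it.
\<close>

definition lin :: "('k, 'm) module \<Rightarrow> ('k, 'n) module \<Rightarrow> ('m \<Rightarrow> 'n) \<Rightarrow> bool" where
  "lin M N f \<longleftrightarrow> vs M \<and> vs N \<and> linear_map K M N f"

lemma linI:
  assumes "vs M" "vs N" "\<And>x. x \<in> carrier M \<Longrightarrow> f x \<in> carrier N"
    "\<And>x y. x \<in> carrier M \<Longrightarrow> y \<in> carrier M \<Longrightarrow> f (x \<oplus>\<^bsub>M\<^esub> y) = f x \<oplus>\<^bsub>N\<^esub> f y"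
    "\<And>r x. r \<in> carrier K \<Longrightarrow> x \<in> carrier M \<Longrightarrow> f (r \<odot>\<^bsub>M\<^esub> x) = r \<odot>\<^bsub>N\<^esub> f x"
  shows "lin M N f"
  using assms by (auto simp: lin_def linear_map_def hom_def)

lemma lin_vs1: "lin M N f \<Longrightarrow> vs M" and lin_vs2: "lin M N f \<Longrightarrow> vs N"
  and lin_closed: "lin M N f \<Longrightarrow> x \<in> carrier M \<Longrightarrow> f x \<in> carrier N"
  and lin_add: "lin M N f \<Longrightarrow> x \<in> carrier M \<Longrightarrow> y \<in> carrier M \<Longrightarrow> f (x \<oplus>\<^bsub>M\<^esub> y) = f x \<oplus>\<^bsub>N\<^esub> f y"
  and lin_smult: "lin M N f \<Longrightarrow> r \<in> carrier K \<Longrightarrow> x \<in> carrier M \<Longrightarrow> f (r \<odot>\<^bsub>M\<^esub> x) = r \<odot>\<^bsub>N\<^esub> f x"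
  by (auto simp: lin_def linear_map_def hom_def)

lemma lin_zero: assumes "lin M N f" shows "f \<zero>\<^bsub>M\<^esub> = \<zero>\<^bsub>N\<^esub>"
  using lin_smult[OF assms zero_closed vs_zero[OF lin_vs1[OF assms]]]
  by (simp add: lin_vs1[OF assms] lin_vs2[OF assms] lin_closed[OF assms])

lemma vs_neg_eq: "vs M \<Longrightarrow> x \<in> carrier M \<Longrightarrow> \<ominus>\<^bsub>M\<^esub> x = (\<ominus>\<^bsub>K\<^esub> \<one>\<^bsub>K\<^esub>) \<odot>\<^bsub>M\<^esub> x"
  using module.smult_l_minus[of K M "\<one>\<^bsub>K\<^esub>" x] by simp

lemma vs_minus_eq: "vs M \<Longrightarrow> x \<in> carrier M \<Longrightarrow> y \<in> carrier M \<Longrightarrow>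
    x \<ominus>\<^bsub>M\<^esub> y = x \<oplus>\<^bsub>M\<^esub> (\<ominus>\<^bsub>K\<^esub> \<one>\<^bsub>K\<^esub>) \<odot>\<^bsub>M\<^esub> y"
  by (simp add: a_minus_def vs_neg_eq)

lemma vs_minus_self: "vs M \<Longrightarrow> x \<in> carrier M \<Longrightarrow> x \<ominus>\<^bsub>M\<^esub> x = \<zero>\<^bsub>M\<^esub>"
  using module.axioms(2)[of K M] by (simp add: a_minus_def abelian_group.r_neg)

lemma vs_minus_zero: "vs M \<Longrightarrow> x \<in> carrier M \<Longrightarrow> x \<ominus>\<^bsub>M\<^esub> \<zero>\<^bsub>M\<^esub> = x"
  by (simp add: vs_minus_eq)

lemma vs_eqI: assumes "vs M" "x \<in> carrier M" "y \<in> carrier M" "x \<ominus>\<^bsub>M\<^esub> y = \<zero>\<^bsub>M\<^esub>" shows "x = y"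
proof -
  interpret module K M by fact
  have "x \<oplus>\<^bsub>M\<^esub> \<ominus>\<^bsub>M\<^esub> y = \<zero>\<^bsub>M\<^esub>" using assms(4) by (simp add: a_minus_def)
  then show ?thesis using assms(2,3) by (metis M.a_inv_closed M.minus_equality M.minus_minus)
qed

lemma lin_neg: "lin M N f \<Longrightarrow> x \<in> carrier M \<Longrightarrow> f (\<ominus>\<^bsub>M\<^esub> x) = \<ominus>\<^bsub>N\<^esub> f x"
  by (simp add: vs_neg_eq lin_vs1 lin_vs2 lin_smult lin_closed)

lemma lin_minus: "lin M N f \<Longrightarrow> x \<in> carrier M \<Longrightarrow> y \<in> carrier M \<Longrightarrow> f (x \<ominus>\<^bsub>M\<^esub> y) = f x \<ominus>\<^bsub>N\<^esub> f y"
  by (simp add: a_minus_def lin_neg lin_vs1 lin_add)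

lemma vs_finsum_closed [simp]:
  "vs M \<Longrightarrow> (\<And>x. x \<in> I \<Longrightarrow> f x \<in> carrier M) \<Longrightarrow> finsum M f I \<in> carrier M"
  by (intro abelian_monoid.finsum_closed) (auto simp: module_def abelian_group_def)

lemma vs_finsum_insert:
  assumes "vs M" "finite I" "i \<notin> I" "f i \<in> carrier M" "\<And>x. x \<in> I \<Longrightarrow> f x \<in> carrier M"
  shows "finsum M f (insert i I) = f i \<oplus>\<^bsub>M\<^esub> finsum M f I"
  using assms by (intro abelian_monoid.finsum_insert) (auto simp: module_def abelian_group_def)

lemma vs_finsum_empty: "vs M \<Longrightarrow> finsum M f {} = \<zero>\<^bsub>M\<^esub>"
  by (intro abelian_monoid.finsum_empty) (auto simp: module_def abelian_group_def)

lemma vs_finsum_cong: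
  "vs M \<Longrightarrow> (\<And>x. x \<in> I \<Longrightarrow> f x = g x) \<Longrightarrow> (\<And>x. x \<in> I \<Longrightarrow> g x \<in> carrier M) \<Longrightarrow> finsum M f I = finsum M g I"
  by (intro abelian_monoid.finsum_cong') (auto simp: module_def abelian_group_def)

lemma vs_finsum_mono:
  assumes "vs M" "finite J" "I \<subseteq> J" "\<And>x. x \<in> J - I \<Longrightarrow> f x = \<zero>\<^bsub>M\<^esub>" "\<And>x. x \<in> J \<Longrightarrow> f x \<in> carrier M"
  shows "finsum M f I = finsum M f J"
proof -
  interpret module K M by fact
  show ?thesis by (rule M.add.finprod_mono_neutral_cong_left) (use assms in auto)
qed

lemma lin_finsum:
  assumes "lin M N f" "finite I" "\<And>i. i \<in> I \<Longrightarrow> h i \<in> carrier M"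
  shows "f (finsum M h I) = finsum N (\<lambda>i. f (h i)) I"
  using assms(2,3)
proof (induction I)
  case empty
  then show ?case using assms(1) by (simp add: vs_finsum_empty lin_vs1 lin_vs2 lin_zero)
next
  case (insert i I)
  then show ?case
    using lin_vs1[OF assms(1)] lin_vs2[OF assms(1)] lin_closed[OF assms(1)]
    by (simp add: vs_finsum_insert lin_add[OF assms(1)])
qed

lemma vs_add_swap:
  assumes "vs M" "a \<in> carrier M" "b \<in> carrier M" "c \<in> carrier M" "d \<in> carrier M"
  shows "(a \<oplus>\<^bsub>M\<^esub> b) \<oplus>\<^bsub>M\<^esub> (c \<oplus>\<^bsub>M\<^esub> d) = (a \<oplus>\<^bsub>M\<^esub> c) \<oplus>\<^bsub>M\<^esub> (b \<oplus>\<^bsub>M\<^esub> d)"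
proof -
  interpret module K M by fact
  show ?thesis using assms by (simp add: M.a_ac)
qed

lemma vs_smult_comm:
  "vs M \<Longrightarrow> r \<in> carrier K \<Longrightarrow> s \<in> carrier K \<Longrightarrow> x \<in> carrier M \<Longrightarrow>
    r \<odot>\<^bsub>M\<^esub> (s \<odot>\<^bsub>M\<^esub> x) = s \<odot>\<^bsub>M\<^esub> (r \<odot>\<^bsub>M\<^esub> x)"
  by (metis m_comm module.smult_assoc1)

lemma vs_smult_add:
  "vs M \<Longrightarrow> r \<in> carrier K \<Longrightarrow> x \<in> carrier M \<Longrightarrow> y \<in> carrier M \<Longrightarrow>
    r \<odot>\<^bsub>M\<^esub> (x \<oplus>\<^bsub>M\<^esub> y) = r \<odot>\<^bsub>M\<^esub> x \<oplus>\<^bsub>M\<^esub> r \<odot>\<^bsub>M\<^esub> y"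
  by (rule module.smult_r_distr)

lemma lin_id: "vs M \<Longrightarrow> lin M M (\<lambda>x. x)"
  by (auto intro: linI)

lemma lin_comp: "lin M N f \<Longrightarrow> lin L M g \<Longrightarrow> lin L N (\<lambda>x. f (g x))"
  by (rule linI) (auto simp: lin_vs1 lin_vs2 lin_closed lin_add lin_smult)

lemma lin_const0: "vs M \<Longrightarrow> vs N \<Longrightarrow> lin M N (\<lambda>x. \<zero>\<^bsub>N\<^esub>)"
  by (auto intro: linI)

lemma lin_add_fun: "lin M N f \<Longrightarrow> lin M N g \<Longrightarrow> lin M N (\<lambda>x. f x \<oplus>\<^bsub>N\<^esub> g x)"
  by (rule linI) (auto simp: lin_vs1 lin_vs2 lin_closed lin_add lin_smult vs_add_swap vs_smult_add)

lemma lin_smult_fun: "r \<in> carrier K \<Longrightarrow> lin M N f \<Longrightarrow> lin M N (\<lambda>x. r \<odot>\<^bsub>N\<^esub> f x)"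
  by (rule linI) (auto simp: lin_vs1 lin_vs2 lin_closed lin_add lin_smult vs_smult_add
      intro: vs_smult_comm)

lemma lin_cong:
  assumes f: "lin M N f" and eq: "\<And>x. x \<in> carrier M \<Longrightarrow> f x = g x"
  shows "lin M N g"
  using f by (intro linI) (auto simp: eq[symmetric] lin_vs1[OF f] lin_vs2[OF f] lin_closed lin_add lin_smult)

lemma lin_minus_fun: "lin M N f \<Longrightarrow> lin M N g \<Longrightarrow> lin M N (\<lambda>x. f x \<ominus>\<^bsub>N\<^esub> g x)"
proof -
  assume a: "lin M N f" "lin M N g"
  have "lin M N (\<lambda>x. f x \<oplus>\<^bsub>N\<^esub> (\<ominus>\<^bsub>K\<^esub> \<one>\<^bsub>K\<^esub>) \<odot>\<^bsub>N\<^esub> g x)"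
    by (intro lin_add_fun lin_smult_fun a) simp
  moreover have "f x \<oplus>\<^bsub>N\<^esub> (\<ominus>\<^bsub>K\<^esub> \<one>\<^bsub>K\<^esub>) \<odot>\<^bsub>N\<^esub> g x = f x \<ominus>\<^bsub>N\<^esub> g x" if "x \<in> carrier M" for x
    using that a by (simp add: vs_minus_eq lin_vs2 lin_closed)
  ultimately show ?thesis by (rule lin_cong)
qed

lemma lin_finsum_fun:
  assumes "vs M" "vs N" "finite I" "\<And>i. i \<in> I \<Longrightarrow> lin M N (f i)"
  shows "lin M N (\<lambda>x. finsum N (\<lambda>i. f i x) I)"
  using assms(3,4)
proof (induction I)
  case empty
  then show ?case using assms by (simp add: vs_finsum_empty lin_const0)
next
  case (insert i I)
  have "lin M N (\<lambda>x. f i x \<oplus>\<^bsub>N\<^esub> finsum N (\<lambda>i. f i x) I)"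
    using insert by (intro lin_add_fun) auto
  then show ?case
  proof (rule lin_cong)
    fix x assume "x \<in> carrier M"
    then have "f j x \<in> carrier N" if "j \<in> insert i I" for j
      using lin_closed[OF insert.prems[OF that]] by blast
    then show "f i x \<oplus>\<^bsub>N\<^esub> finsum N (\<lambda>i. f i x) I = finsum N (\<lambda>i. f i x) (insert i I)"
      by (subst vs_finsum_insert[OF assms(2) insert.hyps]) auto
  qed
qed

section \<open>Submodules\<close>

lemma submodI:
  assumes "vs M" "H \<subseteq> carrier M" "\<zero>\<^bsub>M\<^esub> \<in> H" "\<And>a b. a \<in> H \<Longrightarrow> b \<in> H \<Longrightarrow> a \<oplus>\<^bsub>M\<^esub> b \<in> H"
    "\<And>r a. r \<in> carrier K \<Longrightarrow> a \<in> H \<Longrightarrow> r \<odot>\<^bsub>M\<^esub> a \<in> H"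
  shows "submodule H K M"
proof (rule module.submoduleI[OF assms(1,2,3)])
  fix a assume "a \<in> H"
  then show "\<ominus>\<^bsub>M\<^esub> a \<in> H" using assms by (subst vs_neg_eq) auto
qed (use assms in auto)

lemma submodD:
  assumes "vs M" "submodule H K M"
  shows "H \<subseteq> carrier M" "\<zero>\<^bsub>M\<^esub> \<in> H" "\<And>a b. a \<in> H \<Longrightarrow> b \<in> H \<Longrightarrow> a \<oplus>\<^bsub>M\<^esub> b \<in> H"
    "\<And>r a. r \<in> carrier K \<Longrightarrow> a \<in> H \<Longrightarrow> r \<odot>\<^bsub>M\<^esub> a \<in> H"
    "\<And>a b. a \<in> H \<Longrightarrow> b \<in> H \<Longrightarrow> a \<ominus>\<^bsub>M\<^esub> b \<in> H"
  using module.submoduleE[OF assms] subgroup.one_closed[OF submodule.axioms(1)[OF assms(2)]]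
  by (auto simp: a_minus_def)

lemma submod_lin_ker:
  assumes "lin M N f" shows "submodule {x \<in> carrier M. f x = \<zero>\<^bsub>N\<^esub>} K M"
  using assms by (intro submodI) (auto simp: lin_vs1 lin_vs2 lin_zero lin_add lin_smult)

lemma submod_lin_vimage:
  assumes "lin M N f" "submodule H K N" shows "submodule {x \<in> carrier M. f x \<in> H} K M"
  using assms submodD[OF lin_vs2[OF assms(1)] assms(2)]
  by (intro submodI) (auto simp: lin_vs1 lin_vs2 lin_zero lin_add lin_smult)

text \<open>
  Linearity of \<open>G x t\<close> in the parameter \<open>x\<close> survives sums and multiples in \<open>t\<close>. It can therefore be
  checked for \<open>t\<close> in a generating set, which is how linearity of a lifted map in a parameter is
  obtained below for tensor products, tensor powers and spaces of forms.
\<close>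

lemma submod_lin_param:
  assumes L: "vs L" and G: "\<And>x. x \<in> carrier L \<Longrightarrow> lin M P (G x)" and V: "vs M" "vs P"
  shows "submodule {t \<in> carrier M. lin L P (\<lambda>x. G x t)} K M"
proof (rule submodI[OF V(1)])
  show "\<zero>\<^bsub>M\<^esub> \<in> {t \<in> carrier M. lin L P (\<lambda>x. G x t)}"
    using V lin_cong[OF lin_const0[OF L V(2)]] lin_zero[OF G] by auto
  show "s \<oplus>\<^bsub>M\<^esub> t \<in> {t \<in> carrier M. lin L P (\<lambda>x. G x t)}"
    if st: "s \<in> {t \<in> carrier M. lin L P (\<lambda>x. G x t)}" "t \<in> {t \<in> carrier M. lin L P (\<lambda>x. G x t)}" for s t
  proof -
    have "lin L P (\<lambda>x. G x s \<oplus>\<^bsub>P\<^esub> G x t)" using st by (intro lin_add_fun) auto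
    then have "lin L P (\<lambda>x. G x (s \<oplus>\<^bsub>M\<^esub> t))" by (rule lin_cong) (use st lin_add[OF G] in auto)
    then show ?thesis using st V by auto
  qed
  show "r \<odot>\<^bsub>M\<^esub> t \<in> {t \<in> carrier M. lin L P (\<lambda>x. G x t)}"
    if rt: "r \<in> carrier K" "t \<in> {t \<in> carrier M. lin L P (\<lambda>x. G x t)}" for r t
  proof -
    have "lin L P (\<lambda>x. r \<odot>\<^bsub>P\<^esub> G x t)" using rt by (intro lin_smult_fun) auto
    then have "lin L P (\<lambda>x. G x (r \<odot>\<^bsub>M\<^esub> t))" by (rule lin_cong) (use rt lin_smult[OF G] in auto)
    then show ?thesis using rt V by auto
  qed
qed auto

lemma lin_span_submod:
  assumes "vs M" "S \<subseteq> carrier M" shows "submodule (lin_span K M S) K M"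
proof -
  have c: "submodule (carrier M) K M" using assms(1) by (rule module.carrier_is_submodule)
  show ?thesis
  proof (rule submodI[OF assms(1)])
    show "lin_span K M S \<subseteq> carrier M" using c assms(2) by (auto simp: lin_span_def)
    show "\<zero>\<^bsub>M\<^esub> \<in> lin_span K M S" using submodD(2)[OF assms(1)] by (auto simp: lin_span_def)
    show "a \<oplus>\<^bsub>M\<^esub> b \<in> lin_span K M S" if "a \<in> lin_span K M S" "b \<in> lin_span K M S" for a b
      using that submodD(3)[OF assms(1)] by (simp add: lin_span_def)
    show "r \<odot>\<^bsub>M\<^esub> a \<in> lin_span K M S" if "r \<in> carrier K" "a \<in> lin_span K M S" for r a
      using that submodD(4)[OF assms(1)] by (simp add: lin_span_def)
  qed
qed

lemma lin_span_incl: "S \<subseteq> lin_span K M S"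
  unfolding lin_span_def by auto

lemma lin_span_least: "submodule N K M \<Longrightarrow> S \<subseteq> N \<Longrightarrow> lin_span K M S \<subseteq> N"
  unfolding lin_span_def by auto

section \<open>Quotients\<close>

text \<open>
  Additively this is the factor group; the scalar action is well defined because \<open>r (z - x) \<in> N\<close>
  whenever \<open>z - x \<in> N\<close>.
\<close>

lemma quot_facts:
  fixes M :: "('k, 'm) module"
  assumes M: "vs M" and N: "submodule N K M"
  shows quot_vs: "vs (quot_module M N)"
    and quot_proj_lin: "lin M (quot_module M N) (\<lambda>x. N +>\<^bsub>M\<^esub> x)"
    and quot_eq_iff: "\<And>x y. x \<in> carrier M \<Longrightarrow> y \<in> carrier M \<Longrightarrow>
      N +>\<^bsub>M\<^esub> x = N +>\<^bsub>M\<^esub> y \<longleftrightarrow> x \<ominus>\<^bsub>M\<^esub> y \<in> N"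
    and quot_carrier: "carrier (quot_module M N) = (\<lambda>x. N +>\<^bsub>M\<^esub> x) ` carrier M"
    and quot_mem: "\<And>x y. x \<in> carrier M \<Longrightarrow> y \<in> N +>\<^bsub>M\<^esub> x \<Longrightarrow> y \<in> carrier M \<and> y \<ominus>\<^bsub>M\<^esub> x \<in> N"
    and quot_self: "\<And>x. x \<in> carrier M \<Longrightarrow> x \<in> N +>\<^bsub>M\<^esub> x"
proof -
  interpret M: module K M by fact
  note D = submodD[OF M N]
  interpret S: abelian_subgroup N M
    by (rule abelian_subgroupI3) (use N in \<open>auto simp: additive_subgroup_def submodule_def M.abelian_group_axioms\<close>)
  show carr: "carrier (quot_module M N) = (\<lambda>x. N +>\<^bsub>M\<^esub> x) ` carrier M"
    by (auto simp: quot_module_def A_RCOSETS_def')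
  show mem: "y \<in> carrier M \<and> y \<ominus>\<^bsub>M\<^esub> x \<in> N" if "x \<in> carrier M" "y \<in> N +>\<^bsub>M\<^esub> x" for x y
    using S.a_rcos_module[of x y] that S.a_elemrcos_carrier[of x y] by (auto simp: a_minus_def)
  show self: "x \<in> N +>\<^bsub>M\<^esub> x" if "x \<in> carrier M" for x
    using S.a_rcos_self[OF that] .
  show eq: "N +>\<^bsub>M\<^esub> x = N +>\<^bsub>M\<^esub> y \<longleftrightarrow> x \<ominus>\<^bsub>M\<^esub> y \<in> N"
    if "x \<in> carrier M" "y \<in> carrier M" for x y
    using S.a_rcos_module[of y x] that self[of x] S.a_repr_independence'[of x y] by (auto simp: a_minus_def)
  have add: "(N +>\<^bsub>M\<^esub> x) \<oplus>\<^bsub>quot_module M N\<^esub> (N +>\<^bsub>M\<^esub> y) = N +>\<^bsub>M\<^esub> (x \<oplus>\<^bsub>M\<^esub> y)"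
    if "x \<in> carrier M" "y \<in> carrier M" for x y
    using S.a_rcos_sum[OF that] by (simp add: quot_module_def)
  have smult: "r \<odot>\<^bsub>quot_module M N\<^esub> (N +>\<^bsub>M\<^esub> x) = N +>\<^bsub>M\<^esub> (r \<odot>\<^bsub>M\<^esub> x)"
    if r: "r \<in> carrier K" and x: "x \<in> carrier M" for r x
  proof -
    have "N +>\<^bsub>M\<^esub> (r \<odot>\<^bsub>M\<^esub> z) = N +>\<^bsub>M\<^esub> (r \<odot>\<^bsub>M\<^esub> x)" if z: "z \<in> N +>\<^bsub>M\<^esub> x" for z
    proof -
      have "r \<odot>\<^bsub>M\<^esub> (z \<ominus>\<^bsub>M\<^esub> x) \<in> N" using mem[OF x z] r D(4) by blast
      moreover have "r \<odot>\<^bsub>M\<^esub> (z \<ominus>\<^bsub>M\<^esub> x) = r \<odot>\<^bsub>M\<^esub> z \<ominus>\<^bsub>M\<^esub> r \<odot>\<^bsub>M\<^esub> x"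
        using lin_minus[OF lin_smult_fun[OF r lin_id[OF M]]] mem[OF x z] x by simp
      ultimately show ?thesis using mem[OF x z] x r by (subst eq) (simp_all add: M)
    qed
    then have "(\<Union>z\<in>N +>\<^bsub>M\<^esub> x. N +>\<^bsub>M\<^esub> (r \<odot>\<^bsub>M\<^esub> z)) = N +>\<^bsub>M\<^esub> (r \<odot>\<^bsub>M\<^esub> x)"
      by (intro UN_constant_eq[OF self[OF x]]) blast
    then show ?thesis by (simp add: quot_module_def)
  qed
  have zero: "\<zero>\<^bsub>quot_module M N\<^esub> = N +>\<^bsub>M\<^esub> \<zero>\<^bsub>M\<^esub>"
    using M.a_coset_add_zero[OF D(1)] by (simp add: quot_module_def)
  show q: "vs (quot_module M N)"
    by (rule vsI; clarsimp simp: carr add smult zero M.a_assoc M.smult_l_distr M.smult_r_distr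
        M.smult_assoc1 M.l_neg M.smult_l_minus; metis M.a_comm)
  show "lin M (quot_module M N) (\<lambda>x. N +>\<^bsub>M\<^esub> x)"
    by (rule linI) (auto simp: M q carr add smult)
qed

section \<open>Free modules and spaces given by generators and relators\<close>

lemma free_mem: "u \<in> carrier (free_module K X) \<Longrightarrow> u x \<in> carrier K"
  by (cases "x \<in> X") (auto simp: free_module_def)

lemma free_vs: "vs (free_module K X)"
proof (rule vsI)
  fix u v assume "u \<in> carrier (free_module K X)" "v \<in> carrier (free_module K X)"
  then have uv: "\<forall>x\<in>X. u x \<in> carrier K \<and> v x \<in> carrier K" "\<forall>x. x \<notin> X \<longrightarrow> u x = \<zero>\<^bsub>K\<^esub> \<and> v x = \<zero>\<^bsub>K\<^esub>"
    "finite ({x. u x \<noteq> \<zero>\<^bsub>K\<^esub>} \<union> {x. v x \<noteq> \<zero>\<^bsub>K\<^esub>})"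
    by (auto simp: free_module_def)
  have "finite {x. u x \<oplus>\<^bsub>K\<^esub> v x \<noteq> \<zero>\<^bsub>K\<^esub>}"
    by (rule finite_subset[OF _ uv(3)]) auto
  then show "u \<oplus>\<^bsub>free_module K X\<^esub> v \<in> carrier (free_module K X)"
    using uv by (auto simp: free_module_def)
next
  fix r u assume "r \<in> carrier K" "u \<in> carrier (free_module K X)"
  then show "r \<odot>\<^bsub>free_module K X\<^esub> u \<in> carrier (free_module K X)"
    by (auto simp: free_module_def elim!: rev_finite_subset)
next
  fix u assume u: "u \<in> carrier (free_module K X)"
  have "u x \<in> carrier K" for x using u by (cases "x \<in> X") (auto simp: free_module_def)
  then show "(\<ominus>\<^bsub>K\<^esub> \<one>\<^bsub>K\<^esub>) \<odot>\<^bsub>free_module K X\<^esub> u \<oplus>\<^bsub>free_module K X\<^esub> u = \<zero>\<^bsub>free_module K X\<^esub>"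
    by (auto simp: free_module_def l_minus l_neg)
next
  fix u v assume u: "u \<in> carrier (free_module K X)" and v: "v \<in> carrier (free_module K X)"
  show "u \<oplus>\<^bsub>free_module K X\<^esub> v = v \<oplus>\<^bsub>free_module K X\<^esub> u"
    using free_mem[OF u] free_mem[OF v] by (auto simp: free_module_def a_comm)
  show "r \<odot>\<^bsub>free_module K X\<^esub> (u \<oplus>\<^bsub>free_module K X\<^esub> v)
    = r \<odot>\<^bsub>free_module K X\<^esub> u \<oplus>\<^bsub>free_module K X\<^esub> r \<odot>\<^bsub>free_module K X\<^esub> v"
    if "r \<in> carrier K" for r
    using free_mem[OF u] free_mem[OF v] that by (auto simp: free_module_def r_distr)
  fix w assume w: "w \<in> carrier (free_module K X)"
  show "u \<oplus>\<^bsub>free_module K X\<^esub> v \<oplus>\<^bsub>free_module K X\<^esub> w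
    = u \<oplus>\<^bsub>free_module K X\<^esub> (v \<oplus>\<^bsub>free_module K X\<^esub> w)"
    using free_mem[OF u] free_mem[OF v] free_mem[OF w] by (auto simp: free_module_def a_assoc)
next
  fix r s u assume r: "r \<in> carrier K" "s \<in> carrier K" and u: "u \<in> carrier (free_module K X)"
  show "(r \<oplus>\<^bsub>K\<^esub> s) \<odot>\<^bsub>free_module K X\<^esub> u
    = r \<odot>\<^bsub>free_module K X\<^esub> u \<oplus>\<^bsub>free_module K X\<^esub> s \<odot>\<^bsub>free_module K X\<^esub> u"
    using free_mem[OF u] r by (auto simp: free_module_def l_distr)
  show "(r \<otimes>\<^bsub>K\<^esub> s) \<odot>\<^bsub>free_module K X\<^esub> u = r \<odot>\<^bsub>free_module K X\<^esub> (s \<odot>\<^bsub>free_module K X\<^esub> u)"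
    using free_mem[OF u] r by (auto simp: free_module_def m_assoc)
next
  fix u assume u: "u \<in> carrier (free_module K X)"
  show "\<zero>\<^bsub>free_module K X\<^esub> \<oplus>\<^bsub>free_module K X\<^esub> u = u" "\<one>\<^bsub>K\<^esub> \<odot>\<^bsub>free_module K X\<^esub> u = u"
    using free_mem[OF u] by (auto simp: free_module_def)
qed (simp add: free_module_def)

text \<open>
  The linear extension of \<open>g\<close> to the free module. The constant \<open>lift\<close> is this map, evaluated at a
  chosen representative of a coset.
\<close>

definition extend :: "('k, 'p) module \<Rightarrow> ('x \<Rightarrow> 'p) \<Rightarrow> ('x \<Rightarrow> 'k) \<Rightarrow> 'p" where
  "extend P g u = (\<Oplus>\<^bsub>P\<^esub>x\<in>{x. u x \<noteq> \<zero>\<^bsub>K\<^esub>}. u x \<odot>\<^bsub>P\<^esub> g x)"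

text \<open>
  Summing over any finite set that contains the support makes values at different vectors
  comparable.
\<close>

lemma extend_superset:
  assumes "vs P" "g \<in> X \<rightarrow> carrier P" "u \<in> carrier (free_module K X)"
    "finite F" "{x. u x \<noteq> \<zero>\<^bsub>K\<^esub>} \<subseteq> F" "F \<subseteq> X"
  shows "extend P g u = (\<Oplus>\<^bsub>P\<^esub>x\<in>F. u x \<odot>\<^bsub>P\<^esub> g x)"
  unfolding extend_def using assms free_mem[OF assms(3)]
  by (intro vs_finsum_mono) (auto simp: Pi_def subset_iff)

lemma free_support: "u \<in> carrier (free_module K X) \<Longrightarrow> finite {x. u x \<noteq> \<zero>\<^bsub>K\<^esub>}"
  "u \<in> carrier (free_module K X) \<Longrightarrow> {x. u x \<noteq> \<zero>\<^bsub>K\<^esub>} \<subseteq> X"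
  by (auto simp: free_module_def)

lemma extend_lin:
  assumes P: "vs P" and g: "g \<in> X \<rightarrow> carrier P"
  shows "lin (free_module K X) P (extend P g)"
proof (rule linI)
  interpret P: module K P by fact
  let ?F = "free_module K X"
  fix u assume u: "u \<in> carrier ?F"
  show "extend P g u \<in> carrier P"
    unfolding extend_def using u free_support(2)[OF u] funcset_mem[OF g] P free_mem[OF u]
    by (intro vs_finsum_closed) auto
  {
    fix v assume v: "v \<in> carrier ?F"
    let ?S = "{x. u x \<noteq> \<zero>\<^bsub>K\<^esub>} \<union> {x. v x \<noteq> \<zero>\<^bsub>K\<^esub>}"
    have S: "finite ?S" "?S \<subseteq> X" using free_support u v by blast+
    have uv: "u \<oplus>\<^bsub>?F\<^esub> v \<in> carrier ?F" using u v free_vs[of X] by simp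
    have "extend P g (u \<oplus>\<^bsub>?F\<^esub> v) = (\<Oplus>\<^bsub>P\<^esub>x\<in>?S. (u \<oplus>\<^bsub>?F\<^esub> v) x \<odot>\<^bsub>P\<^esub> g x)"
      by (rule extend_superset[OF P g uv S(1) _ S(2)]) (auto simp: free_module_def)
    also have "\<dots> = (\<Oplus>\<^bsub>P\<^esub>x\<in>?S. u x \<odot>\<^bsub>P\<^esub> g x \<oplus>\<^bsub>P\<^esub> v x \<odot>\<^bsub>P\<^esub> g x)"
      using S g free_mem[OF u] free_mem[OF v]
      by (intro vs_finsum_cong P) (auto simp: free_module_def P.smult_l_distr Pi_def subset_iff)
    also have "\<dots> = (\<Oplus>\<^bsub>P\<^esub>x\<in>?S. u x \<odot>\<^bsub>P\<^esub> g x) \<oplus>\<^bsub>P\<^esub> (\<Oplus>\<^bsub>P\<^esub>x\<in>?S. v x \<odot>\<^bsub>P\<^esub> g x)"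
      using S g free_mem[OF u] free_mem[OF v] by (intro P.finsum_addf) (auto simp: Pi_def subset_iff)
    also have "\<dots> = extend P g u \<oplus>\<^bsub>P\<^esub> extend P g v"
      using extend_superset[OF P g u S(1) _ S(2)] extend_superset[OF P g v S(1) _ S(2)] by auto
    finally show "extend P g (u \<oplus>\<^bsub>?F\<^esub> v) = extend P g u \<oplus>\<^bsub>P\<^esub> extend P g v" .
  }
  fix r assume r: "r \<in> carrier K"
  let ?S = "{x. u x \<noteq> \<zero>\<^bsub>K\<^esub>}"
  have ru: "r \<odot>\<^bsub>?F\<^esub> u \<in> carrier ?F" using r u free_vs[of X] by simp
  have "extend P g (r \<odot>\<^bsub>?F\<^esub> u) = (\<Oplus>\<^bsub>P\<^esub>x\<in>?S. (r \<odot>\<^bsub>?F\<^esub> u) x \<odot>\<^bsub>P\<^esub> g x)"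
    by (rule extend_superset[OF P g ru free_support(1)[OF u] _ free_support(2)[OF u]])
      (use r in \<open>auto simp: free_module_def\<close>)
  also have "\<dots> = (\<Oplus>\<^bsub>P\<^esub>x\<in>?S. r \<odot>\<^bsub>P\<^esub> (u x \<odot>\<^bsub>P\<^esub> g x))"
    using free_support[OF u] g free_mem[OF u] r
    by (intro vs_finsum_cong P) (auto simp: free_module_def P.smult_assoc1 Pi_def subset_iff)
  also have "\<dots> = r \<odot>\<^bsub>P\<^esub> extend P g u"
    unfolding extend_def using free_support[OF u] g free_mem[OF u] r
    by (intro P.finsum_smult_ldistr[symmetric]) (auto simp: Pi_def subset_iff)
  finally show "extend P g (r \<odot>\<^bsub>?F\<^esub> u) = r \<odot>\<^bsub>P\<^esub> extend P g u" .
qed (use P free_vs in auto)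

lemma unit_vec_mem: "x \<in> X \<Longrightarrow> unit_vec K x \<in> carrier (free_module K X)"
  by (auto simp: free_module_def unit_vec_def intro: rev_finite_subset[of "{x}"])

lemma extend_unit:
  assumes P: "vs P" and g: "g \<in> X \<rightarrow> carrier P" and x: "x \<in> X"
  shows "extend P g (unit_vec K x) = g x"
proof -
  have "extend P g (unit_vec K x) = (\<Oplus>\<^bsub>P\<^esub>y\<in>{x}. unit_vec K x y \<odot>\<^bsub>P\<^esub> g y)"
    by (rule extend_superset[OF P g unit_vec_mem[OF x]]) (use x in \<open>auto simp: unit_vec_def\<close>)
  also have "\<dots> = \<one>\<^bsub>K\<^esub> \<odot>\<^bsub>P\<^esub> g x \<oplus>\<^bsub>P\<^esub> (\<Oplus>\<^bsub>P\<^esub>y\<in>{}. unit_vec K x y \<odot>\<^bsub>P\<^esub> g y)"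
    using funcset_mem[OF g x] P by (subst vs_finsum_insert) (auto simp: unit_vec_def)
  finally show ?thesis using funcset_mem[OF g x] P by (auto simp: vs_finsum_empty)
qed

lemma free_expand:
  assumes u: "u \<in> carrier (free_module K X)"
  shows "extend (free_module K X) (unit_vec K) u = u"
proof -
  let ?F = "free_module K X"
  have "(\<Oplus>\<^bsub>?F\<^esub>x\<in>S. u x \<odot>\<^bsub>?F\<^esub> unit_vec K x) = (\<lambda>x. if x \<in> S then u x else \<zero>\<^bsub>K\<^esub>)"
    if "finite S" "S \<subseteq> X" for S
    using that
  proof (induction S)
    case empty
    then show ?case using free_vs[of X] by (simp add: vs_finsum_empty) (simp add: free_module_def)
  next
    case (insert x S)
    have "(\<Oplus>\<^bsub>?F\<^esub>x\<in>insert x S. u x \<odot>\<^bsub>?F\<^esub> unit_vec K x)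
      = u x \<odot>\<^bsub>?F\<^esub> unit_vec K x \<oplus>\<^bsub>?F\<^esub> (\<Oplus>\<^bsub>?F\<^esub>x\<in>S. u x \<odot>\<^bsub>?F\<^esub> unit_vec K x)"
      using insert free_vs[of X] free_mem[OF u] unit_vec_mem[where X=X] by (intro vs_finsum_insert) auto
    also have "\<dots> = (\<lambda>y. if y \<in> insert x S then u y else \<zero>\<^bsub>K\<^esub>)"
      using insert free_mem[OF u] by (auto simp: free_module_def unit_vec_def fun_eq_iff)
    finally show ?case .
  qed
  from this[OF free_support[OF u]] show ?thesis
    by (auto simp: extend_def)
qed

lemma free_induct:
  assumes H: "submodule H K (free_module K X)" and e: "\<And>x. x \<in> X \<Longrightarrow> unit_vec K x \<in> H"
    and u: "u \<in> carrier (free_module K X)"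
  shows "u \<in> H"
proof -
  let ?F = "free_module K X"
  note D = submodD[OF free_vs H]
  have "(\<Oplus>\<^bsub>?F\<^esub>x\<in>S. u x \<odot>\<^bsub>?F\<^esub> unit_vec K x) \<in> H" if "finite S" "S \<subseteq> X" for S
    using that
  proof (induction S)
    case empty
    then show ?case using free_vs[of X] D by (simp add: vs_finsum_empty)
  next
    case (insert x S)
    then show ?case using free_vs[of X] free_mem[OF u] unit_vec_mem[where X=X] D e
      by (subst vs_finsum_insert) auto
  qed
  from this[OF free_support[OF u]] show ?thesis
    using free_expand[OF u] by (simp add: extend_def)
qed

lemma lift_extend: "lift K P g S = extend P g (SOME u. u \<in> S)"
  by (simp add: lift_def extend_def Let_def)

lemma presented_facts:
  fixes Rel :: "('x \<Rightarrow> 'k) set" and X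
  assumes R: "Rel \<subseteq> carrier (free_module K X)"
  shows presented_vs: "vs (presented K X Rel)"
    and gen_closed: "\<And>x. x \<in> X \<Longrightarrow> gen K X Rel x \<in> carrier (presented K X Rel)"
    and presented_proj: "lin (free_module K X) (presented K X Rel)
      (\<lambda>u. lin_span K (free_module K X) Rel +>\<^bsub>free_module K X\<^esub> u)"
    and presented_rel: "\<And>u. u \<in> Rel \<Longrightarrow>
      lin_span K (free_module K X) Rel +>\<^bsub>free_module K X\<^esub> u = \<zero>\<^bsub>presented K X Rel\<^esub>"
    and presented_repr: "\<And>S. S \<in> carrier (presented K X Rel) \<Longrightarrow>
      (SOME u. u \<in> S) \<in> carrier (free_module K X)
      \<and> S = lin_span K (free_module K X) Rel +>\<^bsub>free_module K X\<^esub> (SOME u. u \<in> S)"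
proof -
  let ?F = "free_module K X" let ?N = "lin_span K ?F Rel"
  note N = lin_span_submod[OF free_vs R]
  note Q = quot_facts[OF free_vs N]
  show "vs (presented K X Rel)" unfolding presented_def by (rule Q)
  show p: "lin ?F (presented K X Rel) (\<lambda>u. ?N +>\<^bsub>?F\<^esub> u)" unfolding presented_def by (rule Q)
  show "gen K X Rel x \<in> carrier (presented K X Rel)" if "x \<in> X" for x
    unfolding gen_def using lin_closed[OF p unit_vec_mem[OF that]] .
  show "?N +>\<^bsub>?F\<^esub> u = \<zero>\<^bsub>presented K X Rel\<^esub>" if "u \<in> Rel" for u
  proof -
    have u: "u \<in> carrier ?F" "u \<in> ?N" using that R lin_span_incl[of Rel ?F] by auto
    then have "?N +>\<^bsub>?F\<^esub> u = ?N +>\<^bsub>?F\<^esub> \<zero>\<^bsub>?F\<^esub>"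
      using Q(3)[of u "\<zero>\<^bsub>?F\<^esub>"] free_vs[of X] by (simp add: vs_minus_zero)
    then show ?thesis using lin_zero[OF p] by simp
  qed
  show "(SOME u. u \<in> S) \<in> carrier ?F \<and> S = ?N +>\<^bsub>?F\<^esub> (SOME u. u \<in> S)"
    if S: "S \<in> carrier (presented K X Rel)" for S
  proof -
    obtain x where x: "x \<in> carrier ?F" "S = ?N +>\<^bsub>?F\<^esub> x"
      using S Q(4) unfolding presented_def by auto
    have "(SOME u. u \<in> S) \<in> S" by (rule someI[of _ x]) (simp only: x(2) Q(6)[OF x(1)])
    then have m: "(SOME u. u \<in> S) \<in> ?N +>\<^bsub>?F\<^esub> x" by (simp only: x(2)[symmetric])
    have v: "(SOME u. u \<in> S) \<in> carrier ?F" "(SOME u. u \<in> S) \<ominus>\<^bsub>?F\<^esub> x \<in> ?N"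
      using Q(5)[OF x(1) m] by auto
    have "S = ?N +>\<^bsub>?F\<^esub> (SOME u. u \<in> S)" using iffD2[OF Q(3)[OF v(1) x(1)] v(2)] by (rule trans[OF x(2) sym])
    with v(1) show ?thesis by (rule conjI)
  qed
qed

lemma presented_induct:
  assumes R: "Rel \<subseteq> carrier (free_module K X)" and H: "submodule H K (presented K X Rel)"
    and g: "\<And>x. x \<in> X \<Longrightarrow> gen K X Rel x \<in> H" and S: "S \<in> carrier (presented K X Rel)"
  shows "S \<in> H"
proof -
  note repr = presented_repr[OF R S]
  have "(SOME u. u \<in> S) \<in> {u \<in> carrier (free_module K X).
    lin_span K (free_module K X) Rel +>\<^bsub>free_module K X\<^esub> u \<in> H}"
    by (rule free_induct[OF submod_lin_vimage[OF presented_proj[OF R] H] _ conjunct1[OF repr]])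
      (use g in \<open>auto simp: unit_vec_mem gen_def\<close>)
  then have "lin_span K (free_module K X) Rel +>\<^bsub>free_module K X\<^esub> (SOME u. u \<in> S) \<in> H" by blast
  then show ?thesis by (rule ssubst[OF conjunct2[OF repr], of "\<lambda>S. S \<in> H"])
qed

text \<open>
  The linear extension of \<open>g\<close> kills the relators, hence their span, so its value does not depend on
  the representative chosen by \<open>lift\<close>.
\<close>

lemma lift_facts:
  fixes g :: "'x \<Rightarrow> 'p"
  assumes R: "Rel \<subseteq> carrier (free_module K X)" and P: "vs P" and g: "g \<in> X \<rightarrow> carrier P"
    and r: "\<And>u. u \<in> Rel \<Longrightarrow> extend P g u = \<zero>\<^bsub>P\<^esub>"
  shows lift_lin: "lin (presented K X Rel) P (lift K P g)"
    and lift_gen: "\<And>x. x \<in> X \<Longrightarrow> lift K P g (gen K X Rel x) = g x"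
proof -
  let ?F = "free_module K X" let ?N = "lin_span K ?F Rel"
  note N = lin_span_submod[OF free_vs R]
  note E = extend_lin[OF P g]
  note p = presented_proj[OF R]
  have ker: "?N \<subseteq> {u \<in> carrier ?F. extend P g u = \<zero>\<^bsub>P\<^esub>}"
    by (rule lin_span_least[OF submod_lin_ker[OF E]]) (use R r in auto)
  have key: "lift K P g (?N +>\<^bsub>?F\<^esub> u) = extend P g u" if u: "u \<in> carrier ?F" for u
  proof -
    let ?v = "SOME v. v \<in> ?N +>\<^bsub>?F\<^esub> u"
    have v: "?v \<in> carrier ?F" "?N +>\<^bsub>?F\<^esub> u = ?N +>\<^bsub>?F\<^esub> ?v"
      using conjunct1[OF presented_repr[OF R lin_closed[OF p u]]]
        conjunct2[OF presented_repr[OF R lin_closed[OF p u]]] by fast+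
    then have "u \<ominus>\<^bsub>?F\<^esub> ?v \<in> ?N" using quot_eq_iff[OF free_vs N u v(1)] by simp
    then have "extend P g u \<ominus>\<^bsub>P\<^esub> extend P g ?v = \<zero>\<^bsub>P\<^esub>" using ker lin_minus[OF E u v(1)] by auto
    then have "extend P g u = extend P g ?v" by (rule vs_eqI[OF P lin_closed[OF E u] lin_closed[OF E v(1)]])
    then show ?thesis by (simp add: lift_extend)
  qed
  have rep: "\<exists>u \<in> carrier ?F. S = ?N +>\<^bsub>?F\<^esub> u" if "S \<in> carrier (presented K X Rel)" for S
    using conjunct1[OF presented_repr[OF R that]] conjunct2[OF presented_repr[OF R that]] 
    by (intro bexI[where x="SOME u. u \<in> S"])
  show "lin (presented K X Rel) P (lift K P g)"
  proof (rule linI[OF presented_vs[OF R] P])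
    fix S T assume "S \<in> carrier (presented K X Rel)" "T \<in> carrier (presented K X Rel)"
    then obtain u v where u: "u \<in> carrier ?F" "S = ?N +>\<^bsub>?F\<^esub> u" and v: "v \<in> carrier ?F" "T = ?N +>\<^bsub>?F\<^esub> v"
      using rep by meson
    then show "lift K P g (S \<oplus>\<^bsub>presented K X Rel\<^esub> T) = lift K P g S \<oplus>\<^bsub>P\<^esub> lift K P g T"
      using lin_add[OF p, symmetric] key free_vs[of X] by (simp add: lin_add[OF E])
  next
    fix S r assume "S \<in> carrier (presented K X Rel)" and r: "r \<in> carrier K"
    then obtain u where u: "u \<in> carrier ?F" "S = ?N +>\<^bsub>?F\<^esub> u"
      using rep by meson
    then show "lift K P g (r \<odot>\<^bsub>presented K X Rel\<^esub> S) = r \<odot>\<^bsub>P\<^esub> lift K P g S"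
      using lin_smult[OF p r, symmetric] key free_vs[of X] r by (simp add: lin_smult[OF E])
  next
    fix S assume "S \<in> carrier (presented K X Rel)"
    then obtain u where u: "u \<in> carrier ?F" "S = ?N +>\<^bsub>?F\<^esub> u"
      using rep by meson
    then show "lift K P g S \<in> carrier P"
      using key lin_closed[OF E] by simp
  qed
  show "lift K P g (gen K X Rel x) = g x" if "x \<in> X" for x
    unfolding gen_def using key[OF unit_vec_mem[OF that]] extend_unit[OF P g that] by simp
qed

lemma lift_cong:
  assumes R: "Rel \<subseteq> carrier (free_module K X)" and S: "S \<in> carrier (presented K X Rel)"
    and P: "vs P" and g: "g \<in> X \<rightarrow> carrier P" and eq: "\<And>x. x \<in> X \<Longrightarrow> f x = g x"
  shows "lift K P f S = lift K P g S"
proof -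
  have u: "(SOME u. u \<in> S) \<in> carrier (free_module K X)" by (rule conjunct1[OF presented_repr[OF R S]])
  show ?thesis
    unfolding lift_extend extend_def
  proof (rule vs_finsum_cong[OF P])
    fix x assume "x \<in> {x. (SOME u. u \<in> S) x \<noteq> \<zero>\<^bsub>K\<^esub>}"
    then have x: "x \<in> X" using free_support(2)[OF u] by blast
    show "(SOME u. u \<in> S) x \<odot>\<^bsub>P\<^esub> f x = (SOME u. u \<in> S) x \<odot>\<^bsub>P\<^esub> g x" by (simp only: eq[OF x])
    show "(SOME u. u \<in> S) x \<odot>\<^bsub>P\<^esub> g x \<in> carrier P" by (rule vs_smult[OF P free_mem[OF u] funcset_mem[OF g x]])
  qed
qed


section \<open>Tensor products\<close>

definition bilin where
  "bilin M N P \<beta> \<longleftrightarrow> vs M \<and> vs N \<and> vs P \<and>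
     (\<forall>x\<in>carrier M. lin N P (\<beta> x)) \<and> (\<forall>y\<in>carrier N. lin M P (\<lambda>x. \<beta> x y))"

lemma bilinI:
  assumes "vs M" "vs N" "vs P" "\<And>x. x \<in> carrier M \<Longrightarrow> lin N P (\<beta> x)"
    "\<And>y. y \<in> carrier N \<Longrightarrow> lin M P (\<lambda>x. \<beta> x y)"
  shows "bilin M N P \<beta>"
  using assms by (auto simp: bilin_def)

lemma bilinD:
  assumes "bilin M N P \<beta>"
  shows "vs M" "vs N" "vs P" "\<And>x. x \<in> carrier M \<Longrightarrow> lin N P (\<beta> x)"
    "\<And>y. y \<in> carrier N \<Longrightarrow> lin M P (\<lambda>x. \<beta> x y)"
    "\<And>x y. x \<in> carrier M \<Longrightarrow> y \<in> carrier N \<Longrightarrow> \<beta> x y \<in> carrier P"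
  using assms by (auto simp: bilin_def dest: lin_closed)

text \<open>
  To be read as an integral: the sum of \<open>\<beta> x\<^sub>i y\<^sub>i\<close> if the argument is \<open>\<Sum> x\<^sub>i \<otimes> y\<^sub>i\<close>.
\<close>

abbreviation tlift where
  "tlift P \<beta> \<equiv> lift K P (\<lambda>(x, y). \<beta> x y)"

lemma tensor_relators_free:
  assumes "vs M" "vs N"
  shows "tensor_relators K M N \<subseteq> carrier (free_module K (carrier M \<times> carrier N))"
  using assms free_vs[of "carrier M \<times> carrier N"]
  by (auto simp: tensor_relators_def Let_def intro!: vs_simps unit_vec_mem)

lemma tensor_vs: "vs M \<Longrightarrow> vs N \<Longrightarrow> vs (tensor K M N)"
  unfolding tensor_def by (rule presented_vs[OF tensor_relators_free])

lemma pure_closed: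
  "vs M \<Longrightarrow> vs N \<Longrightarrow> x \<in> carrier M \<Longrightarrow> y \<in> carrier N \<Longrightarrow> pure K M N x y \<in> carrier (tensor K M N)"
  unfolding tensor_def pure_def by (rule gen_closed[OF tensor_relators_free]) auto

lemma gen_add:
  assumes R: "Rel \<subseteq> carrier (free_module K X)" and x: "x \<in> X" "y \<in> X" "z \<in> X"
    and r: "unit_vec K x \<ominus>\<^bsub>free_module K X\<^esub> (unit_vec K y \<oplus>\<^bsub>free_module K X\<^esub> unit_vec K z) \<in> Rel"
  shows "gen K X Rel x = gen K X Rel y \<oplus>\<^bsub>presented K X Rel\<^esub> gen K X Rel z"
proof (rule vs_eqI[OF presented_vs[OF R]])
  note p = presented_proj[OF R]
  show "gen K X Rel x \<ominus>\<^bsub>presented K X Rel\<^esub> (gen K X Rel y \<oplus>\<^bsub>presented K X Rel\<^esub> gen K X Rel z)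
    = \<zero>\<^bsub>presented K X Rel\<^esub>"
    using presented_rel[OF R r] free_vs[of X] x
    unfolding gen_def by (simp add: lin_minus[OF p] lin_add[OF p] unit_vec_mem)
qed (use x gen_closed[OF R] presented_vs[OF R] in auto)

lemma gen_smult:
  assumes R: "Rel \<subseteq> carrier (free_module K X)" and x: "x \<in> X" "y \<in> X" "s \<in> carrier K"
    and r: "unit_vec K x \<ominus>\<^bsub>free_module K X\<^esub> s \<odot>\<^bsub>free_module K X\<^esub> unit_vec K y \<in> Rel"
  shows "gen K X Rel x = s \<odot>\<^bsub>presented K X Rel\<^esub> gen K X Rel y"
proof (rule vs_eqI[OF presented_vs[OF R]])
  note p = presented_proj[OF R]
  show "gen K X Rel x \<ominus>\<^bsub>presented K X Rel\<^esub> s \<odot>\<^bsub>presented K X Rel\<^esub> gen K X Rel y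
    = \<zero>\<^bsub>presented K X Rel\<^esub>"
    using presented_rel[OF R r] free_vs[of X] x
    unfolding gen_def by (simp add: lin_minus[OF p] lin_smult[OF p] unit_vec_mem)
qed (use x gen_closed[OF R] presented_vs[OF R] in auto)

lemma extend_rel_add:
  assumes "vs P" "g \<in> X \<rightarrow> carrier P" "x \<in> X" "y \<in> X" "z \<in> X" "g x = g y \<oplus>\<^bsub>P\<^esub> g z"
  shows "extend P g (unit_vec K x \<ominus>\<^bsub>free_module K X\<^esub> (unit_vec K y \<oplus>\<^bsub>free_module K X\<^esub> unit_vec K z))
    = \<zero>\<^bsub>P\<^esub>"
  using assms free_vs[of X] funcset_mem[OF assms(2)]
  by (simp add: lin_minus[OF extend_lin] lin_add[OF extend_lin] unit_vec_mem
      extend_unit[OF assms(1,2)] vs_minus_self)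

lemma extend_rel_smult:
  assumes "vs P" "g \<in> X \<rightarrow> carrier P" "x \<in> X" "y \<in> X" "s \<in> carrier K" "g x = s \<odot>\<^bsub>P\<^esub> g y"
  shows "extend P g (unit_vec K x \<ominus>\<^bsub>free_module K X\<^esub> s \<odot>\<^bsub>free_module K X\<^esub> unit_vec K y) = \<zero>\<^bsub>P\<^esub>"
  using assms free_vs[of X] funcset_mem[OF assms(2)]
  by (simp add: lin_minus[OF extend_lin] lin_smult[OF extend_lin] unit_vec_mem
      extend_unit[OF assms(1,2)] vs_minus_self)

lemma pure_bilin:
  assumes M: "vs M" and N: "vs N"
  shows "bilin M N (tensor K M N) (pure K M N)"
proof (rule bilinI[OF M N tensor_vs[OF M N]])
  note R = tensor_relators_free[OF M N]
  note i = insertI1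
  show "lin N (tensor K M N) (pure K M N x)" if x: "x \<in> carrier M" for x
  proof (rule linI[OF N tensor_vs[OF M N]])
    show "pure K M N x (y \<oplus>\<^bsub>N\<^esub> z) = pure K M N x y \<oplus>\<^bsub>tensor K M N\<^esub> pure K M N x z"
      if "y \<in> carrier N" "z \<in> carrier N" for y z
      unfolding pure_def tensor_def
      by (rule gen_add[OF R]) (use M N x that in \<open>auto simp: tensor_relators_def Let_def\<close>)
    show "pure K M N x (r \<odot>\<^bsub>N\<^esub> y) = r \<odot>\<^bsub>tensor K M N\<^esub> pure K M N x y"
      if "y \<in> carrier N" "r \<in> carrier K" for y r
      unfolding pure_def tensor_def
      by (rule gen_smult[OF R]) (use M N x that in \<open>auto simp: tensor_relators_def Let_def\<close>)
  qed (use M N x in \<open>auto intro: pure_closed\<close>)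
  show "lin M (tensor K M N) (\<lambda>x. pure K M N x y)" if y: "y \<in> carrier N" for y
  proof (rule linI[OF M tensor_vs[OF M N]])
    show "pure K M N (x \<oplus>\<^bsub>M\<^esub> z) y = pure K M N x y \<oplus>\<^bsub>tensor K M N\<^esub> pure K M N z y"
      if "x \<in> carrier M" "z \<in> carrier M" for x z
      unfolding pure_def tensor_def
      by (rule gen_add[OF R]) (use M N y that in \<open>auto simp: tensor_relators_def Let_def\<close>)
    show "pure K M N (r \<odot>\<^bsub>M\<^esub> x) y = r \<odot>\<^bsub>tensor K M N\<^esub> pure K M N x y"
      if "x \<in> carrier M" "r \<in> carrier K" for x r
      unfolding pure_def tensor_def
      by (rule gen_smult[OF R]) (use M N y that in \<open>auto simp: tensor_relators_def Let_def\<close>)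
  qed (use M N y in \<open>auto intro: pure_closed\<close>)
qed

lemma tlift_facts:
  assumes b: "bilin M N P \<beta>"
  shows tlift_lin: "lin (tensor K M N) P (tlift P \<beta>)"
    and tlift_pure: "\<And>x y. x \<in> carrier M \<Longrightarrow> y \<in> carrier N \<Longrightarrow> tlift P \<beta> (pure K M N x y) = \<beta> x y"
proof -
  note D = bilinD[OF b]
  note R = tensor_relators_free[OF D(1,2)]
  have g: "(\<lambda>(x, y). \<beta> x y) \<in> carrier M \<times> carrier N \<rightarrow> carrier P" using D(6) by auto
  have r: "extend P (\<lambda>(x, y). \<beta> x y) u = \<zero>\<^bsub>P\<^esub>" if "u \<in> tensor_relators K M N" for u
    using that D(1-3) unfolding tensor_relators_def Let_def
    by (auto intro!: extend_rel_add[OF D(3) g] extend_rel_smult[OF D(3) g]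
        simp: lin_add[OF D(4)] lin_add[OF D(5)] lin_smult[OF D(4)] lin_smult[OF D(5)])
  show "lin (tensor K M N) P (tlift P \<beta>)"
    unfolding tensor_def by (rule lift_lin[OF R D(3) g r])
  show "tlift P \<beta> (pure K M N x y) = \<beta> x y" if "x \<in> carrier M" "y \<in> carrier N" for x y
    unfolding pure_def using lift_gen[OF R D(3) g r, of "(x, y)"] that by simp
qed

lemma tensor_induct:
  assumes "vs M" "vs N" "submodule H K (tensor K M N)"
    "\<And>x y. x \<in> carrier M \<Longrightarrow> y \<in> carrier N \<Longrightarrow> pure K M N x y \<in> H" "t \<in> carrier (tensor K M N)"
  shows "t \<in> H"
  using presented_induct[OF tensor_relators_free[OF assms(1,2)], of H t] assms(3-5)
  unfolding tensor_def pure_def by auto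

lemma submod_eq:
  assumes f: "lin M P f" and g: "lin M P g" shows "submodule {x \<in> carrier M. f x = g x} K M"
  by (rule submodI)
    (auto simp: lin_vs1[OF f] lin_zero[OF f] lin_zero[OF g] lin_add[OF f] lin_add[OF g]
      lin_smult[OF f] lin_smult[OF g])

lemma tensor_eqI:
  assumes "vs M" "vs N" and f: "lin (tensor K M N) P f" and g: "lin (tensor K M N) P g"
    and eq: "\<And>x y. x \<in> carrier M \<Longrightarrow> y \<in> carrier N \<Longrightarrow> f (pure K M N x y) = g (pure K M N x y)"
    and t: "t \<in> carrier (tensor K M N)"
  shows "f t = g t"
  using tensor_induct[OF assms(1,2) submod_eq[OF f g] _ t] eq pure_closed[OF assms(1,2)] by auto

lemma tlift_cong:
  assumes "t \<in> carrier (tensor K M N)" "bilin M N P \<gamma>"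
    "\<And>x y. x \<in> carrier M \<Longrightarrow> y \<in> carrier N \<Longrightarrow> \<beta> x y = \<gamma> x y"
  shows "tlift P \<beta> t = tlift P \<gamma> t"
proof -
  note D = bilinD[OF assms(2)]
  show ?thesis
    by (rule lift_cong[OF tensor_relators_free[OF D(1,2)] assms(1)[unfolded tensor_def] D(3)])
      (use D(6) assms(3) in auto)
qed

lemma lin_tlift_arg:
  "lin L (tensor K M N) g \<Longrightarrow> bilin M N P \<beta> \<Longrightarrow> lin L P (\<lambda>x. tlift P \<beta> (g x))"
  by (rule lin_comp[OF tlift_lin])

lemma lin_tlift_fun:
  assumes t: "t \<in> carrier (tensor K M N)" and L: "vs L" "vs M" "vs N" "vs P"
    and a: "\<And>a b. a \<in> carrier M \<Longrightarrow> b \<in> carrier N \<Longrightarrow> lin L P (\<lambda>x. \<beta> x a b)"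
    and b: "\<And>x. x \<in> carrier L \<Longrightarrow> bilin M N P (\<beta> x)"
  shows "lin L P (\<lambda>x. tlift P (\<beta> x) t)"
proof -
  have "t \<in> {t \<in> carrier (tensor K M N). lin L P (\<lambda>x. tlift P (\<beta> x) t)}"
  proof (rule tensor_induct[OF L(2,3) submod_lin_param[OF L(1) tlift_lin[OF b] tensor_vs[OF L(2,3)] L(4)] _ t])
    show "pure K M N x y \<in> {t \<in> carrier (tensor K M N). lin L P (\<lambda>x. tlift P (\<beta> x) t)}"
      if "x \<in> carrier M" "y \<in> carrier N" for x y
      using lin_cong[OF a[OF that]] tlift_pure[OF b] that pure_closed[OF L(2,3)] by auto
  qed
  then show ?thesis by auto
qed

lemma tlift_fusion:
  assumes f: "lin P Q f" and b: "bilin M N P \<beta>" and t: "t \<in> carrier (tensor K M N)"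
  shows "f (tlift P \<beta> t) = tlift Q (\<lambda>x y. f (\<beta> x y)) t"
proof -
  note D = bilinD[OF b]
  have b': "bilin M N Q (\<lambda>x y. f (\<beta> x y))"
    using D by (auto intro!: bilinI lin_comp[OF f] lin_vs2[OF f])
  show ?thesis
    by (rule tensor_eqI[OF D(1,2) lin_comp[OF f tlift_lin[OF b]] tlift_lin[OF b'] _ t])
      (simp add: tlift_pure[OF b] tlift_pure[OF b'])
qed

lemma lin_pure1: "lin L M g \<Longrightarrow> vs N \<Longrightarrow> y \<in> carrier N \<Longrightarrow> lin L (tensor K M N) (\<lambda>x. pure K M N (g x) y)"
  by (rule lin_comp[OF bilinD(5)[OF pure_bilin]]) (auto dest: lin_vs2)

lemma lin_pure2: "lin L N g \<Longrightarrow> vs M \<Longrightarrow> x \<in> carrier M \<Longrightarrow> lin L (tensor K M N) (\<lambda>y. pure K M N x (g y))"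
  by (rule lin_comp[OF bilinD(4)[OF pure_bilin]]) (auto dest: lin_vs2)

lemma tmap_bilin:
  assumes f: "lin M M' f" and g: "lin N N' g"
  shows "bilin M N (tensor K M' N') (\<lambda>x y. pure K M' N' (f x) (g y))"
  using f g by (intro bilinI tensor_vs lin_pure1 lin_pure2)
    (auto dest: lin_vs1 lin_vs2 lin_closed)

lemma tmap_lin: "lin M M' f \<Longrightarrow> lin N N' g \<Longrightarrow> lin (tensor K M N) (tensor K M' N') (tmap K M' N' f g)"
  unfolding tmap_def by (rule tlift_lin[OF tmap_bilin])

lemma tmap_pure:
  "lin M M' f \<Longrightarrow> lin N N' g \<Longrightarrow> x \<in> carrier M \<Longrightarrow> y \<in> carrier N \<Longrightarrow>
    tmap K M' N' f g (pure K M N x y) = pure K M' N' (f x) (g y)"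
  unfolding tmap_def by (rule tlift_pure[OF tmap_bilin])

lemma tmap_comp:
  assumes f: "lin M M' f" and g: "lin N N' g" and f': "lin M' M'' f'" and g': "lin N' N'' g'"
    and t: "t \<in> carrier (tensor K M N)"
  shows "tmap K M'' N'' f' g' (tmap K M' N' f g t) = tmap K M'' N'' (\<lambda>x. f' (f x)) (\<lambda>y. g' (g y)) t"
  by (rule tensor_eqI[OF lin_vs1[OF f] lin_vs1[OF g]
        lin_comp[OF tmap_lin[OF f' g'] tmap_lin[OF f g]]
        tmap_lin[OF lin_comp[OF f' f] lin_comp[OF g' g]] _ t])
    (simp add: tmap_pure[OF f g] tmap_pure[OF f' g'] tmap_pure[OF lin_comp[OF f' f] lin_comp[OF g' g]]
      lin_closed[OF f] lin_closed[OF g])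

lemma tlift_tmap:
  assumes f: "lin M M' f" and g: "lin N N' g" and b: "bilin M' N' P \<beta>"
    and t: "t \<in> carrier (tensor K M N)"
  shows "tlift P \<beta> (tmap K M' N' f g t) = tlift P (\<lambda>x y. \<beta> (f x) (g y)) t"
  unfolding tmap_def
  by (subst tlift_fusion[OF tlift_lin[OF b] tmap_bilin[OF f g] t])
    (rule tlift_cong[OF t], auto intro!: bilinI lin_comp[OF bilinD(4)[OF b] g] lin_comp[OF bilinD(5)[OF b] f]
      simp: tlift_pure[OF b] lin_closed[OF f] lin_closed[OF g]
       lin_vs1[OF f] lin_vs1[OF g] bilinD(3)[OF b])

text \<open>
  The Fubini rule for two independent integrals.
\<close>

lemma tlift_swap:
  assumes t: "t \<in> carrier (tensor K M N)" and s: "s \<in> carrier (tensor K M' N')"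
    and V: "vs M" "vs N" "vs M'" "vs N'" "vs P"
    and b1: "\<And>x y. x \<in> carrier M \<Longrightarrow> y \<in> carrier N \<Longrightarrow> bilin M' N' P (\<beta> x y)"
    and b2: "\<And>z w. z \<in> carrier M' \<Longrightarrow> w \<in> carrier N' \<Longrightarrow> bilin M N P (\<lambda>x y. \<beta> x y z w)"
  shows "tlift P (\<lambda>x y. tlift P (\<beta> x y) s) t = tlift P (\<lambda>z w. tlift P (\<lambda>x y. \<beta> x y z w) t) s"
proof -
  have c: "bilin M N P (\<lambda>x y. tlift P (\<beta> x y) s)"
    by (intro bilinI lin_tlift_fun[OF s] V) (auto intro!: V b1 bilinD(4,5)[OF b2] bilinD(4,5)[OF b1])
  have d: "bilin M' N' P (\<lambda>z w. tlift P (\<lambda>x y. \<beta> x y z w) t)"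
    by (intro bilinI lin_tlift_fun[OF t] V) (auto intro!: V b2 bilinD(4,5)[OF b1] bilinD(4,5)[OF b2])
  have l2: "lin (tensor K M N) P (\<lambda>t. tlift P (\<lambda>z w. tlift P (\<lambda>x y. \<beta> x y z w) t) s)"
    by (intro lin_tlift_fun[OF s] V tensor_vs tlift_lin bilinI b2 lin_tlift_fun)
      (auto intro!: V b2 bilinD(4,5)[OF b1] bilinD(4,5)[OF b2])
  show ?thesis
    apply (rule tensor_eqI[OF V(1,2) tlift_lin[OF c] l2 _ t])
    apply (simp add: tlift_pure[OF c])
    apply (rule tlift_cong[OF s])
     apply (auto intro!: bilinI V lin_tlift_fun bilinD(4,5)[OF b1] bilinD(4,5)[OF b2] simp: tlift_pure[OF b2] pure_closed V intro: b2)
    done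
qed

lemma assoc_facts:
  fixes M :: "('k, 'm) module" and N :: "('k, 'n) module" and P :: "('k, 'p) module"
  assumes V: "vs M" "vs N" "vs P"
  shows assoc_lin: "lin (tensor K (tensor K M N) P) (tensor K M (tensor K N P)) (assoc K M N P)"
    and assoc_pure2: "\<And>t z. t \<in> carrier (tensor K M N) \<Longrightarrow> z \<in> carrier P \<Longrightarrow>
      assoc K M N P (pure K (tensor K M N) P t z) =
      tlift (tensor K M (tensor K N P)) (\<lambda>x y. pure K M (tensor K N P) x (pure K N P y z)) t"
    and assoc_pure: "\<And>x y z. x \<in> carrier M \<Longrightarrow> y \<in> carrier N \<Longrightarrow> z \<in> carrier P \<Longrightarrow>
      assoc K M N P (pure K (tensor K M N) P (pure K M N x y) z) = pure K M (tensor K N P) x (pure K N P y z)"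
proof -
  let ?T = "tensor K M (tensor K N P)"
  note T = tensor_vs[OF V(1) tensor_vs[OF V(2,3)]]
  have a: "bilin M N ?T (\<lambda>x y. pure K M (tensor K N P) x (pure K N P y z))" if "z \<in> carrier P" for z
    using that by (intro bilinI V T lin_pure1 lin_pure2 lin_id tensor_vs pure_closed)
  have b: "bilin (tensor K M N) P ?T (\<lambda>t z. tlift ?T (\<lambda>x y. pure K M (tensor K N P) x (pure K N P y z)) t)"
    by (intro bilinI V T tensor_vs tlift_lin a lin_tlift_fun lin_pure2 lin_id)
      (auto intro!: V T tensor_vs lin_pure1 lin_pure2 lin_id pure_closed)
  show "lin (tensor K (tensor K M N) P) ?T (assoc K M N P)"
    unfolding assoc_def Let_def by (rule tlift_lin[OF b])
  show 1: "assoc K M N P (pure K (tensor K M N) P t z) =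
      tlift ?T (\<lambda>x y. pure K M (tensor K N P) x (pure K N P y z)) t"
    if "t \<in> carrier (tensor K M N)" "z \<in> carrier P" for t z
    unfolding assoc_def Let_def by (rule tlift_pure[OF b that])
  show "assoc K M N P (pure K (tensor K M N) P (pure K M N x y) z) = pure K M (tensor K N P) x (pure K N P y z)"
    if "x \<in> carrier M" "y \<in> carrier N" "z \<in> carrier P" for x y z
    using that by (simp add: 1 pure_closed V tlift_pure[OF a])
qed

lemma assoc_inv_facts:
  fixes M :: "('k, 'm) module" and N :: "('k, 'n) module" and P :: "('k, 'p) module"
  assumes V: "vs M" "vs N" "vs P"
  shows assoc_inv_lin: "lin (tensor K M (tensor K N P)) (tensor K (tensor K M N) P) (assoc_inv K M N P)"
    and assoc_inv_pure2: "\<And>x t. x \<in> carrier M \<Longrightarrow> t \<in> carrier (tensor K N P) \<Longrightarrow>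
      assoc_inv K M N P (pure K M (tensor K N P) x t) =
      tlift (tensor K (tensor K M N) P) (\<lambda>y z. pure K (tensor K M N) P (pure K M N x y) z) t"
    and assoc_inv_pure: "\<And>x y z. x \<in> carrier M \<Longrightarrow> y \<in> carrier N \<Longrightarrow> z \<in> carrier P \<Longrightarrow>
      assoc_inv K M N P (pure K M (tensor K N P) x (pure K N P y z)) = pure K (tensor K M N) P (pure K M N x y) z"
proof -
  let ?T = "tensor K (tensor K M N) P"
  note T = tensor_vs[OF tensor_vs[OF V(1,2)] V(3)]
  have a: "bilin N P ?T (\<lambda>y z. pure K (tensor K M N) P (pure K M N x y) z)" if "x \<in> carrier M" for x
    using that by (intro bilinI V T lin_pure1 lin_pure2 lin_id tensor_vs pure_closed)
  have b: "bilin M (tensor K N P) ?T (\<lambda>x t. tlift ?T (\<lambda>y z. pure K (tensor K M N) P (pure K M N x y) z) t)"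
    by (intro bilinI V T tensor_vs tlift_lin a lin_tlift_fun lin_pure1 lin_id)
      (auto intro!: V T tensor_vs lin_pure1 lin_pure2 lin_id pure_closed)
  show "lin (tensor K M (tensor K N P)) ?T (assoc_inv K M N P)"
    unfolding assoc_inv_def Let_def by (rule tlift_lin[OF b])
  show 1: "assoc_inv K M N P (pure K M (tensor K N P) x t) =
      tlift ?T (\<lambda>y z. pure K (tensor K M N) P (pure K M N x y) z) t"
    if "x \<in> carrier M" "t \<in> carrier (tensor K N P)" for x t
    unfolding assoc_inv_def Let_def by (rule tlift_pure[OF b that])
  show "assoc_inv K M N P (pure K M (tensor K N P) x (pure K N P y z)) = pure K (tensor K M N) P (pure K M N x y) z"
    if "x \<in> carrier M" "y \<in> carrier N" "z \<in> carrier P" for x y z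
    using that by (simp add: 1 pure_closed V tlift_pure[OF a])
qed

lemma tmap_mem_span:
  assumes f: "lin M M' f" and g: "lin N N' g" and t: "t \<in> carrier (tensor K M N)"
    and S: "\<And>x y. x \<in> carrier M \<Longrightarrow> y \<in> carrier N \<Longrightarrow> pure K M' N' (f x) (g y) \<in> S"
      "S \<subseteq> carrier (tensor K M' N')"
  shows "tmap K M' N' f g t \<in> lin_span K (tensor K M' N') S"
proof -
  note V = lin_vs1[OF f] lin_vs1[OF g]
  have "t \<in> {t \<in> carrier (tensor K M N). tmap K M' N' f g t \<in> lin_span K (tensor K M' N') S}"
    by (rule tensor_induct[OF V submod_lin_vimage[OF tmap_lin[OF f g] lin_span_submod] _ t])
      (use S lin_span_incl[of S "tensor K M' N'"] f g in \<open>auto simp: tmap_pure[OF f g] pure_closed V lin_vs2 intro: tensor_vs\<close>)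
  then show ?thesis by auto
qed

section \<open>Tensor powers\<close>

text \<open>
  A function of words is cut open at the slot in which it is to be linear, in the same way as in the
  relators of the tensor power.
\<close>

definition mlin where
  "mlin M n P g \<longleftrightarrow> vs M \<and> vs P \<and> g \<in> words M n \<rightarrow> carrier P \<and>
    (\<forall>xs zs. set xs \<subseteq> carrier M \<longrightarrow> set zs \<subseteq> carrier M \<longrightarrow> length xs + length zs + 1 = n \<longrightarrow>
      lin M P (\<lambda>y. g (xs @ y # zs)))"

lemma mlinI:
  assumes "vs M" "vs P" "\<And>xs. xs \<in> words M n \<Longrightarrow> g xs \<in> carrier P"
    "\<And>xs zs. set xs \<subseteq> carrier M \<Longrightarrow> set zs \<subseteq> carrier M \<Longrightarrow> length xs + length zs + 1 = n \<Longrightarrow>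
      lin M P (\<lambda>y. g (xs @ y # zs))"
  shows "mlin M n P g"
  using assms by (auto simp: mlin_def)

lemma mlinD:
  assumes "mlin M n P g"
  shows "vs M" "vs P" "\<And>xs. xs \<in> words M n \<Longrightarrow> g xs \<in> carrier P"
    "\<And>xs zs. set xs \<subseteq> carrier M \<Longrightarrow> set zs \<subseteq> carrier M \<Longrightarrow> length xs + length zs + 1 = n \<Longrightarrow>
      lin M P (\<lambda>y. g (xs @ y # zs))"
  using assms by (auto simp: mlin_def)

lemma tpow_relators_free:
  assumes "vs M"
  shows "tpow_relators K M n \<subseteq> carrier (free_module K (words M n))"
  using assms free_vs[of "words M n"]
  by (auto simp: tpow_relators_def words_def Let_def intro!: vs_simps unit_vec_mem)

lemma tpow_vs: "vs M \<Longrightarrow> vs (tpow K M n)"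
  unfolding tpow_def by (rule presented_vs[OF tpow_relators_free])

lemma tword_mlin:
  assumes M: "vs M" shows "mlin M n (tpow K M n) (tword K M)"
proof (rule mlinI[OF M tpow_vs[OF M]])
  note R = tpow_relators_free[OF M, of n]
  show c: "tword K M xs \<in> carrier (tpow K M n)" if "xs \<in> words M n" for xs
    using gen_closed[OF R that] that by (simp add: tword_def tpow_def words_def)
  fix xs zs assume xs: "set xs \<subseteq> carrier M" "set zs \<subseteq> carrier M" and n: "length xs + length zs + 1 = n"
  have w: "xs @ y # zs \<in> words M n" if "y \<in> carrier M" for y
    using that xs n by (auto simp: words_def)
  have len: "length (xs @ y # zs) = n" for y using n by simp
  show "lin M (tpow K M n) (\<lambda>y. tword K M (xs @ y # zs))"
  proof (rule linI[OF M tpow_vs[OF M]])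
    show "tword K M (xs @ y # zs) \<in> carrier (tpow K M n)" if "y \<in> carrier M" for y
      by (rule c[OF w[OF that]])
    show "tword K M (xs @ (y \<oplus>\<^bsub>M\<^esub> y') # zs)
      = tword K M (xs @ y # zs) \<oplus>\<^bsub>tpow K M n\<^esub> tword K M (xs @ y' # zs)"
      if y: "y \<in> carrier M" "y' \<in> carrier M" for y y'
      unfolding tword_def tpow_def len
    proof (rule gen_add[OF R])
      show "unit_vec K (xs @ (y \<oplus>\<^bsub>M\<^esub> y') # zs) \<ominus>\<^bsub>free_module K (words M n)\<^esub>
        (unit_vec K (xs @ y # zs) \<oplus>\<^bsub>free_module K (words M n)\<^esub> unit_vec K (xs @ y' # zs))
        \<in> tpow_relators K M n"
        unfolding tpow_relators_def Let_def
        by (intro UnI1 CollectI exI[of _ xs] exI[of _ y] exI[of _ y'] exI[of _ zs])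
          (use y w in auto)
    qed (use M w y in auto)
    show "tword K M (xs @ (r \<odot>\<^bsub>M\<^esub> y) # zs) = r \<odot>\<^bsub>tpow K M n\<^esub> tword K M (xs @ y # zs)"
      if y: "y \<in> carrier M" "r \<in> carrier K" for y r
      unfolding tword_def tpow_def len
    proof (rule gen_smult[OF R])
      show "unit_vec K (xs @ (r \<odot>\<^bsub>M\<^esub> y) # zs) \<ominus>\<^bsub>free_module K (words M n)\<^esub>
        r \<odot>\<^bsub>free_module K (words M n)\<^esub> unit_vec K (xs @ y # zs) \<in> tpow_relators K M n"
        unfolding tpow_relators_def Let_def
        by (intro UnI2 CollectI exI[of _ xs] exI[of _ y] exI[of _ r] exI[of _ zs])
          (use y w in auto)
    qed (use M w y in auto)
  qed
qed

lemma tword_closed: "vs M \<Longrightarrow> xs \<in> words M n \<Longrightarrow> tword K M xs \<in> carrier (tpow K M n)"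
  by (rule mlinD(3)[OF tword_mlin])

lemma mlift_facts:
  assumes g: "mlin M n P g"
  shows mlift_lin: "lin (tpow K M n) P (lift K P g)"
    and mlift_word: "\<And>xs. xs \<in> words M n \<Longrightarrow> lift K P g (tword K M xs) = g xs"
proof -
  note D = mlinD[OF g]
  note R = tpow_relators_free[OF D(1), of n]
  have gp: "g \<in> words M n \<rightarrow> carrier P" using D(3) by auto
  have r: "extend P g u = \<zero>\<^bsub>P\<^esub>" if "u \<in> tpow_relators K M n" for u
  proof -
    have "(\<exists>xs y y' zs. u = unit_vec K (xs @ (y \<oplus>\<^bsub>M\<^esub> y') # zs) \<ominus>\<^bsub>free_module K (words M n)\<^esub>
          (unit_vec K (xs @ y # zs) \<oplus>\<^bsub>free_module K (words M n)\<^esub> unit_vec K (xs @ y' # zs)) \<and>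
          xs @ y # zs \<in> words M n \<and> xs @ y' # zs \<in> words M n) \<or>
      (\<exists>r xs y zs. u = unit_vec K (xs @ (r \<odot>\<^bsub>M\<^esub> y) # zs) \<ominus>\<^bsub>free_module K (words M n)\<^esub>
          r \<odot>\<^bsub>free_module K (words M n)\<^esub> unit_vec K (xs @ y # zs) \<and>
          r \<in> carrier K \<and> xs @ y # zs \<in> words M n)"
      using that unfolding tpow_relators_def Let_def Un_iff mem_Collect_eq append_Cons append_Nil .
    then show ?thesis
    proof (elim disjE exE conjE)
      fix xs y y' zs
      assume u: "u = unit_vec K (xs @ (y \<oplus>\<^bsub>M\<^esub> y') # zs) \<ominus>\<^bsub>free_module K (words M n)\<^esub>
          (unit_vec K (xs @ y # zs) \<oplus>\<^bsub>free_module K (words M n)\<^esub> unit_vec K (xs @ y' # zs))"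
        and w: "xs @ y # zs \<in> words M n" "xs @ y' # zs \<in> words M n"
      then have "lin M P (\<lambda>y. g (xs @ y # zs))" by (intro D(4)) (auto simp: words_def)
      from lin_add[OF this] show ?thesis unfolding u using w D(1)
        by (intro extend_rel_add[OF D(2) gp]) (auto simp: words_def)
    next
      fix r xs y zs
      assume u: "u = unit_vec K (xs @ (r \<odot>\<^bsub>M\<^esub> y) # zs) \<ominus>\<^bsub>free_module K (words M n)\<^esub>
          r \<odot>\<^bsub>free_module K (words M n)\<^esub> unit_vec K (xs @ y # zs)"
        and w: "r \<in> carrier K" "xs @ y # zs \<in> words M n"
      then have "lin M P (\<lambda>y. g (xs @ y # zs))" by (intro D(4)) (auto simp: words_def)
      from lin_smult[OF this] show ?thesis unfolding u using w D(1)
        by (intro extend_rel_smult[OF D(2) gp]) (auto simp: words_def)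
    qed
  qed
  show "lin (tpow K M n) P (lift K P g)"
    unfolding tpow_def by (rule lift_lin[OF R D(2) gp r])
  show "lift K P g (tword K M xs) = g xs" if "xs \<in> words M n" for xs
    using lift_gen[OF R D(2) gp r that] that by (simp add: tword_def words_def)
qed

lemma tpow_induct:
  assumes "vs M" "submodule H K (tpow K M n)"
    "\<And>xs. xs \<in> words M n \<Longrightarrow> tword K M xs \<in> H" "t \<in> carrier (tpow K M n)"
  shows "t \<in> H"
  by (rule presented_induct[OF tpow_relators_free[OF assms(1), of n] assms(2)[unfolded tpow_def] _
        assms(4)[unfolded tpow_def]])
    (use assms(3) in \<open>auto simp: tword_def words_def\<close>)

lemma tpow_eqI:
  assumes "vs M" and f: "lin (tpow K M n) P f" and g: "lin (tpow K M n) P g"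
    and eq: "\<And>xs. xs \<in> words M n \<Longrightarrow> f (tword K M xs) = g (tword K M xs)"
    and t: "t \<in> carrier (tpow K M n)"
  shows "f t = g t"
  using tpow_induct[OF assms(1) submod_eq[OF f g] _ t] eq tword_closed[OF assms(1)] by auto

lemma mlift_cong:
  assumes "t \<in> carrier (tpow K M n)" "mlin M n P g" "\<And>xs. xs \<in> words M n \<Longrightarrow> f xs = g xs"
  shows "lift K P f t = lift K P g t"
  by (rule lift_cong[OF tpow_relators_free[OF mlinD(1)[OF assms(2)]] assms(1)[unfolded tpow_def]
        mlinD(2)[OF assms(2)]])
    (use mlinD(3)[OF assms(2)] assms(3) in auto)

text \<open>
  Multilinear functions can be built by recursion on words: linearity in the head and
  multilinearity in the tail suffice.
\<close>

lemma mlin_Cons: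
  assumes V: "vs M" "vs P"
    and 1: "\<And>x. x \<in> carrier M \<Longrightarrow> mlin M n P (\<lambda>xs. g (x # xs))"
    and 2: "\<And>xs. xs \<in> words M n \<Longrightarrow> lin M P (\<lambda>x. g (x # xs))"
  shows "mlin M (Suc n) P g"
proof (rule mlinI[OF V])
  fix xs assume "xs \<in> words M (Suc n)"
  then obtain y ys where "xs = y # ys" "y \<in> carrier M" "ys \<in> words M n"
    by (cases xs) (auto simp: words_def)
  then show "g xs \<in> carrier P" using lin_closed[OF 2] by auto
next
  fix xs zs assume "set xs \<subseteq> carrier M" "set zs \<subseteq> carrier M" "length xs + length zs + 1 = Suc n"
  then show "lin M P (\<lambda>y. g (xs @ y # zs))"
    using 2 mlinD(4)[OF 1] by (cases xs) (auto simp: words_def)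
qed

lemma mlin_ConsD:
  assumes g: "mlin M (Suc n) P g" and x: "x \<in> carrier M"
  shows "mlin M n P (\<lambda>xs. g (x # xs))"
proof (rule mlinI[OF mlinD(1,2)[OF g]])
  show "g (x # xs) \<in> carrier P" if "xs \<in> words M n" for xs
    using mlinD(3)[OF g, of "x # xs"] that x by (auto simp: words_def)
  show "lin M P (\<lambda>y. g (x # xs @ y # zs))"
    if "set xs \<subseteq> carrier M" "set zs \<subseteq> carrier M" "length xs + length zs + 1 = n" for xs zs
    using mlinD(4)[OF g, of "x # xs" zs] that x by auto
qed

lemma mlin_comp: "lin P Q f \<Longrightarrow> mlin M n P g \<Longrightarrow> mlin M n Q (\<lambda>xs. f (g xs))"
  by (rule mlinI) (auto dest: mlinD lin_vs2 lin_closed intro!: lin_comp[of P Q f M])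


lemma lin_mlift_fun:
  assumes t: "t \<in> carrier (tpow K M n)" and L: "vs L" "vs M" "vs P"
    and a: "\<And>xs. xs \<in> words M n \<Longrightarrow> lin L P (\<lambda>x. \<beta> x xs)"
    and b: "\<And>x. x \<in> carrier L \<Longrightarrow> mlin M n P (\<beta> x)"
  shows "lin L P (\<lambda>x. lift K P (\<beta> x) t)"
proof -
  have "t \<in> {t \<in> carrier (tpow K M n). lin L P (\<lambda>x. lift K P (\<beta> x) t)}"
  proof (rule tpow_induct[OF L(2) submod_lin_param[OF L(1) mlift_lin[OF b] tpow_vs[OF L(2)] L(3)] _ t])
    show "tword K M xs \<in> {t \<in> carrier (tpow K M n). lin L P (\<lambda>x. lift K P (\<beta> x) t)}"
      if "xs \<in> words M n" for xs
      using lin_cong[OF a[OF that]] mlift_word[OF b that] that tword_closed[OF L(2)] by auto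
  qed
  then show ?thesis by auto
qed

lemma mlin_cong:
  assumes g: "mlin M n P g" and eq: "\<And>xs. xs \<in> words M n \<Longrightarrow> h xs = g xs"
  shows "mlin M n P h"
proof (rule mlinI[OF mlinD(1,2)[OF g]])
  show "h xs \<in> carrier P" if "xs \<in> words M n" for xs
    using that mlinD(3)[OF g] by (simp add: eq)
  fix xs zs assume w: "set xs \<subseteq> carrier M" "set zs \<subseteq> carrier M" "length xs + length zs + 1 = n"
  show "lin M P (\<lambda>y. h (xs @ y # zs))"
    by (rule lin_cong[OF mlinD(4)[OF g w]], rule eq[symmetric]) (use w in \<open>auto simp: words_def\<close>)
qed

section \<open>Transported spaces and the ground ring\<close>

lemma transport_facts:
  fixes M :: "('k, 'm) module" and f :: "'m \<Rightarrow> 'n"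
  assumes M: "vs M" and g: "\<And>x. g (f x) = x"
  shows transport_vs: "vs (transport f g M)"
    and transport_lin: "lin M (transport f g M) f"
    and transport_inv_lin: "lin (transport f g M) M g"
proof -
  interpret M: module K M by fact
  have s: "carrier (transport f g M) = f ` carrier M" "\<zero>\<^bsub>transport f g M\<^esub> = f \<zero>\<^bsub>M\<^esub>"
    "x \<oplus>\<^bsub>transport f g M\<^esub> y = f (g x \<oplus>\<^bsub>M\<^esub> g y)" "r \<odot>\<^bsub>transport f g M\<^esub> x = f (r \<odot>\<^bsub>M\<^esub> g x)"
    for x y r by (simp_all add: transport_def)
  show T: "vs (transport f g M)"
    by (rule vsI; unfold s; (elim imageE)?; simp add: s g M.a_assoc M.smult_l_distr M.smult_r_distr
        M.smult_assoc1 M.l_neg M.smult_l_minus; simp add: M.a_comm)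
  show "lin M (transport f g M) f"
    by (rule linI[OF M T]) (simp_all add: s g)
  show "lin (transport f g M) M g"
    by (rule linI[OF T M]) (auto simp: s g)
qed

lemma ground_simps [simp]:
  "carrier (ground K) = carrier K" "add (ground K) = add K" "zero (ground K) = zero K"
  "r \<odot>\<^bsub>ground K\<^esub> s = r \<otimes>\<^bsub>K\<^esub> s"
  by (simp_all add: ground_def)

lemma ground_vs [simp]: "vs (ground K)"
  by (rule vsI) (auto simp: a_ac l_distr r_distr m_assoc l_minus l_neg r_neg)

lemma lin_scale:
  assumes f: "lin L (ground K) f" and M: "vs M" "x \<in> carrier M"
  shows "lin L M (\<lambda>l. f l \<odot>\<^bsub>M\<^esub> x)"
  using lin_closed[OF f]
  by (intro linI[OF lin_vs1[OF f] M(1)])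
    (simp_all add: M lin_add[OF f] lin_smult[OF f] module.smult_l_distr[OF M(1)] module.smult_assoc1[OF M(1)])

end

section \<open>The spaces of forms\<close>

locale universal_forms = scalars K for K :: "'k ring" +
  fixes A :: "('k, 'a) module"
  assumes alg: "nonunital_algebra K A"
begin

lemma A_vs [simp]: "vs A"
  using alg by (simp add: nonunital_algebra_def)

lemma A_bilin: "bilin A A A (\<lambda>x y. x \<otimes>\<^bsub>A\<^esub> y)"
  using alg
  by (intro bilinI linI A_vs)
    (auto simp: nonunital_algebra.mult_closed nonunital_algebra.mult_l_distr
      nonunital_algebra.mult_r_distr nonunital_algebra.mult_smult_l nonunital_algebra.mult_smult_r)

lemma A_closed [simp]: "x \<in> carrier A \<Longrightarrow> y \<in> carrier A \<Longrightarrow> x \<otimes>\<^bsub>A\<^esub> y \<in> carrier A"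
  by (rule bilinD(6)[OF A_bilin])

abbreviation U where "U \<equiv> unitization K A"
abbreviation Om where "Om \<equiv> Omega K A"
abbreviation deg where "deg \<equiv> Omega_deg K A"
abbreviation incl where "incl \<equiv> Omega_incl K A"

lemma U_carrier: "p \<in> carrier U \<longleftrightarrow> fst p \<in> carrier A \<and> snd p \<in> carrier K"
  by (cases p) (auto simp: unitization_def)

lemma U_simps [simp]:
  "p \<oplus>\<^bsub>U\<^esub> q = (fst p \<oplus>\<^bsub>A\<^esub> fst q, snd p \<oplus>\<^bsub>K\<^esub> snd q)" "\<zero>\<^bsub>U\<^esub> = (\<zero>\<^bsub>A\<^esub>, \<zero>\<^bsub>K\<^esub>)"
  "r \<odot>\<^bsub>U\<^esub> p = (r \<odot>\<^bsub>A\<^esub> fst p, r \<otimes>\<^bsub>K\<^esub> snd p)"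
  by (simp_all add: unitization_def case_prod_beta)

lemma pair_mem [simp]: "a \<in> carrier A \<Longrightarrow> r \<in> carrier K \<Longrightarrow> (a, r) \<in> carrier U"
  by (simp add: U_carrier)

lemma U_vs [simp]: "vs U"
proof -
  interpret A: module K A by simp
  show ?thesis
    by (rule vsI; simp add: U_carrier A.a_assoc a_assoc A.smult_l_distr l_distr A.smult_r_distr r_distr
        A.smult_assoc1 m_assoc A.l_neg A.smult_l_minus l_minus l_neg prod_eq_iff; simp add: A.a_comm a_comm)
qed

lemma fst_mem [simp]: "p \<in> carrier U \<Longrightarrow> fst p \<in> carrier A"
  and snd_mem [simp]: "p \<in> carrier U \<Longrightarrow> snd p \<in> carrier K"
  by (auto simp: U_carrier)

lemma lin_fst: "lin U A fst"
  by (rule linI) simp_all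

lemma lin_snd: "lin U (ground K) snd"
  by (rule linI) simp_all

lemma lin_pair:
  assumes f: "lin L A f" and g: "lin L (ground K) g" shows "lin L U (\<lambda>x. (f x, g x))"
  using lin_closed[OF f] lin_closed[OF g]
  by (intro linI lin_vs1[OF f] U_vs)
    (simp_all add: lin_add[OF f] lin_add[OF g] lin_smult[OF f] lin_smult[OF g])

lemma U_mult: "p \<otimes>\<^bsub>U\<^esub> q = (fst p \<otimes>\<^bsub>A\<^esub> fst q \<oplus>\<^bsub>A\<^esub> snd p \<odot>\<^bsub>A\<^esub> fst q \<oplus>\<^bsub>A\<^esub> snd q \<odot>\<^bsub>A\<^esub> fst p, snd p \<otimes>\<^bsub>K\<^esub> snd q)"
  by (simp add: unitization_def case_prod_beta)

lemma lin_kmult: "r \<in> carrier K \<Longrightarrow> lin L (ground K) f \<Longrightarrow> lin L (ground K) (\<lambda>x. r \<otimes>\<^bsub>K\<^esub> f x)"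
  unfolding ground_simps(4)[symmetric] by (rule lin_smult_fun)

lemma lin_kmult2: "r \<in> carrier K \<Longrightarrow> lin L (ground K) f \<Longrightarrow> lin L (ground K) (\<lambda>x. f x \<otimes>\<^bsub>K\<^esub> r)"
  unfolding ground_simps(4)[symmetric] by (rule lin_scale) simp_all

lemma U_bilin: "bilin U U U (\<lambda>p q. p \<otimes>\<^bsub>U\<^esub> q)"
  unfolding U_mult
  by (intro bilinI U_vs lin_pair lin_add_fun lin_smult_fun lin_scale A_vs lin_kmult lin_kmult2 lin_fst lin_snd
      lin_comp[OF bilinD(4)[OF A_bilin] lin_fst] lin_comp[OF bilinD(5)[OF A_bilin] lin_fst]) auto

lemma U_closed [simp]: "p \<in> carrier U \<Longrightarrow> q \<in> carrier U \<Longrightarrow> p \<otimes>\<^bsub>U\<^esub> q \<in> carrier U"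
  by (rule bilinD(6)[OF U_bilin])

lemma U_assoc:
  assumes "p \<in> carrier U" "q \<in> carrier U" "r \<in> carrier U"
  shows "p \<otimes>\<^bsub>U\<^esub> q \<otimes>\<^bsub>U\<^esub> r = p \<otimes>\<^bsub>U\<^esub> (q \<otimes>\<^bsub>U\<^esub> r)"
proof -
  interpret A: module K A by simp
  obtain a \<mu> b \<nu> c \<rho> where [simp]: "p = (a, \<mu>)" "q = (b, \<nu>)" "r = (c, \<rho>)" by (metis surj_pair)
  have c [simp]: "a \<in> carrier A" "b \<in> carrier A" "c \<in> carrier A" "\<mu> \<in> carrier K" "\<nu> \<in> carrier K" "\<rho> \<in> carrier K"
    using assms by (auto simp: U_carrier simp del: fst_mem snd_mem)
  have s: "\<mu> \<odot>\<^bsub>A\<^esub> (\<rho> \<odot>\<^bsub>A\<^esub> b) = \<rho> \<odot>\<^bsub>A\<^esub> (\<mu> \<odot>\<^bsub>A\<^esub> b)"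
    "\<nu> \<odot>\<^bsub>A\<^esub> (\<rho> \<odot>\<^bsub>A\<^esub> a) = \<rho> \<odot>\<^bsub>A\<^esub> (\<nu> \<odot>\<^bsub>A\<^esub> a)"
    by (auto intro: vs_smult_comm)
  show ?thesis
    using alg
    by (simp add: U_mult m_assoc nonunital_algebra.mult_assoc nonunital_algebra.mult_l_distr
        nonunital_algebra.mult_r_distr nonunital_algebra.mult_smult_l nonunital_algebra.mult_smult_r
        A.smult_r_distr A.smult_assoc1 s A.a_ac)
qed

lemma deg_vs [simp]: "vs (deg n)"
  unfolding Omega_deg_def by (auto intro!: transport_vs tensor_vs tpow_vs)

text \<open>
  The coefficients \<open>a\<^sub>0 + \<mu>\<close> that occur in degree \<open>n\<close>: a form of degree \<open>0\<close> is an element of \<open>A\<close>.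
\<close>

definition valid :: "nat \<Rightarrow> 'a \<times> 'k \<Rightarrow> bool" where
  "valid n p \<longleftrightarrow> p \<in> carrier U \<and> (n = 0 \<longrightarrow> snd p = \<zero>\<^bsub>K\<^esub>)"

text \<open>
  The families from which maps on \<open>\<Omega>\<^sup>nA\<close> are built. All families below are linear in \<open>\<mu>\<close> in degree \<open>0\<close>
  as well, so that one condition serves every degree.
\<close>

definition wml where
  "wml n P g \<longleftrightarrow> (\<forall>p\<in>carrier U. mlin A n P (g p)) \<and> (\<forall>as\<in>words A n. lin U P (\<lambda>p. g p as))"

lemma wmlI:
  "(\<And>p. p \<in> carrier U \<Longrightarrow> mlin A n P (g p)) \<Longrightarrow> (\<And>as. as \<in> words A n \<Longrightarrow> lin U P (\<lambda>p. g p as)) \<Longrightarrow> wml n P g"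
  by (auto simp: wml_def)

lemma wmlD:
  assumes "wml n P g"
  shows "p \<in> carrier U \<Longrightarrow> mlin A n P (g p)" "as \<in> words A n \<Longrightarrow> lin U P (\<lambda>p. g p as)"
    "p \<in> carrier U \<Longrightarrow> as \<in> words A n \<Longrightarrow> g p as \<in> carrier P" "vs P"
  using assms mlinD(2)[of A n P "g \<zero>\<^bsub>U\<^esub>"] vs_zero[OF U_vs] by (auto simp: wml_def mlinD)

lemma wml_comp: "lin P Q f \<Longrightarrow> wml n P g \<Longrightarrow> wml n Q (\<lambda>p as. f (g p as))"
  by (auto simp: wml_def intro: mlin_comp lin_comp)

lemma wml_cong:
  assumes g: "wml n P g" and eq: "\<And>p as. as \<in> words A n \<Longrightarrow> h p as = g p as"
  shows "wml n P h"
  by (rule wmlI) (rule mlin_cong[OF wmlD(1)[OF g]] lin_cong[OF wmlD(2)[OF g]]; simp add: eq)+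

lemma mlin_0: "vs P \<Longrightarrow> g [] \<in> carrier P \<Longrightarrow> mlin A 0 P g"
  by (rule mlinI) (auto simp: words_def)

lemma form_wml: "wml n (deg n) (form K A)"
proof (cases "n = 0")
  case True
  have "lin A (deg 0) Inl" using transport_lin[OF A_vs, of projl Inl] by (simp add: Omega_deg_def)
  from lin_comp[OF this lin_fst] have l: "lin U (deg 0) (\<lambda>p. Inl (fst p))" .
  have e: "form K A p [] = Inl (fst p)" for p by (simp add: form_def)
  have "wml 0 (deg 0) (form K A)"
  proof (rule wmlI)
    show "mlin A 0 (deg 0) (form K A p)" if "p \<in> carrier U" for p
      by (rule mlin_0[OF deg_vs]) (simp add: e lin_closed[OF l that])
    show "lin U (deg 0) (\<lambda>p. form K A p as)" if "as \<in> words A 0" for as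
      using that l by (simp add: words_def e)
  qed
  then show ?thesis using True by simp
next
  case False
  let ?T = "tensor K U (tpow K A n)"
  have T: "vs ?T" by (intro tensor_vs tpow_vs) auto
  have i: "lin ?T (deg n) Inr" unfolding Omega_deg_def using False transport_lin[OF T, of projr Inr] by simp
  have w: "wml n ?T (\<lambda>p as. pure K U (tpow K A n) p (tword K A as))"
    by (intro wmlI mlin_comp[OF bilinD(4)[OF pure_bilin]] tword_mlin bilinD(5)[OF pure_bilin] U_vs
        tpow_vs A_vs tword_closed)
  have "wml n (deg n) (\<lambda>p as. Inr (pure K U (tpow K A n) p (tword K A as)))"
    by (rule wml_comp[OF i w])
  moreover have "form K A p as = Inr (pure K U (tpow K A n) p (tword K A as))" if "as \<in> words A n" for p as
    using that False by (auto simp: form_def words_def)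
  ultimately show ?thesis by (rule wml_cong)
qed

lemma form_closed: "p \<in> carrier U \<Longrightarrow> as \<in> words A n \<Longrightarrow> form K A p as \<in> carrier (deg n)"
  by (rule wmlD(3)[OF form_wml])

text \<open>
  The forms \<open>(a\<^sub>0 + \<mu>) da\<^sub>1 \<dots> da\<^sub>n\<close> span \<open>\<Omega>\<^sup>nA\<close>.
\<close>

lemma deg_induct:
  assumes H: "submodule H K (deg n)" and e: "\<And>p as. as \<in> words A n \<Longrightarrow> valid n p \<Longrightarrow> form K A p as \<in> H"
    and u: "u \<in> carrier (deg n)"
  shows "u \<in> H"
proof (cases "n = 0")
  case True
  then obtain a where "a \<in> carrier A" "u = Inl a" using u by (auto simp: Omega_deg_def transport_def)
  then show ?thesis using e[of "[]" "(a, \<zero>\<^bsub>K\<^esub>)"] True by (auto simp: valid_def words_def form_def)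
next
  case False
  let ?T = "tensor K U (tpow K A n)"
  have P: "vs (tpow K A n)" by (simp add: tpow_vs)
  note T = tensor_vs[OF U_vs P]
  have i: "lin ?T (deg n) Inr" unfolding Omega_deg_def using False transport_lin[OF T, of projr Inr] by simp
  obtain t where t: "t \<in> carrier ?T" "u = Inr t" using u False by (auto simp: Omega_deg_def transport_def)
  have "t \<in> {t \<in> carrier ?T. Inr t \<in> H}"
  proof (rule tensor_induct[OF U_vs P submod_lin_vimage[OF i H] _ t(1)])
    fix p s assume p: "p \<in> carrier U" and s: "s \<in> carrier (tpow K A n)"
    have l: "lin (tpow K A n) (deg n) (\<lambda>s. Inr (pure K U (tpow K A n) p s))"
      by (rule lin_comp[OF i bilinD(4)[OF pure_bilin[OF U_vs P] p]])
    have "s \<in> {s \<in> carrier (tpow K A n). Inr (pure K U (tpow K A n) p s) \<in> H}"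
    proof (rule tpow_induct[OF A_vs submod_lin_vimage[OF l H] _ s])
      fix as assume as: "as \<in> words A n"
      then have "form K A p as = Inr (pure K U (tpow K A n) p (tword K A as))"
        using False by (auto simp: form_def words_def)
      then show "tword K A as \<in> {s \<in> carrier (tpow K A n). Inr (pure K U (tpow K A n) p s) \<in> H}"
        using e[OF as, of p] p False tword_closed[OF A_vs as] by (auto simp: valid_def)
    qed
    then show "pure K U (tpow K A n) p s \<in> {t \<in> carrier ?T. Inr t \<in> H}"
      using pure_closed[OF U_vs P p s] by auto
  qed
  then show ?thesis using t by auto
qed

lemma deg_eqI:
  assumes f: "lin (deg n) P f" and g: "lin (deg n) P g"
    and eq: "\<And>p as. as \<in> words A n \<Longrightarrow> valid n p \<Longrightarrow> f (form K A p as) = g (form K A p as)"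
    and u: "u \<in> carrier (deg n)"
  shows "f u = g u"
  using deg_induct[OF submod_eq[OF f g] _ u] eq form_closed by (auto simp: valid_def)

lemma inner_bilin:
  assumes g: "wml n P g"
  shows "bilin U (tpow K A n) P (\<lambda>p s. lift K P (g p) s)"
  using g by (intro bilinI U_vs tpow_vs A_vs lin_mlift_fun mlift_lin) (auto intro: wmlD)

text \<open>
  The universal property of \<open>\<Omega>\<^sup>nA\<close>: a multilinear family extends uniquely to a linear map.
\<close>

lemma form_lift_facts:
  assumes g: "wml n P g"
  shows form_lift_lin: "lin (deg n) P (form_lift K P g)"
    and form_lift_form: "\<And>p as. as \<in> words A n \<Longrightarrow> valid n p \<Longrightarrow> form_lift K P g (form K A p as) = g p as"
proof -
  have "lin (deg n) P (form_lift K P g) \<and>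
    (\<forall>p as. as \<in> words A n \<longrightarrow> valid n p \<longrightarrow> form_lift K P g (form K A p as) = g p as)"
  proof (cases "n = 0")
    case True
    have l: "lin A U (\<lambda>a. (a, \<zero>\<^bsub>K\<^esub>))"
      by (rule lin_pair) (auto intro!: lin_id linI)
    have "lin A P (\<lambda>a. g (a, \<zero>\<^bsub>K\<^esub>) [])"
      by (rule lin_comp[OF wmlD(2)[OF g] l]) (simp add: True words_def)
    then have "lin (deg n) P (\<lambda>u. g (projl u, \<zero>\<^bsub>K\<^esub>) [])"
      using lin_comp[OF _ transport_inv_lin[OF A_vs, of projl Inl], of P "\<lambda>a. g (a, \<zero>\<^bsub>K\<^esub>) []"]
      by (simp add: Omega_deg_def True)
    then have "lin (deg n) P (form_lift K P g)"
      by (rule lin_cong) (auto simp: Omega_deg_def True transport_def form_lift_def)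
    then show ?thesis
      by (auto simp: True form_lift_def form_def words_def valid_def prod_eq_iff
          intro!: arg_cong2[where f=g])
  next
    case False
    let ?T = "tensor K U (tpow K A n)"
    have P: "vs (tpow K A n)" by (simp add: tpow_vs)
    note T = tensor_vs[OF U_vs P]
    note b = inner_bilin[OF g]
    have "lin (deg n) P (\<lambda>u. tlift P (\<lambda>p s. lift K P (g p) s) (projr u))"
      using lin_comp[OF tlift_lin[OF b] transport_inv_lin[OF T, of projr Inr]] False
      by (simp add: Omega_deg_def)
    then have "lin (deg n) P (form_lift K P g)"
      by (rule lin_cong) (auto simp: Omega_deg_def False transport_def form_lift_def)
    moreover have "form_lift K P g (form K A p as) = g p as" if "as \<in> words A n" "valid n p" for p as
    proof -
      have "form_lift K P g (form K A p as) = lift K P (g p) (tword K A as)"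
        using that False tlift_pure[OF b, of p "tword K A as"] tword_closed[OF A_vs, of as n]
        by (auto simp: form_lift_def form_def words_def valid_def)
      also have "\<dots> = g p as"
        using that by (intro mlift_word[OF wmlD(1)[OF g]]) (auto simp: valid_def)
      finally show ?thesis .
    qed
    ultimately show ?thesis by blast
  qed
  then show "lin (deg n) P (form_lift K P g)"
    "\<And>p as. as \<in> words A n \<Longrightarrow> valid n p \<Longrightarrow> form_lift K P g (form K A p as) = g p as" by auto
qed

lemma form_lift_cong:
  assumes u: "u \<in> carrier (deg n)" and g: "wml n P g"
    and eq: "\<And>p as. as \<in> words A n \<Longrightarrow> valid n p \<Longrightarrow> f p as = g p as"
  shows "form_lift K P f u = form_lift K P g u"
proof (cases "n = 0")
  case True
  then show ?thesis using u eq[of "[]"]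
    by (auto simp: Omega_deg_def transport_def form_lift_def valid_def words_def)
next
  case False
  then obtain t where t: "u = Inr t" "t \<in> carrier (tensor K U (tpow K A n))"
    using u by (auto simp: Omega_deg_def transport_def)
  have "tlift P (\<lambda>p s. lift K P (f p) s) t = tlift P (\<lambda>p s. lift K P (g p) s) t"
    by (rule tlift_cong[OF t(2) inner_bilin[OF g]], rule mlift_cong)
      (use g eq False in \<open>auto simp: valid_def intro: wmlD\<close>)
  then show ?thesis by (simp add: t form_lift_def)
qed

lemma lin_form_lift_fun:
  assumes u: "u \<in> carrier (deg n)" and L: "vs L" "vs P"
    and b: "\<And>x. x \<in> carrier L \<Longrightarrow> wml n P (\<beta> x)"
    and a: "\<And>p as. as \<in> words A n \<Longrightarrow> valid n p \<Longrightarrow> lin L P (\<lambda>x. \<beta> x p as)"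
  shows "lin L P (\<lambda>x. form_lift K P (\<beta> x) u)"
proof -
  have "u \<in> {u \<in> carrier (deg n). lin L P (\<lambda>x. form_lift K P (\<beta> x) u)}"
  proof (rule deg_induct[OF submod_lin_param[OF L(1) form_lift_lin[OF b] deg_vs L(2)] _ u])
    show "form K A p as \<in> {u \<in> carrier (deg n). lin L P (\<lambda>x. form_lift K P (\<beta> x) u)}"
      if "as \<in> words A n" "valid n p" for p as
      using lin_cong[OF a[OF that]] form_lift_form[OF b that] form_closed[OF _ that(1)] that(2)
      by (auto simp: valid_def)
  qed
  then show ?thesis by auto
qed

section \<open>The direct sum\<close>

lemma Om_carrier: "x \<in> carrier Om \<longleftrightarrow> (\<forall>n. x n \<in> carrier (deg n)) \<and> finite {n. x n \<noteq> \<zero>\<^bsub>deg n\<^esub>}"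
  by (simp add: Omega_def dsum_def)

lemma Om_add: "x \<oplus>\<^bsub>Om\<^esub> y = (\<lambda>n. x n \<oplus>\<^bsub>deg n\<^esub> y n)"
  and Om_smult: "r \<odot>\<^bsub>Om\<^esub> x = (\<lambda>n. r \<odot>\<^bsub>deg n\<^esub> x n)"
  and Om_zero: "\<zero>\<^bsub>Om\<^esub> = (\<lambda>n. \<zero>\<^bsub>deg n\<^esub>)"
  by (simp_all add: Omega_def dsum_def)

lemma Om_vs [simp]: "vs Om"
proof (rule vsI)
  fix x y assume xy: "x \<in> carrier Om" "y \<in> carrier Om"
  then have "finite ({n. x n \<noteq> \<zero>\<^bsub>deg n\<^esub>} \<union> {n. y n \<noteq> \<zero>\<^bsub>deg n\<^esub>})" by (simp add: Om_carrier)
  moreover have "{n. x n \<oplus>\<^bsub>deg n\<^esub> y n \<noteq> \<zero>\<^bsub>deg n\<^esub>} \<subseteq> {n. x n \<noteq> \<zero>\<^bsub>deg n\<^esub>} \<union> {n. y n \<noteq> \<zero>\<^bsub>deg n\<^esub>}"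
    by auto
  ultimately show "x \<oplus>\<^bsub>Om\<^esub> y \<in> carrier Om"
    using xy by (auto simp: Om_carrier Om_add intro: finite_subset)
next
  fix r x assume "r \<in> carrier K" "x \<in> carrier Om"
  then show "r \<odot>\<^bsub>Om\<^esub> x \<in> carrier Om"
    by (auto simp: Om_carrier Om_smult elim!: rev_finite_subset)
next
  fix x assume "x \<in> carrier Om"
  then have c: "x n \<in> carrier (deg n)" for n by (simp add: Om_carrier)
  show "(\<ominus>\<^bsub>K\<^esub> \<one>\<^bsub>K\<^esub>) \<odot>\<^bsub>Om\<^esub> x \<oplus>\<^bsub>Om\<^esub> x = \<zero>\<^bsub>Om\<^esub>"
    using c abelian_group.l_neg[OF module.axioms(2)[OF deg_vs]]
    by (simp add: Om_add Om_smult Om_zero vs_neg_eq[OF deg_vs, symmetric])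
qed (auto simp: Om_carrier Om_add Om_smult Om_zero module.smult_l_distr[OF deg_vs]
    module.smult_r_distr[OF deg_vs] module.smult_assoc1[OF deg_vs]
    abelian_groupE(3)[OF module.axioms(2)[OF deg_vs]]
    intro!: ext intro: abelian_groupE(4)[OF module.axioms(2)[OF deg_vs]])

lemma comp_lin: "lin Om (deg n) (\<lambda>x. x n)"
  by (rule linI) (auto simp: Om_add Om_smult Om_carrier)

lemma incl_lin: "lin (deg n) Om (incl n)"
proof (rule linI)
  fix u assume u: "u \<in> carrier (deg n)"
  have "finite {m. (if m = n then u else \<zero>\<^bsub>deg m\<^esub>) \<noteq> \<zero>\<^bsub>deg m\<^esub>}"
    by (rule finite_subset[of _ "{n}"]) auto
  with u show "incl n u \<in> carrier Om" by (auto simp: Om_carrier Omega_incl_def)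
qed (auto simp: Omega_incl_def Om_add Om_smult fun_eq_iff)

lemma incl_same [simp]: "incl n u n = u" and incl_other: "m \<noteq> n \<Longrightarrow> incl n u m = \<zero>\<^bsub>deg m\<^esub>"
  by (auto simp: Omega_incl_def)

lemma Om_expand:
  assumes x: "x \<in> carrier Om" and S: "finite S" "{n. x n \<noteq> \<zero>\<^bsub>deg n\<^esub>} \<subseteq> S"
  shows "(\<Oplus>\<^bsub>Om\<^esub>n\<in>S. incl n (x n)) = x"
proof -
  have c: "x n \<in> carrier (deg n)" for n using x by (simp add: Om_carrier)
  have "(\<Oplus>\<^bsub>Om\<^esub>n\<in>S. incl n (x n)) = (\<lambda>n. if n \<in> S then x n else \<zero>\<^bsub>deg n\<^esub>)"
    using S(1)
  proof (induction S)
    case empty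
    then show ?case by (simp add: vs_finsum_empty Om_zero)
  next
    case (insert m S)
    have "(\<Oplus>\<^bsub>Om\<^esub>n\<in>insert m S. incl n (x n)) = incl m (x m) \<oplus>\<^bsub>Om\<^esub> (\<Oplus>\<^bsub>Om\<^esub>n\<in>S. incl n (x n))"
      using insert c lin_closed[OF incl_lin] by (intro vs_finsum_insert) auto
    also have "\<dots> = (\<lambda>n. if n \<in> insert m S then x n else \<zero>\<^bsub>deg n\<^esub>)"
      using insert c by (auto simp: Om_add Omega_incl_def fun_eq_iff)
    finally show ?case .
  qed
  also have "\<dots> = x"
  proof
    fix n
    have "n \<notin> S \<Longrightarrow> n \<notin> {n. x n \<noteq> \<zero>\<^bsub>deg n\<^esub>}" using S(2) by blast
    then show "(if n \<in> S then x n else \<zero>\<^bsub>deg n\<^esub>) = x n" by simp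
  qed
  finally show ?thesis .
qed

lemma Om_induct_deg:
  assumes H: "submodule H K Om" and e: "\<And>n u. u \<in> carrier (deg n) \<Longrightarrow> incl n u \<in> H"
    and x: "x \<in> carrier Om"
  shows "x \<in> H"
proof -
  note D = submodD[OF Om_vs H]
  have c: "x n \<in> carrier (deg n)" for n using x by (simp add: Om_carrier)
  have "(\<Oplus>\<^bsub>Om\<^esub>n\<in>S. incl n (x n)) \<in> H" if "finite S" for S
    using that
  proof (induction S)
    case empty
    then show ?case using D(2) by (simp add: vs_finsum_empty)
  next
    case (insert m S)
    then show ?case using D(3) e c lin_closed[OF incl_lin]
      by (subst vs_finsum_insert) auto
  qed
  moreover have fin: "finite {n. x n \<noteq> \<zero>\<^bsub>deg n\<^esub>}" using x by (simp add: Om_carrier)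
  ultimately have "(\<Oplus>\<^bsub>Om\<^esub>n\<in>{n. x n \<noteq> \<zero>\<^bsub>deg n\<^esub>}. incl n (x n)) \<in> H" by blast
  then show ?thesis by (simp only: Om_expand[OF x fin subset_refl])
qed

text \<open>
  The form \<open>(a\<^sub>0 + \<mu>) da\<^sub>1 \<dots> da\<^sub>n\<close> as an element of the direct sum \<open>\<Omega>A\<close>.
\<close>

definition wform where "wform p as = incl (length as) (form K A p as)"

lemma wform_closed: "p \<in> carrier U \<Longrightarrow> set as \<subseteq> carrier A \<Longrightarrow> wform p as \<in> carrier Om"
  unfolding wform_def by (intro lin_closed[OF incl_lin] form_closed) (auto simp: words_def)

lemma wform_wml: "wml n Om wform"
proof -
  have "wml n Om (\<lambda>p as. incl n (form K A p as))" by (rule wml_comp[OF incl_lin form_wml])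
  moreover have "wform p as = incl n (form K A p as)" if "as \<in> words A n" for p as
    using that by (simp add: wform_def words_def)
  ultimately show ?thesis by (rule wml_cong)
qed

lemma Om_induct:
  assumes H: "submodule H K Om"
    and e: "\<And>p as. set as \<subseteq> carrier A \<Longrightarrow> valid (length as) p \<Longrightarrow> wform p as \<in> H"
    and x: "x \<in> carrier Om"
  shows "x \<in> H"
proof (rule Om_induct_deg[OF H _ x])
  fix n u assume u: "u \<in> carrier (deg n)"
  have "u \<in> {u \<in> carrier (deg n). incl n u \<in> H}"
  proof (rule deg_induct[OF submod_lin_vimage[OF incl_lin H] _ u])
    fix p as assume "as \<in> words A n" "valid n p"
    then show "form K A p as \<in> {u \<in> carrier (deg n). incl n u \<in> H}"
      using e[of as p] by (auto simp: words_def wform_def valid_def intro: form_closed)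
  qed
  then show "incl n u \<in> H" by auto
qed

lemma Om_eqI:
  assumes f: "lin Om P f" and g: "lin Om P g"
    and eq: "\<And>p as. set as \<subseteq> carrier A \<Longrightarrow> valid (length as) p \<Longrightarrow> f (wform p as) = g (wform p as)"
    and u: "x \<in> carrier Om"
  shows "f x = g x"
  using Om_induct[OF submod_eq[OF f g] _ u] eq wform_closed by (auto simp: valid_def)

text \<open>
  The linear map on \<open>\<Omega>A\<close> determined by its values on forms of all degrees. The map \<open>\<psi>\<close>-hat is
  defined by a sum of this shape.
\<close>

definition wlift where
  "wlift P g x = (\<Oplus>\<^bsub>P\<^esub>n\<in>{n. x n \<noteq> \<zero>\<^bsub>deg n\<^esub>}. form_lift K P g (x n))"

lemma wlift_superset:
  assumes g: "\<And>n. wml n P g" and x: "x \<in> carrier Om"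
    and S: "finite S" "{n. x n \<noteq> \<zero>\<^bsub>deg n\<^esub>} \<subseteq> S"
  shows "wlift P g x = (\<Oplus>\<^bsub>P\<^esub>n\<in>S. form_lift K P g (x n))"
  unfolding wlift_def
  by (rule vs_finsum_mono[OF wmlD(4)[OF g] S])
    (use x in \<open>auto simp: Om_carrier lin_zero[OF form_lift_lin[OF g]] intro!: lin_closed[OF form_lift_lin[OF g]]\<close>)

lemma wlift_facts:
  assumes g: "\<And>n. wml n P g"
  shows wlift_lin: "lin Om P (wlift P g)"
    and wlift_incl: "\<And>n u. u \<in> carrier (deg n) \<Longrightarrow> wlift P g (incl n u) = form_lift K P g u"
    and wlift_wform: "\<And>p as. set as \<subseteq> carrier A \<Longrightarrow> valid (length as) p \<Longrightarrow> wlift P g (wform p as) = g p as"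
proof -
  note P = wmlD(4)[OF g]
  note l = form_lift_lin[OF g]
  show "lin Om P (wlift P g)"
  proof (rule linI[OF Om_vs P])
    fix x assume x: "x \<in> carrier Om"
    then show "wlift P g x \<in> carrier P"
      unfolding wlift_def by (intro vs_finsum_closed P lin_closed[OF l]) (auto simp: Om_carrier)
    have fx: "form_lift K P g (z n) \<in> carrier P" if "z \<in> carrier Om" for z n
      by (rule lin_closed[OF form_lift_lin[OF g[of n]]]) (use that in \<open>simp add: Om_carrier\<close>)
    {
      fix y assume y: "y \<in> carrier Om"
      let ?S = "{n. x n \<noteq> \<zero>\<^bsub>deg n\<^esub>} \<union> {n. y n \<noteq> \<zero>\<^bsub>deg n\<^esub>}"
      have S: "finite ?S" using x y by (simp add: Om_carrier)
      have "wlift P g (x \<oplus>\<^bsub>Om\<^esub> y) = (\<Oplus>\<^bsub>P\<^esub>n\<in>?S. form_lift K P g ((x \<oplus>\<^bsub>Om\<^esub> y) n))"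
        by (rule wlift_superset[OF g vs_add[OF Om_vs x y] S]) (auto simp: Om_add)
      also have "\<dots> = (\<Oplus>\<^bsub>P\<^esub>n\<in>?S. form_lift K P g (x n) \<oplus>\<^bsub>P\<^esub> form_lift K P g (y n))"
        by (rule vs_finsum_cong[OF P])
          (use fx x y in \<open>simp_all add: Om_add Om_carrier lin_add[OF l] P\<close>)
      also have "\<dots> = (\<Oplus>\<^bsub>P\<^esub>n\<in>?S. form_lift K P g (x n)) \<oplus>\<^bsub>P\<^esub> (\<Oplus>\<^bsub>P\<^esub>n\<in>?S. form_lift K P g (y n))"
      proof -
        interpret P: module K P by (rule P)
        show ?thesis by (rule P.finsum_addf) (use fx x y in auto)
      qed
      also have "\<dots> = wlift P g x \<oplus>\<^bsub>P\<^esub> wlift P g y"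
        using wlift_superset[OF g x S] wlift_superset[OF g y S] by auto
      finally show "wlift P g (x \<oplus>\<^bsub>Om\<^esub> y) = wlift P g x \<oplus>\<^bsub>P\<^esub> wlift P g y" .
    }
    fix r assume r: "r \<in> carrier K"
    let ?S = "{n. x n \<noteq> \<zero>\<^bsub>deg n\<^esub>}"
    have S: "finite ?S" using x by (simp add: Om_carrier)
    have "wlift P g (r \<odot>\<^bsub>Om\<^esub> x) = (\<Oplus>\<^bsub>P\<^esub>n\<in>?S. form_lift K P g ((r \<odot>\<^bsub>Om\<^esub> x) n))"
      by (rule wlift_superset[OF g vs_smult[OF Om_vs r x] S]) (use r in \<open>auto simp: Om_smult\<close>)
    also have "\<dots> = (\<Oplus>\<^bsub>P\<^esub>n\<in>?S. r \<odot>\<^bsub>P\<^esub> form_lift K P g (x n))"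
      by (rule vs_finsum_cong[OF P])
        (use fx x r in \<open>simp_all add: Om_smult Om_carrier lin_smult[OF l] P\<close>)
    also have "\<dots> = r \<odot>\<^bsub>P\<^esub> wlift P g x"
      unfolding wlift_def
      by (rule module.finsum_smult_ldistr[OF P S r, symmetric]) (use fx x in auto)
    finally show "wlift P g (r \<odot>\<^bsub>Om\<^esub> x) = r \<odot>\<^bsub>P\<^esub> wlift P g x" .
  qed
  show i: "wlift P g (incl n u) = form_lift K P g u" if u: "u \<in> carrier (deg n)" for n u
  proof -
    have "wlift P g (incl n u) = (\<Oplus>\<^bsub>P\<^esub>m\<in>{n}. form_lift K P g (incl n u m))"
      by (rule wlift_superset[OF g lin_closed[OF incl_lin u]]) (auto simp: incl_other intro: ccontr)
    also have "\<dots> = form_lift K P g u"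
      using P lin_closed[OF l u] by (subst vs_finsum_insert) (auto simp: vs_finsum_empty)
    finally show ?thesis .
  qed
  show "wlift P g (wform p as) = g p as" if "set as \<subseteq> carrier A" "valid (length as) p" for p as
    unfolding wform_def using that
    by (subst i) (auto intro!: form_closed form_lift_form[OF g] simp: words_def valid_def)
qed

lemma lin_wlift_fun:
  assumes x: "x \<in> carrier Om" and L: "vs L" "vs P"
    and b: "\<And>n l. l \<in> carrier L \<Longrightarrow> wml n P (\<beta> l)"
    and a: "\<And>p as. set as \<subseteq> carrier A \<Longrightarrow> valid (length as) p \<Longrightarrow> lin L P (\<lambda>l. \<beta> l p as)"
  shows "lin L P (\<lambda>l. wlift P (\<beta> l) x)"
  unfolding wlift_def using x
  by (intro lin_finsum_fun L lin_form_lift_fun b a) (auto simp: Om_carrier words_def)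

lemma lin_OmI:
  assumes "\<And>n. lin M (deg n) (\<lambda>x. f x n)" "\<And>x. x \<in> carrier M \<Longrightarrow> f x \<in> carrier Om"
  shows "lin M Om f"
  by (rule linI[OF lin_vs1[OF assms(1)] Om_vs assms(2)])
    (simp_all add: Om_add Om_smult fun_eq_iff lin_add[OF assms(1)] lin_smult[OF assms(1)])


lemma lin_wform: "set as \<subseteq> carrier A \<Longrightarrow> lin U Om (\<lambda>p. wform p as)"
  by (rule wmlD(2)[OF wform_wml, of _ "length as"]) (simp add: words_def)

lemma lin_inl: "lin A U (\<lambda>a. (a, \<zero>\<^bsub>K\<^esub>))"
  by (rule lin_pair) (auto intro!: lin_id linI)

abbreviation unit_U where "unit_U \<equiv> (\<zero>\<^bsub>A\<^esub>, \<one>\<^bsub>K\<^esub>)"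

section \<open>The differential\<close>

abbreviation d where "d \<equiv> Omega_d K A"

lemma d_wml: "wml n Om (\<lambda>p as. wform unit_U (fst p # as))"
proof (rule wmlI)
  have m: "mlin A (Suc n) Om (wform unit_U)" by (rule wmlD(1)[OF wform_wml]) simp
  show "mlin A n Om (\<lambda>as. wform unit_U (fst p # as))" if "p \<in> carrier U" for p
    by (rule mlin_ConsD[OF m]) (simp add: that)
  show "lin U Om (\<lambda>p. wform unit_U (fst p # as))" if "as \<in> words A n" for as
    using lin_comp[OF mlinD(4)[OF m, of "[]" as] lin_fst] that by (simp add: words_def)
qed

lemma d_deg_wml: "wml n (deg (Suc n)) (\<lambda>p as. form K A unit_U (fst p # as))"
proof (rule wml_cong[OF wml_comp[OF comp_lin d_wml[of n], of "Suc n"]])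
  show "form K A unit_U (fst p # as) = wform unit_U (fst p # as) (Suc n)"
    if "as \<in> words A n" for p as
    using that by (simp add: wform_def words_def)
qed

lemma d_lin: "lin Om Om d"
proof (rule lin_OmI)
  note l = form_lift_lin[OF d_deg_wml]
  show c: "lin Om (deg n) (\<lambda>x. d x n)" for n
    by (cases n) (simp_all add: Omega_d_def lin_const0 lin_comp[OF l comp_lin])
  fix x assume x: "x \<in> carrier Om"
  have "{n. d x n \<noteq> \<zero>\<^bsub>deg n\<^esub>} \<subseteq> Suc ` {n. x n \<noteq> \<zero>\<^bsub>deg n\<^esub>}"
  proof
    fix n assume "n \<in> {n. d x n \<noteq> \<zero>\<^bsub>deg n\<^esub>}"
    then obtain m where m: "n = Suc m" "d x (Suc m) \<noteq> \<zero>\<^bsub>deg (Suc m)\<^esub>"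
      by (cases n) (auto simp: Omega_d_def)
    then have "x m \<noteq> \<zero>\<^bsub>deg m\<^esub>" using lin_zero[OF l] by (auto simp: Omega_d_def)
    with m(1) show "n \<in> Suc ` {n. x n \<noteq> \<zero>\<^bsub>deg n\<^esub>}" by auto
  qed
  moreover have "finite {n. x n \<noteq> \<zero>\<^bsub>deg n\<^esub>}" using x by (simp add: Om_carrier)
  ultimately show "d x \<in> carrier Om"
    using lin_closed[OF c x] by (auto simp: Om_carrier intro: finite_subset)
qed

lemma d_incl:
  assumes "u \<in> carrier (deg n)"
  shows "d (incl n u) = incl (Suc n) (form_lift K (deg (Suc n)) (\<lambda>p as. form K A unit_U (fst p # as)) u)"
proof
  fix m show "d (incl n u) m =
    incl (Suc n) (form_lift K (deg (Suc n)) (\<lambda>p as. form K A unit_U (fst p # as)) u) m"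
    using lin_zero[OF form_lift_lin[OF d_deg_wml]]
    by (cases m) (auto simp: Omega_d_def Omega_incl_def)
qed

lemma d_wform:
  "set as \<subseteq> carrier A \<Longrightarrow> valid (length as) p \<Longrightarrow> d (wform p as) = wform unit_U (fst p # as)"
  unfolding wform_def
  by (subst d_incl) (auto simp: form_closed words_def valid_def form_lift_form[OF d_deg_wml])

text \<open>
  This is \<open>d0 = 0\<close>, and the reason for \<open>d\<^sup>2 = 0\<close>: the coefficient \<open>0 + 1\<close> of \<open>da\<^sub>0 da\<^sub>1 \<dots> da\<^sub>n\<close> has
  \<open>A\<close>-part \<open>0\<close>.
\<close>

lemma wform_0: "set as \<subseteq> carrier A \<Longrightarrow> p \<in> carrier U \<Longrightarrow> wform p (\<zero>\<^bsub>A\<^esub> # as) = \<zero>\<^bsub>Om\<^esub>"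
  using lin_zero[OF mlinD(4)[OF wmlD(1)[OF wform_wml, of p "Suc (length as)"], of "[]" as]] by simp

lemma d_d: "x \<in> carrier Om \<Longrightarrow> d (d x) = \<zero>\<^bsub>Om\<^esub>"
  by (rule Om_eqI[OF lin_comp[OF d_lin d_lin] lin_const0[OF Om_vs Om_vs]])
    (auto simp: d_wform valid_def wform_0)

section \<open>Left multiplications as operators\<close>

text \<open>
  Left multiplication by \<open>p \<in> A \<oplus> k\<close>; it preserves \<open>\<Omega>\<^sup>0A = A\<close>, since \<open>A\<close> is an ideal of \<open>A \<oplus> k\<close>.
\<close>

definition lop where "lop p = wlift Om (\<lambda>q qs. wform (p \<otimes>\<^bsub>U\<^esub> q) qs)"

lemma lop_wml: "p \<in> carrier U \<Longrightarrow> wml n Om (\<lambda>q qs. wform (p \<otimes>\<^bsub>U\<^esub> q) qs)"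
  by (intro wmlI wmlD(1)[OF wform_wml] lin_comp[OF wmlD(2)[OF wform_wml] bilinD(4)[OF U_bilin]]) auto

lemma lop_lin: "p \<in> carrier U \<Longrightarrow> lin Om Om (lop p)"
  unfolding lop_def by (rule wlift_lin[OF lop_wml])

lemma lop_closed [simp]: "p \<in> carrier U \<Longrightarrow> y \<in> carrier Om \<Longrightarrow> lop p y \<in> carrier Om"
  by (rule lin_closed[OF lop_lin])

lemma d_closed [simp]: "y \<in> carrier Om \<Longrightarrow> d y \<in> carrier Om"
  by (rule lin_closed[OF d_lin])

lemma lop_wform:
  "p \<in> carrier U \<Longrightarrow> set as \<subseteq> carrier A \<Longrightarrow> valid (length as) q \<Longrightarrow> lop p (wform q as) = wform (p \<otimes>\<^bsub>U\<^esub> q) as"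
  unfolding lop_def by (rule wlift_wform[OF lop_wml])

lemma lop_lin1: "y \<in> carrier Om \<Longrightarrow> lin U Om (\<lambda>p. lop p y)"
  unfolding lop_def
  by (intro lin_wlift_fun lop_wml U_vs Om_vs lin_comp[OF lin_wform bilinD(5)[OF U_bilin]])
    (auto simp: valid_def)

lemma validD: "valid n q \<Longrightarrow> q \<in> carrier U"
  by (simp add: valid_def)

lemma valid_mult: "p \<in> carrier U \<Longrightarrow> valid n q \<Longrightarrow> valid n (p \<otimes>\<^bsub>U\<^esub> q)"
  by (auto simp: valid_def U_mult)

lemma lop_lop:
  assumes "p \<in> carrier U" "q \<in> carrier U" "y \<in> carrier Om"
  shows "lop p (lop q y) = lop (p \<otimes>\<^bsub>U\<^esub> q) y"
proof (rule Om_eqI[OF lin_comp[OF lop_lin lop_lin] lop_lin _ assms(3)])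
  fix r as assume "set as \<subseteq> carrier A" "valid (length as) r"
  then show "lop p (lop q (wform r as)) = lop (p \<otimes>\<^bsub>U\<^esub> q) (wform r as)"
    using assms validD[of "length as" r] by (simp add: lop_wform valid_mult U_assoc)
qed (use assms in auto)

text \<open>
  The operator \<open>y \<mapsto> da \<cdot> y\<close>, expressed by \<open>da \<cdot> y = d(a y) - a dy\<close>.
\<close>

definition delta where
  "delta a y = d (lop (a, \<zero>\<^bsub>K\<^esub>) y) \<ominus>\<^bsub>Om\<^esub> lop (a, \<zero>\<^bsub>K\<^esub>) (d y)"

lemma delta_lin: "a \<in> carrier A \<Longrightarrow> lin Om Om (delta a)"
  unfolding delta_def[abs_def]
  by (intro lin_minus_fun lin_comp[OF d_lin lop_lin] lin_comp[OF lop_lin d_lin]) auto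

lemma delta_lin1: "y \<in> carrier Om \<Longrightarrow> lin A Om (\<lambda>a. delta a y)"
  unfolding delta_def
  by (intro lin_minus_fun lin_comp[OF d_lin lin_comp[OF lop_lin1 lin_inl]] lin_comp[OF lop_lin1 lin_inl]) auto

lemma delta_closed [simp]: "a \<in> carrier A \<Longrightarrow> y \<in> carrier Om \<Longrightarrow> delta a y \<in> carrier Om"
  by (rule lin_closed[OF delta_lin])

lemma foldr_delta_lin: "set as \<subseteq> carrier A \<Longrightarrow> lin Om Om (foldr delta as)"
  by (induction as) (auto intro!: lin_id lin_comp[OF delta_lin] simp: comp_def id_def)

lemma foldr_delta_closed [simp]: "set as \<subseteq> carrier A \<Longrightarrow> y \<in> carrier Om \<Longrightarrow> foldr delta as y \<in> carrier Om"
  by (rule lin_closed[OF foldr_delta_lin])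

lemma foldr_delta_mlin: "y \<in> carrier Om \<Longrightarrow> mlin A n Om (\<lambda>as. foldr delta as y)"
proof (induction n)
  case 0
  then show ?case by (auto intro: mlin_0)
next
  case (Suc n)
  show ?case
    by (rule mlin_Cons)
      (use Suc in \<open>auto simp: words_def comp_def intro!: delta_lin1 mlin_comp[OF delta_lin]\<close>)
qed

text \<open>
  The operator by which \<open>(p\<^sub>0 + \<mu>) dp\<^sub>1 \<dots> dp\<^sub>i\<close> has to multiply from the left.
\<close>

definition lam where "lam p ps y = lop p (foldr delta ps y)"

lemma lam_wml: "y \<in> carrier Om \<Longrightarrow> wml n Om (\<lambda>p ps. lam p ps y)"
  unfolding lam_def
  by (intro wmlI mlin_comp[OF lop_lin] foldr_delta_mlin lop_lin1) (auto simp: words_def)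

lemma lam_lin: "p \<in> carrier U \<Longrightarrow> set ps \<subseteq> carrier A \<Longrightarrow> lin Om Om (lam p ps)"
  unfolding lam_def[abs_def] by (rule lin_comp[OF lop_lin foldr_delta_lin])

lemma lam_closed [simp]:
  "p \<in> carrier U \<Longrightarrow> set ps \<subseteq> carrier A \<Longrightarrow> y \<in> carrier Om \<Longrightarrow> lam p ps y \<in> carrier Om"
  by (rule lin_closed[OF lam_lin])

text \<open>
  A product on \<open>\<Omega>A\<close> that is bilinear by construction. It turns out to be the product of \<open>Omega K A\<close>
  (\<open>Om_mult\<close>).
\<close>

definition mul where "mul x y = wlift Om (\<lambda>p ps. lam p ps y) x"

lemma mul_bilin: "bilin Om Om Om mul"
  unfolding mul_def[abs_def]
  by (intro bilinI Om_vs wlift_lin lin_wlift_fun lam_wml lam_lin) (auto simp: valid_def)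

lemma mul_closed [simp]: "x \<in> carrier Om \<Longrightarrow> y \<in> carrier Om \<Longrightarrow> mul x y \<in> carrier Om"
  by (rule bilinD(6)[OF mul_bilin])

lemmas mul_lin = bilinD(4)[OF mul_bilin]
lemmas mul_lin1 = bilinD(5)[OF mul_bilin]

lemma mul_wform:
  "set ps \<subseteq> carrier A \<Longrightarrow> valid (length ps) p \<Longrightarrow> y \<in> carrier Om \<Longrightarrow> mul (wform p ps) y = lam p ps y"
  unfolding mul_def by (rule wlift_wform[OF lam_wml])

section \<open>Associativity and the Leibniz rule\<close>

lemma one_U_mult: "q \<in> carrier U \<Longrightarrow> unit_U \<otimes>\<^bsub>U\<^esub> q = q"
  and U_mult_one: "q \<in> carrier U \<Longrightarrow> q \<otimes>\<^bsub>U\<^esub> unit_U = q"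
  using lin_zero[OF bilinD(4)[OF A_bilin]] lin_zero[OF bilinD(5)[OF A_bilin]]
  by (auto simp: U_mult prod_eq_iff)

lemma one_mem [simp]: "unit_U \<in> carrier U" by simp

lemma lop_one: "y \<in> carrier Om \<Longrightarrow> lop unit_U y = y"
  by (rule Om_eqI[OF lop_lin lin_id]) (auto simp: lop_wform one_U_mult valid_def)

lemma lop_split:
  assumes "p \<in> carrier U" "y \<in> carrier Om"
  shows "lop p y = lop (fst p, \<zero>\<^bsub>K\<^esub>) y \<oplus>\<^bsub>Om\<^esub> snd p \<odot>\<^bsub>Om\<^esub> y"
proof -
  have "p = (fst p, \<zero>\<^bsub>K\<^esub>) \<oplus>\<^bsub>U\<^esub> snd p \<odot>\<^bsub>U\<^esub> unit_U" using assms by (simp add: prod_eq_iff)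
  then have "lop p y = lop ((fst p, \<zero>\<^bsub>K\<^esub>) \<oplus>\<^bsub>U\<^esub> snd p \<odot>\<^bsub>U\<^esub> unit_U) y" by simp
  also have "\<dots> = lop (fst p, \<zero>\<^bsub>K\<^esub>) y \<oplus>\<^bsub>Om\<^esub> snd p \<odot>\<^bsub>Om\<^esub> lop unit_U y"
    using assms lin_add[OF lop_lin1[OF assms(2)], of "(fst p, \<zero>\<^bsub>K\<^esub>)" "snd p \<odot>\<^bsub>U\<^esub> unit_U"]
      lin_smult[OF lop_lin1[OF assms(2)], of "snd p" "unit_U"]
    by (simp del: U_simps)
  finally show ?thesis using assms by (simp add: lop_one)
qed

lemma delta_wform:
  assumes a: "a \<in> carrier A" and as: "set as \<subseteq> carrier A" and q: "valid (length as) q"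
  shows "delta a (wform q as) = wform unit_U ((a \<otimes>\<^bsub>A\<^esub> fst q) # as)
    \<ominus>\<^bsub>Om\<^esub> wform (a, \<zero>\<^bsub>K\<^esub>) (fst q # as) \<oplus>\<^bsub>Om\<^esub> snd q \<odot>\<^bsub>Om\<^esub> wform unit_U (a # as)"
proof -
  interpret Om: module K Om by simp
  have q': "q \<in> carrier U" using q by (simp add: valid_def)
  have z: "valid (length (fst q # as)) unit_U" by (simp add: valid_def)
  have l: "lin A Om (\<lambda>y. wform unit_U (y # as))"
    using mlinD(4)[OF wmlD(1)[OF wform_wml, of _ "Suc (length as)"] , of "unit_U" "[]" as] as by simp
  have "d (lop (a, \<zero>\<^bsub>K\<^esub>) (wform q as)) = wform unit_U ((a \<otimes>\<^bsub>A\<^esub> fst q \<oplus>\<^bsub>A\<^esub> snd q \<odot>\<^bsub>A\<^esub> a) # as)"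
    using a as q q' valid_mult[OF _ q, of "(a, \<zero>\<^bsub>K\<^esub>)"]
    by (simp add: lop_wform d_wform) (simp add: U_mult)
  also have "\<dots> = wform unit_U ((a \<otimes>\<^bsub>A\<^esub> fst q) # as)
      \<oplus>\<^bsub>Om\<^esub> snd q \<odot>\<^bsub>Om\<^esub> wform unit_U (a # as)"
    using a q' by (simp add: lin_add[OF l] lin_smult[OF l])
  finally have 1: "d (lop (a, \<zero>\<^bsub>K\<^esub>) (wform q as)) = \<dots>" .
  have 2: "lop (a, \<zero>\<^bsub>K\<^esub>) (d (wform q as)) = wform (a, \<zero>\<^bsub>K\<^esub>) (fst q # as)"
    using a as q q' lop_wform[OF _ _ z] by (simp add: d_wform U_mult_one)
  show ?thesis
    unfolding delta_def 1 2 using a as q' wform_closed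
    by (simp add: a_minus_def Om.a_ac)
qed

text \<open>
  With \<open>q = b + \<nu>\<close>: expand \<open>d L\<^sub>a L\<^sub>q - L\<^sub>a d L\<^sub>q\<close>, using \<open>L\<^sub>a L\<^sub>b = L\<^bsub>ab\<^esub>\<close>, and insert
  \<open>L\<^sub>a L\<^sub>b d - L\<^sub>a L\<^sub>b d\<close>.
\<close>

lemma delta_lop:
  assumes a: "a \<in> carrier A" and q: "q \<in> carrier U" and y: "y \<in> carrier Om"
  shows "delta a (lop q y) = delta (a \<otimes>\<^bsub>A\<^esub> fst q) y \<ominus>\<^bsub>Om\<^esub> lop (a, \<zero>\<^bsub>K\<^esub>) (delta (fst q) y)
    \<oplus>\<^bsub>Om\<^esub> snd q \<odot>\<^bsub>Om\<^esub> delta a y"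
proof -
  interpret Om: module K Om by simp
  let ?a = "(a, \<zero>\<^bsub>K\<^esub>)" let ?b = "(fst q, \<zero>\<^bsub>K\<^esub>)" let ?r = "snd q"
  let ?L = "\<lambda>z. lop ?a z"
  have m: "?a \<otimes>\<^bsub>U\<^esub> ?b = (a \<otimes>\<^bsub>A\<^esub> fst q, \<zero>\<^bsub>K\<^esub>)" using a q by (simp add: U_mult)
  have la: "lin Om Om (lop ?a)" using a by (intro lop_lin) simp
  have ab: "lop (a \<otimes>\<^bsub>A\<^esub> fst q, \<zero>\<^bsub>K\<^esub>) z = lop ?a (lop ?b z)" if "z \<in> carrier Om" for z
    using lop_lop[of ?a ?b z] a q that by (simp add: m)
  note c = a q y
  have "delta a (lop q y) = (d (?L (lop ?b y)) \<oplus>\<^bsub>Om\<^esub> ?r \<odot>\<^bsub>Om\<^esub> d (?L y))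
      \<ominus>\<^bsub>Om\<^esub> (?L (d (lop ?b y)) \<oplus>\<^bsub>Om\<^esub> ?r \<odot>\<^bsub>Om\<^esub> ?L (d y))"
    unfolding delta_def using c
    by (subst (1 2) lop_split[OF q y]) (simp add: lin_add[OF la] lin_smult[OF la] lin_add[OF d_lin] lin_smult[OF d_lin])
  also have "\<dots> = (d (?L (lop ?b y)) \<ominus>\<^bsub>Om\<^esub> ?L (lop ?b (d y))) \<ominus>\<^bsub>Om\<^esub> (?L (d (lop ?b y)) \<ominus>\<^bsub>Om\<^esub> ?L (lop ?b (d y)))
      \<oplus>\<^bsub>Om\<^esub> ?r \<odot>\<^bsub>Om\<^esub> (d (?L y) \<ominus>\<^bsub>Om\<^esub> ?L (d y))"
  proof -
    have r: "?r \<odot>\<^bsub>Om\<^esub> (d (?L y) \<ominus>\<^bsub>Om\<^esub> ?L (d y)) = ?r \<odot>\<^bsub>Om\<^esub> d (?L y) \<ominus>\<^bsub>Om\<^esub> ?r \<odot>\<^bsub>Om\<^esub> ?L (d y)"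
      using c by (intro lin_minus[OF lin_smult_fun[OF _ lin_id[OF Om_vs]]]) auto
    \<comment> \<open>The element \<open>s\<close> to be inserted is \<open>L\<^sub>a L\<^sub>b d y\<close>.\<close>
    have abel: "(p \<oplus>\<^bsub>Om\<^esub> x) \<ominus>\<^bsub>Om\<^esub> (q \<oplus>\<^bsub>Om\<^esub> z) = (p \<ominus>\<^bsub>Om\<^esub> s) \<ominus>\<^bsub>Om\<^esub> (q \<ominus>\<^bsub>Om\<^esub> s) \<oplus>\<^bsub>Om\<^esub> (x \<ominus>\<^bsub>Om\<^esub> z)"
      if "p \<in> carrier Om" "q \<in> carrier Om" "x \<in> carrier Om" "z \<in> carrier Om" "s \<in> carrier Om" for p q x z s
    proof -
      have "\<ominus>\<^bsub>Om\<^esub> s \<oplus>\<^bsub>Om\<^esub> (s \<oplus>\<^bsub>Om\<^esub> w) = w" if "w \<in> carrier Om" for w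
        using that \<open>s \<in> carrier Om\<close> by (simp add: Om.a_assoc[symmetric] Om.l_neg)
      from this[of "p \<oplus>\<^bsub>Om\<^esub> (x \<oplus>\<^bsub>Om\<^esub> (\<ominus>\<^bsub>Om\<^esub> q \<oplus>\<^bsub>Om\<^esub> \<ominus>\<^bsub>Om\<^esub> z))"] show ?thesis
        using that by (simp add: a_minus_def Om.minus_add Om.a_ac)
    qed
    show ?thesis unfolding r by (rule abel) (use c in auto)
  qed
  also have "\<dots> = delta (a \<otimes>\<^bsub>A\<^esub> fst q) y \<ominus>\<^bsub>Om\<^esub> ?L (delta (fst q) y) \<oplus>\<^bsub>Om\<^esub> ?r \<odot>\<^bsub>Om\<^esub> delta a y"
    unfolding delta_def using c by (simp add: ab lin_minus[OF la])
  finally show ?thesis .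
qed

lemma mul_lop:
  assumes "p \<in> carrier U" "y \<in> carrier Om" "z \<in> carrier Om"
  shows "mul (lop p y) z = lop p (mul y z)"
proof (rule Om_eqI[OF lin_comp[OF mul_lin1 lop_lin] lin_comp[OF lop_lin mul_lin1] _ assms(2)])
  fix q as assume "set as \<subseteq> carrier A" "valid (length as) q"
  then show "mul (lop p (wform q as)) z = lop p (mul (wform q as) z)"
    using assms validD[of "length as" q] by (simp add: lop_wform mul_wform valid_mult lam_def lop_lop)
qed (use assms in auto)

lemma mul_wform_one: "set ps \<subseteq> carrier A \<Longrightarrow> ps \<noteq> [] \<Longrightarrow> y \<in> carrier Om \<Longrightarrow>
    mul (wform unit_U ps) y = foldr delta ps y"
  by (subst mul_wform) (auto simp: valid_def lam_def lop_one)

text \<open>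
  On a form \<open>y = (q + \<nu>) dq\<^sub>1 \<dots> dq\<^sub>n\<close> both sides are computed by \<open>delta_wform\<close> and \<open>delta_lop\<close>,
  which have the same shape.
\<close>

lemma mul_delta:
  assumes a: "a \<in> carrier A" and y: "y \<in> carrier Om" and z: "z \<in> carrier Om"
  shows "mul (delta a y) z = delta a (mul y z)"
proof (rule Om_eqI[OF lin_comp[OF mul_lin1[OF z] delta_lin[OF a]] lin_comp[OF delta_lin[OF a] mul_lin1[OF z]] _ y])
  fix q as assume as: "set as \<subseteq> carrier A" and q: "valid (length as) q"
  have q': "q \<in> carrier U" using q by (simp add: valid_def)
  let ?z = "foldr delta as z"
  have "mul (delta a (wform q as)) z = delta (a \<otimes>\<^bsub>A\<^esub> fst q) ?z \<ominus>\<^bsub>Om\<^esub> lop (a, \<zero>\<^bsub>K\<^esub>) (delta (fst q) ?z)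
      \<oplus>\<^bsub>Om\<^esub> snd q \<odot>\<^bsub>Om\<^esub> delta a ?z"
    using a z as q' wform_closed mul_wform[of "fst q # as" "(a, \<zero>\<^bsub>K\<^esub>)" z]
    by (simp add: delta_wform[OF a as q] lin_add[OF mul_lin1] lin_minus[OF mul_lin1] lin_smult[OF mul_lin1]
        mul_wform_one lam_def valid_def)
  also have "\<dots> = delta a (mul (wform q as) z)"
    using as z by (simp add: mul_wform[OF as q z] lam_def delta_lop[OF a q'])
  finally show "mul (delta a (wform q as)) z = delta a (mul (wform q as) z)" .
qed

lemma mul_foldr_delta:
  "set as \<subseteq> carrier A \<Longrightarrow> y \<in> carrier Om \<Longrightarrow> z \<in> carrier Om \<Longrightarrow>
    mul (foldr delta as y) z = foldr delta as (mul y z)"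
  by (induction as) (auto simp: mul_delta)

text \<open>
  Left multiplication by a form is a composition of operators \<open>lop\<close> and \<open>delta\<close>, and both commute
  with right multiplications by \<open>mul_lop\<close> and \<open>mul_delta\<close>.
\<close>

lemma mul_assoc:
  assumes x: "x \<in> carrier Om" and y: "y \<in> carrier Om" and z: "z \<in> carrier Om"
  shows "mul (mul x y) z = mul x (mul y z)"
  by (rule Om_eqI[OF lin_comp[OF mul_lin1[OF z] mul_lin1[OF y]] mul_lin1 _ x])
    (use y z in \<open>auto simp: mul_wform lam_def mul_lop mul_foldr_delta valid_def\<close>)

lemma sgn_mem [simp]: "sgn_pow K n \<in> carrier K"
  by (simp add: sgn_pow_def)

lemma sgn_Suc: "x \<in> carrier Om \<Longrightarrow> sgn_pow K (Suc n) \<odot>\<^bsub>Om\<^esub> x = \<ominus>\<^bsub>Om\<^esub> (sgn_pow K n \<odot>\<^bsub>Om\<^esub> x)"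
  by (simp add: sgn_pow_def vs_neg_eq module.smult_assoc1[OF Om_vs, symmetric] m_comm)

lemma sgn_0: "x \<in> carrier Om \<Longrightarrow> sgn_pow K 0 \<odot>\<^bsub>Om\<^esub> x = x"
  by (simp add: sgn_pow_def)

text \<open>
  From \<open>d\<^sup>2 = 0\<close>: \<open>d (d L\<^sub>a - L\<^sub>a d) = - d L\<^sub>a d = - (d L\<^sub>a - L\<^sub>a d) d\<close>. Each factor \<open>da\<^sub>i\<close> thus
  contributes one sign to the Leibniz rule.
\<close>

lemma d_delta: "a \<in> carrier A \<Longrightarrow> y \<in> carrier Om \<Longrightarrow> d (delta a y) = \<ominus>\<^bsub>Om\<^esub> delta a (d y)"
proof -
  interpret Om: module K Om by simp
  assume "a \<in> carrier A" "y \<in> carrier Om"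
  then show ?thesis
    using lin_zero[OF lop_lin[of "(a, \<zero>\<^bsub>K\<^esub>)"]]
    by (simp add: delta_def lin_minus[OF d_lin] d_d vs_minus_zero) (simp add: a_minus_def)
qed

lemma d_foldr_delta:
  "set as \<subseteq> carrier A \<Longrightarrow> y \<in> carrier Om \<Longrightarrow>
    d (foldr delta as y) = sgn_pow K (length as) \<odot>\<^bsub>Om\<^esub> foldr delta as (d y)"
proof (induction as)
  case Nil
  then show ?case by (simp add: sgn_0)
next
  case (Cons a as)
  then show ?case
    by (simp add: d_delta lin_smult[OF delta_lin] sgn_Suc)
qed

lemma d_mul_wform:
  assumes ps: "set ps \<subseteq> carrier A" and p: "valid (length ps) p" and y: "y \<in> carrier Om"
  shows "d (mul (wform p ps) y) = mul (d (wform p ps)) y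
    \<oplus>\<^bsub>Om\<^esub> sgn_pow K (length ps) \<odot>\<^bsub>Om\<^esub> mul (wform p ps) (d y)"
proof -
  interpret Om: module K Om by simp
  have p': "p \<in> carrier U" using p by (simp add: valid_def)
  let ?y = "foldr delta ps y" let ?b = "(fst p, \<zero>\<^bsub>K\<^esub>)"
  have lb: "lin Om Om (lop ?b)" using p' by (intro lop_lin) simp
  have "d (lop p ?y) = d (lop ?b ?y) \<oplus>\<^bsub>Om\<^esub> snd p \<odot>\<^bsub>Om\<^esub> d ?y"
    using ps y p' by (simp add: lop_split[OF p'] lin_add[OF d_lin] lin_smult[OF d_lin])
  also have "\<dots> = delta (fst p) ?y \<oplus>\<^bsub>Om\<^esub> (lop ?b (d ?y) \<oplus>\<^bsub>Om\<^esub> snd p \<odot>\<^bsub>Om\<^esub> d ?y)"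
    using ps y p' by (simp add: delta_def a_minus_def Om.a_ac Om.r_neg1 Om.r_neg2 Om.r_neg Om.l_neg)
  also have "lop ?b (d ?y) \<oplus>\<^bsub>Om\<^esub> snd p \<odot>\<^bsub>Om\<^esub> d ?y = lop p (d ?y)"
    using ps y p' by (simp add: lop_split[OF p', symmetric])
  also have "\<dots> = sgn_pow K (length ps) \<odot>\<^bsub>Om\<^esub> lop p (foldr delta ps (d y))"
    using ps y p' by (simp add: d_foldr_delta lin_smult[OF lop_lin])
  finally show ?thesis
    using ps y p p' by (simp add: mul_wform lam_def d_wform mul_wform_one)
qed


section \<open>The explicit product formula\<close>

text \<open>
  The right-hand side of the product formula, for a left factor of positive degree. The left factor
  is built up from its last differential: \<open>delta_wmult\<close> puts a further \<open>dp\<close> in front, \<open>lop_wmult\<close> the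
  coefficient.
\<close>

definition wmult where
  "wmult p ps q qs =
     wform p (butlast ps @ [last ps \<otimes>\<^bsub>A\<^esub> fst q] @ qs)
     \<oplus>\<^bsub>Om\<^esub> (\<Oplus>\<^bsub>Om\<^esub>l\<in>{1..<length ps}. sgn_pow K (length ps - l) \<odot>\<^bsub>Om\<^esub> wform p (merge A l ps @ [fst q] @ qs))
     \<oplus>\<^bsub>Om\<^esub> sgn_pow K (length ps) \<odot>\<^bsub>Om\<^esub> wform (p \<otimes>\<^bsub>U\<^esub> (hd ps, \<zero>\<^bsub>K\<^esub>)) (tl ps @ [fst q] @ qs)
     \<oplus>\<^bsub>Om\<^esub> snd q \<odot>\<^bsub>Om\<^esub> wform p (ps @ qs)"

lemma merge_set: "set ps \<subseteq> carrier A \<Longrightarrow> l \<in> {1..<length ps} \<Longrightarrow> set (merge A l ps) \<subseteq> carrier A"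
  by (auto simp: merge_def subset_iff dest: in_set_takeD in_set_dropD intro!: A_closed)

lemma merge_length: "l \<in> {1..<length ps} \<Longrightarrow> Suc (length (merge A l ps)) = length ps"
  by (auto simp: merge_def)

lemma merge_Suc: "l \<ge> 1 \<Longrightarrow> merge A (Suc l) (a # ps) = a # merge A l ps"
  by (cases l) (auto simp: merge_def)

lemma merge_1: "ps \<noteq> [] \<Longrightarrow> merge A 1 (a # ps) = (a \<otimes>\<^bsub>A\<^esub> hd ps) # tl ps"
  by (cases ps) (auto simp: merge_def)

lemma last_butlast_mem:
  "set ps \<subseteq> carrier A \<Longrightarrow> ps \<noteq> [] \<Longrightarrow> last ps \<in> carrier A"
  "set ps \<subseteq> carrier A \<Longrightarrow> set (butlast ps) \<subseteq> carrier A"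
  "set ps \<subseteq> carrier A \<Longrightarrow> ps \<noteq> [] \<Longrightarrow> hd ps \<in> carrier A"
  "set ps \<subseteq> carrier A \<Longrightarrow> set (tl ps) \<subseteq> carrier A"
  by (auto simp: subset_iff dest: in_set_butlastD) (cases ps; simp)

lemma delta_unit:
  assumes a: "a \<in> carrier A" and as: "set as \<subseteq> carrier A" "as \<noteq> []"
  shows "delta a (wform unit_U as) = wform unit_U (a # as)"
proof -
  have "delta a (wform unit_U as) = \<zero>\<^bsub>Om\<^esub> \<ominus>\<^bsub>Om\<^esub> \<zero>\<^bsub>Om\<^esub> \<oplus>\<^bsub>Om\<^esub> wform unit_U (a # as)"
    using a as delta_wform[OF a as(1), of unit_U] lin_zero[OF bilinD(4)[OF A_bilin a]]
      wform_closed[of unit_U "a # as"]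
    by (simp add: valid_def wform_0)
  then show ?thesis using wform_closed[of unit_U "a # as"] a as by (simp add: vs_minus_self)
qed

lemma delta_pair:
  assumes a: "a \<in> carrier A" and b: "b \<in> carrier A" and as: "set as \<subseteq> carrier A"
  shows "delta a (wform (b, \<zero>\<^bsub>K\<^esub>) as) = wform unit_U ((a \<otimes>\<^bsub>A\<^esub> b) # as) \<ominus>\<^bsub>Om\<^esub> wform (a, \<zero>\<^bsub>K\<^esub>) (b # as)"
  using delta_wform[OF a as, of "(b, \<zero>\<^bsub>K\<^esub>)"] a b as by (simp add: valid_def wform_closed)

lemma wmult_closed_parts:
  assumes p: "p \<in> carrier U" and ps: "set ps \<subseteq> carrier A" "ps \<noteq> []" and q: "q \<in> carrier U"
    and qs: "set qs \<subseteq> carrier A"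
  shows "wform p (butlast ps @ [last ps \<otimes>\<^bsub>A\<^esub> fst q] @ qs) \<in> carrier Om"
    "\<And>l. l \<in> {1..<length ps} \<Longrightarrow> wform p (merge A l ps @ [fst q] @ qs) \<in> carrier Om"
    "wform (p \<otimes>\<^bsub>U\<^esub> (hd ps, \<zero>\<^bsub>K\<^esub>)) (tl ps @ [fst q] @ qs) \<in> carrier Om"
    "wform p (ps @ qs) \<in> carrier Om"
  by (rule wform_closed; use p ps q qs last_butlast_mem[of ps] merge_set[of ps] in simp)+

text \<open>
  A linear operator is applied to the formula with coefficient \<open>1\<close> term by term. The term with
  \<open>p\<^sub>1\<close> in the coefficient is the only one that does not begin with \<open>1 \<cdot> d\<close>, so it is kept apart.
\<close>

lemma wmult_image:
  assumes T: "lin Om Om T" and ps: "set ps \<subseteq> carrier A" "ps \<noteq> []" and q: "valid (length qs) q"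
    and qs: "set qs \<subseteq> carrier A"
    and a: "\<And>as. set as \<subseteq> carrier A \<Longrightarrow> as \<noteq> [] \<Longrightarrow> T (wform unit_U as) = w as"
  shows "T (wmult unit_U ps q qs) = w (butlast ps @ [last ps \<otimes>\<^bsub>A\<^esub> fst q] @ qs)
     \<oplus>\<^bsub>Om\<^esub> (\<Oplus>\<^bsub>Om\<^esub>l\<in>{1..<length ps}. sgn_pow K (length ps - l) \<odot>\<^bsub>Om\<^esub> w (merge A l ps @ [fst q] @ qs))
     \<oplus>\<^bsub>Om\<^esub> sgn_pow K (length ps) \<odot>\<^bsub>Om\<^esub> T (wform (hd ps, \<zero>\<^bsub>K\<^esub>) (tl ps @ [fst q] @ qs))
     \<oplus>\<^bsub>Om\<^esub> snd q \<odot>\<^bsub>Om\<^esub> w (ps @ qs)"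
proof -
  note q' = validD[OF q]
  note c = wmult_closed_parts[OF one_mem ps q' qs]
  note mem = last_butlast_mem[of ps]
  have 1: "T (wform unit_U (butlast ps @ [last ps \<otimes>\<^bsub>A\<^esub> fst q] @ qs)) = w (butlast ps @ [last ps \<otimes>\<^bsub>A\<^esub> fst q] @ qs)"
    using ps q' qs mem by (intro a) auto
  have 2: "T (\<Oplus>\<^bsub>Om\<^esub>l\<in>{1..<length ps}. sgn_pow K (length ps - l) \<odot>\<^bsub>Om\<^esub> wform unit_U (merge A l ps @ [fst q] @ qs))
    = (\<Oplus>\<^bsub>Om\<^esub>l\<in>{1..<length ps}. sgn_pow K (length ps - l) \<odot>\<^bsub>Om\<^esub> w (merge A l ps @ [fst q] @ qs))"
  proof (subst lin_finsum[OF T])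
    show "(\<Oplus>\<^bsub>Om\<^esub>l\<in>{1..<length ps}. T (sgn_pow K (length ps - l) \<odot>\<^bsub>Om\<^esub> wform unit_U (merge A l ps @ [fst q] @ qs)))
      = (\<Oplus>\<^bsub>Om\<^esub>l\<in>{1..<length ps}. sgn_pow K (length ps - l) \<odot>\<^bsub>Om\<^esub> w (merge A l ps @ [fst q] @ qs))"
    proof (rule vs_finsum_cong[OF Om_vs])
      fix l assume l: "l \<in> {1..<length ps}"
      have m: "T (wform unit_U (merge A l ps @ [fst q] @ qs)) = w (merge A l ps @ [fst q] @ qs)"
        using merge_set[OF ps(1) l] q' qs by (intro a) auto
      show "T (sgn_pow K (length ps - l) \<odot>\<^bsub>Om\<^esub> wform unit_U (merge A l ps @ [fst q] @ qs))
        = sgn_pow K (length ps - l) \<odot>\<^bsub>Om\<^esub> w (merge A l ps @ [fst q] @ qs)"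
        by (simp only: lin_smult[OF T sgn_mem c(2)[OF l]] m)
      show "sgn_pow K (length ps - l) \<odot>\<^bsub>Om\<^esub> w (merge A l ps @ [fst q] @ qs) \<in> carrier Om"
        unfolding m[symmetric] by (intro vs_smult Om_vs sgn_mem lin_closed[OF T] c(2)[OF l])
    qed
  qed (use c(2) in auto)
  have 3: "unit_U \<otimes>\<^bsub>U\<^esub> (hd ps, \<zero>\<^bsub>K\<^esub>) = (hd ps, \<zero>\<^bsub>K\<^esub>)" using mem ps by (simp add: one_U_mult)
  have 4: "T (wform unit_U (ps @ qs)) = w (ps @ qs)" using ps qs by (intro a) auto
  have s: "(\<Oplus>\<^bsub>Om\<^esub>l\<in>{1..<length ps}. sgn_pow K (length ps - l) \<odot>\<^bsub>Om\<^esub> wform unit_U (merge A l ps @ [fst q] @ qs)) \<in> carrier Om"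
    by (intro vs_finsum_closed Om_vs vs_smult sgn_mem c(2))
  show ?thesis
    unfolding wmult_def using c(1,3,4) s q'
    by (simp only: lin_add[OF T] lin_smult[OF T] 1 2 3 4 vs_add[OF Om_vs] vs_smult[OF Om_vs] sgn_mem snd_mem)
qed

lemma lop_wmult:
  assumes p: "p \<in> carrier U" and ps: "set ps \<subseteq> carrier A" "ps \<noteq> []" and q: "valid (length qs) q"
    and qs: "set qs \<subseteq> carrier A"
  shows "lop p (wmult unit_U ps q qs) = wmult p ps q qs"
proof -
  have w: "lop p (wform unit_U as) = wform p as" if "set as \<subseteq> carrier A" "as \<noteq> []" for as
    using lop_wform[OF p that(1), of unit_U] that p by (simp add: valid_def U_mult_one)
  have e: "lop p (wform (hd ps, \<zero>\<^bsub>K\<^esub>) (tl ps @ [fst q] @ qs)) = wform (p \<otimes>\<^bsub>U\<^esub> (hd ps, \<zero>\<^bsub>K\<^esub>)) (tl ps @ [fst q] @ qs)"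
    using last_butlast_mem[OF ps(1)] ps validD[OF q] qs by (intro lop_wform[OF p]) (auto simp: valid_def)
  show ?thesis
    by (rule trans[OF wmult_image[where w = "wform p", OF lop_lin[OF p] ps q qs w]])
      (simp_all only: wmult_def e not_False_eq_True)
qed

text \<open>
  The last-but-one term \<open>p\<^sub>1 dp\<^sub>2 \<dots>\<close> of the formula becomes \<open>d(a p\<^sub>1) dp\<^sub>2 \<dots> - a dp\<^sub>1 dp\<^sub>2 \<dots>\<close>: the
  first summand is the new term \<open>l = 1\<close> of the sum over \<open>l\<close>, the second one is the new boundary term,
  with the opposite sign. In the other terms \<open>l\<close> is shifted by one.
\<close>

lemma delta_wmult:
  assumes a: "a \<in> carrier A" and ps: "set ps \<subseteq> carrier A" "ps \<noteq> []" and q: "valid (length qs) q"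
    and qs: "set qs \<subseteq> carrier A"
  shows "delta a (wmult unit_U ps q qs) = wmult unit_U (a # ps) q qs"
proof -
  interpret Om: module K Om by simp
  note q' = validD[OF q]
  let ?i = "length ps" and ?T = "[fst q] @ qs"
  let ?S = "\<Oplus>\<^bsub>Om\<^esub>l\<in>{1..<?i}. sgn_pow K (?i - l) \<odot>\<^bsub>Om\<^esub> wform unit_U (a # merge A l ps @ ?T)"
  let ?X = "wform unit_U (a # butlast ps @ [last ps \<otimes>\<^bsub>A\<^esub> fst q] @ qs)"
  let ?Y = "wform unit_U ((a \<otimes>\<^bsub>A\<^esub> hd ps) # tl ps @ ?T)"
  let ?Z = "wform (a, \<zero>\<^bsub>K\<^esub>) (ps @ ?T)"
  let ?V = "wform unit_U (a # ps @ qs)"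
  have h: "hd ps \<in> carrier A" using last_butlast_mem(3)[OF ps] .
  have m: "wform unit_U (a # merge A l ps @ ?T) \<in> carrier Om" if "l \<in> {1..<?i}" for l
    using merge_set[OF ps(1) that] a q' qs by (intro wform_closed) auto
  have X: "?X \<in> carrier Om" using last_butlast_mem[of ps] ps a q' qs by (intro wform_closed) auto
  have Y: "?Y \<in> carrier Om" using last_butlast_mem[of ps] h ps a q' qs by (intro wform_closed) auto
  have Z: "?Z \<in> carrier Om" using ps a q' qs by (intro wform_closed) auto
  have V: "?V \<in> carrier Om" using ps a qs by (intro wform_closed) auto
  have S: "?S \<in> carrier Om" by (intro vs_finsum_closed Om_vs vs_smult sgn_mem m)
  have e: "delta a (wform (hd ps, \<zero>\<^bsub>K\<^esub>) (tl ps @ ?T)) = ?Y \<ominus>\<^bsub>Om\<^esub> ?Z"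
    using delta_pair[OF a h, of "tl ps @ ?T"] last_butlast_mem(4)[OF ps(1)] q' qs ps(2)
    by (simp flip: append_Cons)
  have lhs: "delta a (wmult unit_U ps q qs)
    = ?X \<oplus>\<^bsub>Om\<^esub> ?S \<oplus>\<^bsub>Om\<^esub> sgn_pow K ?i \<odot>\<^bsub>Om\<^esub> (?Y \<ominus>\<^bsub>Om\<^esub> ?Z) \<oplus>\<^bsub>Om\<^esub> snd q \<odot>\<^bsub>Om\<^esub> ?V"
    by (rule trans[OF wmult_image[where w = "\<lambda>as. wform unit_U (a # as)", OF delta_lin[OF a] ps q qs delta_unit[OF a]]])
      (simp_all only: e not_False_eq_True)
  have set: "{1..<Suc ?i} = insert 1 (Suc ` {1..<?i})"
    using ps(2) by (cases ps) (auto simp: image_Suc_atLeastLessThan)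
  have mS: "sgn_pow K (Suc ?i - l) \<odot>\<^bsub>Om\<^esub> wform unit_U (merge A l (a # ps) @ ?T) \<in> carrier Om"
    if "l \<in> Suc ` {1..<?i}" for l
  proof -
    obtain k where k: "l = Suc k" "k \<in> {1..<?i}" using \<open>l \<in> Suc ` {1..<?i}\<close> by blast
    then show ?thesis using m[of k] by (simp add: merge_Suc)
  qed
  have "(\<Oplus>\<^bsub>Om\<^esub>l\<in>{1..<Suc ?i}. sgn_pow K (Suc ?i - l) \<odot>\<^bsub>Om\<^esub> wform unit_U (merge A l (a # ps) @ ?T))
    = sgn_pow K ?i \<odot>\<^bsub>Om\<^esub> ?Y \<oplus>\<^bsub>Om\<^esub>
      (\<Oplus>\<^bsub>Om\<^esub>l\<in>Suc ` {1..<?i}. sgn_pow K (Suc ?i - l) \<odot>\<^bsub>Om\<^esub> wform unit_U (merge A l (a # ps) @ ?T))"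
    unfolding set
    using merge_1[OF ps(2), of a] Y by (subst vs_finsum_insert[OF Om_vs _ _ _ mS]) auto
  also have "(\<Oplus>\<^bsub>Om\<^esub>l\<in>Suc ` {1..<?i}. sgn_pow K (Suc ?i - l) \<odot>\<^bsub>Om\<^esub> wform unit_U (merge A l (a # ps) @ ?T))
    = (\<Oplus>\<^bsub>Om\<^esub>l\<in>{1..<?i}. sgn_pow K (Suc ?i - Suc l) \<odot>\<^bsub>Om\<^esub> wform unit_U (merge A (Suc l) (a # ps) @ ?T))"
    by (rule Om.finsum_reindex) (use mS in auto)
  also have "\<dots> = ?S"
    using m by (intro vs_finsum_cong Om_vs) (auto simp: merge_Suc)
  finally have sum: "(\<Oplus>\<^bsub>Om\<^esub>l\<in>{1..<Suc ?i}. sgn_pow K (Suc ?i - l) \<odot>\<^bsub>Om\<^esub> wform unit_U (merge A l (a # ps) @ ?T))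
    = sgn_pow K ?i \<odot>\<^bsub>Om\<^esub> ?Y \<oplus>\<^bsub>Om\<^esub> ?S" .
  have rhs: "wmult unit_U (a # ps) q qs
    = ?X \<oplus>\<^bsub>Om\<^esub> (sgn_pow K ?i \<odot>\<^bsub>Om\<^esub> ?Y \<oplus>\<^bsub>Om\<^esub> ?S) \<oplus>\<^bsub>Om\<^esub> \<ominus>\<^bsub>Om\<^esub> (sgn_pow K ?i \<odot>\<^bsub>Om\<^esub> ?Z) \<oplus>\<^bsub>Om\<^esub> snd q \<odot>\<^bsub>Om\<^esub> ?V"
    using ps(2) a Z sum by (simp add: wmult_def one_U_mult sgn_Suc)
  have "sgn_pow K ?i \<odot>\<^bsub>Om\<^esub> (?Y \<ominus>\<^bsub>Om\<^esub> ?Z) = sgn_pow K ?i \<odot>\<^bsub>Om\<^esub> ?Y \<oplus>\<^bsub>Om\<^esub> \<ominus>\<^bsub>Om\<^esub> (sgn_pow K ?i \<odot>\<^bsub>Om\<^esub> ?Z)"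
    using lin_minus[OF lin_smult_fun[OF sgn_mem lin_id[OF Om_vs]] Y Z] by (simp add: a_minus_def)
  then show ?thesis
    unfolding lhs rhs using X Y Z S V q'
    by (simp only: Om.a_ac vs_add[OF Om_vs] vs_smult[OF Om_vs] vs_neg[OF Om_vs] sgn_mem snd_mem)
qed

lemma foldr_delta_wform:
  assumes "set ps \<subseteq> carrier A" "ps \<noteq> []" and q: "valid (length qs) q" and qs: "set qs \<subseteq> carrier A"
  shows "foldr delta ps (wform q qs) = wmult unit_U ps q qs"
  using assms(1,2)
proof (induction ps)
  case (Cons a ps)
  interpret Om: module K Om by simp
  show ?case
  proof (cases "ps = []")
    case True
    have "sgn_pow K (Suc 0) \<odot>\<^bsub>Om\<^esub> wform (a, \<zero>\<^bsub>K\<^esub>) (fst q # qs) = \<ominus>\<^bsub>Om\<^esub> wform (a, \<zero>\<^bsub>K\<^esub>) (fst q # qs)"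
      using sgn_Suc[of "wform (a, \<zero>\<^bsub>K\<^esub>) (fst q # qs)" 0] sgn_0[of "wform (a, \<zero>\<^bsub>K\<^esub>) (fst q # qs)"]
        wform_closed[of "(a, \<zero>\<^bsub>K\<^esub>)" "fst q # qs"] Cons validD[OF q] qs by simp
    then show ?thesis
      using True Cons qs validD[OF q] wform_closed[of unit_U "(a \<otimes>\<^bsub>A\<^esub> fst q) # qs"]
      by (simp add: delta_wform[OF _ qs q] wmult_def one_U_mult vs_finsum_empty a_minus_def)
  next
    case False
    then show ?thesis using Cons by (simp add: delta_wmult[OF _ _ _ q qs])
  qed
qed simp

lemma lam_wform:
  assumes ps: "set ps \<subseteq> carrier A" and p: "valid (length ps) p"
    and q: "valid (length qs) q" and qs: "set qs \<subseteq> carrier A"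
  shows "lam p ps (wform q qs) = incl (length ps + length qs) (form_mult K A p ps q qs)"
proof (cases "ps = []")
  case True
  have "p \<otimes>\<^bsub>U\<^esub> q = (fst p \<otimes>\<^bsub>A\<^esub> fst q \<oplus>\<^bsub>A\<^esub> snd q \<odot>\<^bsub>A\<^esub> fst p, \<zero>\<^bsub>K\<^esub>)"
    using True p q by (simp add: valid_def U_mult)
  then show ?thesis using True lop_wform[OF validD[OF p] qs q]
    by (simp add: lam_def form_mult_def case_prod_beta Let_def wform_def)
next
  case False
  note p' = validD[OF p] and q' = validD[OF q]
  let ?n = "length ps + length qs" let ?i = "length ps"
  note L = incl_lin[of ?n]
  note mem = last_butlast_mem[of ps]
  have e: "wform r as = incl ?n (form K A r as)" if "length as = ?n" for r as
    using that by (simp add: wform_def)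
  have l1: "length (butlast ps @ [last ps \<otimes>\<^bsub>A\<^esub> fst q] @ qs) = ?n"
    "length (tl ps @ [fst q] @ qs) = ?n" "length (ps @ qs) = ?n"
    using False by (cases ps; simp)+
  have l2: "length (merge A l ps @ [fst q] @ qs) = ?n" if "l \<in> {1..<?i}" for l
    using merge_length[OF that] by simp
  have c: "form K A p (butlast ps @ [last ps \<otimes>\<^bsub>A\<^esub> fst q] @ qs) \<in> carrier (deg ?n)"
     "form K A (p \<otimes>\<^bsub>U\<^esub> (hd ps, \<zero>\<^bsub>K\<^esub>)) (tl ps @ [fst q] @ qs) \<in> carrier (deg ?n)"
     "form K A p (ps @ qs) \<in> carrier (deg ?n)"
    using l1 mem ps False p' q' qs by (intro form_closed; simp add: words_def)+
  have c2: "form K A p (merge A l ps @ [fst q] @ qs) \<in> carrier (deg ?n)" if "l \<in> {1..<?i}" for l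
    using l2[OF that] merge_set[OF ps that] p' q' qs by (intro form_closed) (auto simp: words_def)
  have "lam p ps (wform q qs) = wmult p ps q qs"
    unfolding lam_def using ps False q qs p' by (simp add: foldr_delta_wform lop_wmult)
  also have "(\<Oplus>\<^bsub>Om\<^esub>l\<in>{1..<?i}. sgn_pow K (?i - l) \<odot>\<^bsub>Om\<^esub> wform p (merge A l ps @ [fst q] @ qs))
    = incl ?n (\<Oplus>\<^bsub>deg ?n\<^esub>l\<in>{1..<?i}. sgn_pow K (?i - l) \<odot>\<^bsub>deg ?n\<^esub> form K A p (merge A l ps @ [fst q] @ qs))"
  proof (subst lin_finsum[OF L])
    show "(\<Oplus>\<^bsub>Om\<^esub>l\<in>{1..<?i}. sgn_pow K (?i - l) \<odot>\<^bsub>Om\<^esub> wform p (merge A l ps @ [fst q] @ qs))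
      = (\<Oplus>\<^bsub>Om\<^esub>l\<in>{1..<?i}. incl ?n (sgn_pow K (?i - l) \<odot>\<^bsub>deg ?n\<^esub> form K A p (merge A l ps @ [fst q] @ qs)))"
    proof (rule vs_finsum_cong[OF Om_vs])
      fix l assume l: "l \<in> {1..<?i}"
      show "sgn_pow K (?i - l) \<odot>\<^bsub>Om\<^esub> wform p (merge A l ps @ [fst q] @ qs)
        = incl ?n (sgn_pow K (?i - l) \<odot>\<^bsub>deg ?n\<^esub> form K A p (merge A l ps @ [fst q] @ qs))"
        by (simp only: e[OF l2[OF l]] lin_smult[OF L sgn_mem c2[OF l]])
      show "incl ?n (sgn_pow K (?i - l) \<odot>\<^bsub>deg ?n\<^esub> form K A p (merge A l ps @ [fst q] @ qs)) \<in> carrier Om"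
        by (intro lin_closed[OF L] vs_smult deg_vs sgn_mem c2[OF l])
    qed
  qed (intro vs_smult deg_vs sgn_mem c2 finite_atLeastLessThan | assumption)+
  then have "wmult p ps q qs = incl ?n (form_mult K A p ps q qs)"
    unfolding wmult_def form_mult_def Let_def case_prod_beta using False c c2 q'
    by (simp only: e l1 lin_add[OF L] lin_smult[OF L] if_False length_0_conv
        vs_add[OF deg_vs] vs_smult[OF deg_vs] vs_finsum_closed[OF deg_vs] sgn_mem snd_mem)
  finally show ?thesis .
qed

lemma mul_incl_other:
  assumes u: "u \<in> carrier (deg i)" and v: "v \<in> carrier (deg j)" and m: "m \<noteq> i + j"
  shows "mul (incl i u) (incl j v) m = \<zero>\<^bsub>deg m\<^esub>"
proof (rule deg_eqI[OF lin_comp[OF comp_lin lin_comp[OF mul_lin1 incl_lin]] lin_const0 _ u])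
  fix p ps assume ps: "ps \<in> words A i" and p: "valid i p"
  have w: "incl i (form K A p ps) = wform p ps" "set ps \<subseteq> carrier A" "length ps = i"
    using ps by (auto simp: wform_def words_def)
  have vi: "incl j v \<in> carrier Om" by (rule lin_closed[OF incl_lin v])
  have "lam p ps (incl j v) m = \<zero>\<^bsub>deg m\<^esub>"
  proof (rule deg_eqI[OF lin_comp[OF comp_lin lin_comp[OF lam_lin incl_lin]] lin_const0 _ v])
    fix q qs assume qs: "qs \<in> words A j" and q: "valid j q"
    have w': "incl j (form K A q qs) = wform q qs" "set qs \<subseteq> carrier A" "length qs = j"
      using qs by (auto simp: wform_def words_def)
    show "lam p ps (incl j (form K A q qs)) m = \<zero>\<^bsub>deg m\<^esub>"
      using lam_wform[OF w(2) _ _ w'(2), of p q] p q m w w' by (simp add: incl_other)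
  qed (use w p in \<open>auto simp: valid_def\<close>)
  then show "mul (incl i (form K A p ps)) (incl j v) m = \<zero>\<^bsub>deg m\<^esub>"
    using mul_wform[OF w(2) _ vi, of p] p w by simp
qed (use lin_closed[OF incl_lin v] in auto)

lemma incl_comp: "(\<And>m. m \<noteq> n \<Longrightarrow> x m = \<zero>\<^bsub>deg m\<^esub>) \<Longrightarrow> incl n (x n) = x"
  by (auto simp: Omega_incl_def fun_eq_iff)

text \<open>
  The nested lifts in \<open>Omega_mult\<close> make sense because, by \<open>lam_wform\<close>, the formula that they lift is a
  component of the multilinear expression \<open>lam p ps (wform q qs)\<close>.
\<close>

lemma Omega_mult_eq:
  assumes u: "u \<in> carrier (deg i)" and v: "v \<in> carrier (deg j)"
  shows "Omega_mult K A i j u v = mul (incl i u) (incl j v) (i + j)"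
proof -
  let ?W = "deg (i + j)"
  have vi: "incl j v \<in> carrier Om" by (rule lin_closed[OF incl_lin v])
  have inner: "form_lift K ?W (form_mult K A p ps) v = lam p ps (incl j v) (i + j)"
    if ps: "ps \<in> words A i" and p: "valid i p" for p ps
  proof -
    have ps': "set ps \<subseteq> carrier A" "length ps = i" using ps by (auto simp: words_def)
    note L = lam_lin[OF validD[OF p] ps'(1)]
    have w: "wml j ?W (\<lambda>q qs. lam p ps (wform q qs) (i + j))"
      by (rule wml_comp[OF lin_comp[OF comp_lin L] wform_wml])
    have "form_lift K ?W (form_mult K A p ps) v = form_lift K ?W (\<lambda>q qs. lam p ps (wform q qs) (i + j)) v"
    proof (rule form_lift_cong[OF v w])
      fix q qs assume "qs \<in> words A j" "valid j q"
      then show "form_mult K A p ps q qs = lam p ps (wform q qs) (i + j)"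
        using lam_wform[OF ps'(1), of p qs q] p ps'(2) by (auto simp: words_def)
    qed
    also have "\<dots> = lam p ps (incl j v) (i + j)"
    proof (rule deg_eqI[OF form_lift_lin[OF w] lin_comp[OF comp_lin lin_comp[OF L incl_lin]] _ v])
      fix q qs assume qs: "qs \<in> words A j" "valid j q"
      then show "form_lift K ?W (\<lambda>q qs. lam p ps (wform q qs) (i + j)) (form K A q qs)
        = lam p ps (incl j (form K A q qs)) (i + j)"
        by (simp add: form_lift_form[OF w]) (simp add: wform_def words_def)
    qed
    finally show ?thesis .
  qed
  have w: "wml i ?W (\<lambda>p ps. lam p ps (incl j v) (i + j))"
    by (rule wml_comp[OF comp_lin lam_wml[OF vi]])
  have "Omega_mult K A i j u v = form_lift K ?W (\<lambda>p ps. lam p ps (incl j v) (i + j)) u"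
    unfolding Omega_mult_def Let_def by (rule form_lift_cong[OF u w]) (rule inner)
  also have "\<dots> = mul (incl i u) (incl j v) (i + j)"
  proof (rule deg_eqI[OF form_lift_lin[OF w] lin_comp[OF comp_lin lin_comp[OF mul_lin1[OF vi] incl_lin]] _ u])
    fix p ps assume ps: "ps \<in> words A i" and p: "valid i p"
    then have "mul (incl i (form K A p ps)) (incl j v) = lam p ps (incl j v)"
      using mul_wform[OF _ _ vi, of ps p] by (auto simp: words_def wform_def)
    then show "form_lift K ?W (\<lambda>p ps. lam p ps (incl j v) (i + j)) (form K A p ps)
      = mul (incl i (form K A p ps)) (incl j v) (i + j)"
      by (simp add: form_lift_form[OF w ps p])
  qed
  finally show ?thesis .
qed

lemma Om_eqI_deg:
  assumes f: "lin Om P f" and g: "lin Om P g"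
    and eq: "\<And>n u. u \<in> carrier (deg n) \<Longrightarrow> f (incl n u) = g (incl n u)"
    and x: "x \<in> carrier Om"
  shows "f x = g x"
  using Om_induct_deg[OF submod_eq[OF f g] _ x] eq lin_closed[OF incl_lin] by auto

text \<open>
  Both sides have components that are linear in \<open>x\<close> and in \<open>y\<close>, so homogeneous \<open>x\<close> and \<open>y\<close> suffice;
  for these at most one summand of the convolution is nonzero.
\<close>

lemma Om_mult:
  assumes x: "x \<in> carrier Om" and y: "y \<in> carrier Om"
  shows "x \<otimes>\<^bsub>Om\<^esub> y = mul x y"
proof
  fix n
  let ?F = "\<lambda>x y. \<Oplus>\<^bsub>deg n\<^esub>i\<in>{..n}. mul (incl i (x i)) (incl (n - i) (y (n - i))) n"
  have ic: "lin Om Om (\<lambda>x. incl i (x i))" for i by (rule lin_comp[OF incl_lin comp_lin])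
  have icc: "incl i (x i) \<in> carrier Om" if "x \<in> carrier Om" for x i by (rule lin_closed[OF ic that])
  have l1: "lin Om (deg n) (\<lambda>x. ?F x y)" if "y \<in> carrier Om" for y
    by (intro lin_finsum_fun Om_vs deg_vs lin_comp[OF comp_lin lin_comp[OF mul_lin1 ic]] icc that) simp
  have l2: "lin Om (deg n) (\<lambda>y. ?F x y)" if "x \<in> carrier Om" for x
    by (intro lin_finsum_fun Om_vs deg_vs lin_comp[OF comp_lin lin_comp[OF mul_lin ic]] icc that) simp
  have "(x \<otimes>\<^bsub>Om\<^esub> y) n = (\<Oplus>\<^bsub>deg n\<^esub>i\<in>{..n}. Omega_mult K A i (n - i) (x i) (y (n - i)))"
    by (simp add: Omega_def)
  also have "\<dots> = ?F x y"
  proof (rule vs_finsum_cong[OF deg_vs])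
    fix i assume "i \<in> {..n}"
    then show "Omega_mult K A i (n - i) (x i) (y (n - i)) = mul (incl i (x i)) (incl (n - i) (y (n - i))) n"
      using Omega_mult_eq[of "x i" i "y (n - i)" "n - i"] x y by (simp add: Om_carrier)
    show "mul (incl i (x i)) (incl (n - i) (y (n - i))) n \<in> carrier (deg n)"
      using icc x y by (intro lin_closed[OF comp_lin] mul_closed)
  qed
  also have "\<dots> = mul x y n"
  proof (rule Om_eqI_deg[OF l1[OF y] lin_comp[OF comp_lin mul_lin1[OF y]] _ x])
    fix i u assume u: "u \<in> carrier (deg i)"
    note ui = lin_closed[OF incl_lin u]
    show "?F (incl i u) y = mul (incl i u) y n"
    proof (rule Om_eqI_deg[OF l2[OF ui] lin_comp[OF comp_lin mul_lin[OF ui]] _ y])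
      fix j v assume v: "v \<in> carrier (deg j)"
      note vj = lin_closed[OF incl_lin v]
      let ?z = "mul (incl i u) (incl j v) n"
      have zc: "?z \<in> carrier (deg n)" by (intro lin_closed[OF comp_lin] mul_closed ui vj)
      \<comment> \<open>If \<open>k = i\<close> but \<open>n - k \<noteq> j\<close>, then \<open>n \<noteq> i + j\<close> and \<open>?z\<close> vanishes, too.\<close>
      have t: "mul (incl k (incl i u k)) (incl (n - k) (incl j v (n - k))) n = (if k = i then ?z else \<zero>\<^bsub>deg n\<^esub>)"
        if k: "k \<le> n" for k
      proof (cases "k = i \<and> n - k = j")
        case False
        have "incl k (incl i u k) = \<zero>\<^bsub>Om\<^esub> \<or> incl (n - k) (incl j v (n - k)) = \<zero>\<^bsub>Om\<^esub>"
        proof (cases "k = i")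
          case True
          then show ?thesis using False incl_other[of "n - k" j v] lin_zero[OF incl_lin] by simp
        next
          case False
          then show ?thesis using incl_other[of k i u] lin_zero[OF incl_lin] by simp
        qed
        then have "mul (incl k (incl i u k)) (incl (n - k) (incl j v (n - k))) = \<zero>\<^bsub>Om\<^esub>"
          using lin_zero[OF mul_lin1] lin_zero[OF mul_lin] icc[OF ui] icc[OF vj] by metis
        moreover have "k = i \<Longrightarrow> ?z = \<zero>\<^bsub>deg n\<^esub>" using False k mul_incl_other[OF u v, of n] by auto
        ultimately show ?thesis by (simp add: Om_zero)
      qed auto
      show "?F (incl i u) (incl j v) = ?z"
      proof (cases "i \<le> n")
        case True
        have "?F (incl i u) (incl j v) = (\<Oplus>\<^bsub>deg n\<^esub>k\<in>{..n}. if k = i then ?z else \<zero>\<^bsub>deg n\<^esub>)"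
          using t zc by (intro vs_finsum_cong deg_vs) auto
        also have "\<dots> = (\<Oplus>\<^bsub>deg n\<^esub>k\<in>{i}. if k = i then ?z else \<zero>\<^bsub>deg n\<^esub>)"
          using True zc by (intro vs_finsum_mono[symmetric] deg_vs) auto
        also have "\<dots> = ?z" using zc by (subst vs_finsum_insert) (auto simp: vs_finsum_empty)
        finally show ?thesis .
      next
        case False
        have "?F (incl i u) (incl j v) = (\<Oplus>\<^bsub>deg n\<^esub>k\<in>{..n}. \<zero>\<^bsub>deg n\<^esub>)"
          using t False by (intro vs_finsum_cong deg_vs) auto
        also have "\<dots> = \<zero>\<^bsub>deg n\<^esub>"
          by (rule abelian_monoid.finsum_zero[OF abelian_group.axioms(1)[OF module.axioms(2)[OF deg_vs]]])
        finally show ?thesis using False mul_incl_other[OF u v, of n] by simp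
      qed
    qed
  qed
  finally show "(x \<otimes>\<^bsub>Om\<^esub> y) n = mul x y n" .
qed

lemma gr_mem: "u \<in> carrier (deg n) \<Longrightarrow> incl n u \<in> Omega_gr K A n"
  by (simp add: Omega_gr_def)

lemma Om_algebra: "nonunital_algebra K Om"
  unfolding nonunital_algebra_def nonunital_algebra_axioms_def
  using alg[unfolded nonunital_algebra_def nonunital_algebra_axioms_def]
  by (auto simp: Om_mult mul_assoc lin_add[OF mul_lin] lin_add[OF mul_lin1] lin_smult[OF mul_lin] lin_smult[OF mul_lin1])

lemma Om_dg: "dg_algebra K Om (Omega_gr K A) d"
proof (intro dg_algebra.intro dg_algebra_axioms.intro Om_algebra)
  show "submodule (Omega_gr K A n) K Om" for n
    unfolding Omega_gr_def
  proof (rule submodI[OF Om_vs])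
    show "incl n ` carrier (deg n) \<subseteq> carrier Om" using lin_closed[OF incl_lin] by auto
    show "\<zero>\<^bsub>Om\<^esub> \<in> incl n ` carrier (deg n)" using lin_zero[OF incl_lin, symmetric] by (rule image_eqI) simp
    show "a \<oplus>\<^bsub>Om\<^esub> b \<in> incl n ` carrier (deg n)"
      if "a \<in> incl n ` carrier (deg n)" "b \<in> incl n ` carrier (deg n)" for a b
      using that by (auto simp: lin_add[OF incl_lin, symmetric])
    show "r \<odot>\<^bsub>Om\<^esub> a \<in> incl n ` carrier (deg n)" if "r \<in> carrier K" "a \<in> incl n ` carrier (deg n)" for a r
      using that by (auto simp: lin_smult[OF incl_lin, symmetric])
  qed
  show "linear_map K Om Om d" using d_lin by (simp add: lin_def)
  show "d x \<in> Omega_gr K A (Suc n)" if "x \<in> Omega_gr K A n" for x n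
    using that by (auto simp: Omega_gr_def d_incl intro!: lin_closed[OF form_lift_lin[OF d_deg_wml]])
  show "d (d x) = \<zero>\<^bsub>Om\<^esub>" if "x \<in> carrier Om" for x by (rule d_d[OF that])
  show "x \<otimes>\<^bsub>Om\<^esub> y \<in> Omega_gr K A (m + n)" if a: "x \<in> Omega_gr K A m" "y \<in> Omega_gr K A n" for x y m n
  proof -
    obtain u v where u: "u \<in> carrier (deg m)" "x = incl m u" and v: "v \<in> carrier (deg n)" "y = incl n v"
      using a by (auto simp: Omega_gr_def)
    note c = lin_closed[OF incl_lin u(1)] lin_closed[OF incl_lin v(1)]
    have "incl (m + n) (mul x y (m + n)) = mul x y"
      unfolding u v by (rule incl_comp[OF mul_incl_other[OF u(1) v(1)]])
    moreover have "mul x y (m + n) \<in> carrier (deg (m + n))"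
      unfolding u v by (intro lin_closed[OF comp_lin] mul_closed c)
    ultimately show ?thesis using gr_mem[of "mul x y (m + n)" "m + n"] c u v by (simp add: Om_mult)
  qed
  show "d (x \<otimes>\<^bsub>Om\<^esub> y) = d x \<otimes>\<^bsub>Om\<^esub> y \<oplus>\<^bsub>Om\<^esub> sgn_pow K n \<odot>\<^bsub>Om\<^esub> (x \<otimes>\<^bsub>Om\<^esub> d y)"
    if a: "x \<in> Omega_gr K A n" and y: "y \<in> carrier Om" for x y n
  proof -
    obtain u where u: "u \<in> carrier (deg n)" "x = incl n u" using a by (auto simp: Omega_gr_def)
    have "d (mul (incl n u) y) = mul (d (incl n u)) y \<oplus>\<^bsub>Om\<^esub> sgn_pow K n \<odot>\<^bsub>Om\<^esub> mul (incl n u) (d y)"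
    proof (rule deg_eqI[OF lin_comp[OF d_lin lin_comp[OF mul_lin1[OF y] incl_lin]]
            lin_add_fun[OF lin_comp[OF lin_comp[OF mul_lin1[OF y] d_lin] incl_lin]
              lin_smult_fun[OF sgn_mem lin_comp[OF mul_lin1[OF d_closed[OF y]] incl_lin]]] _ u(1)])
      fix p as assume "as \<in> words A n" "valid n p"
      then show "d (mul (incl n (form K A p as)) y) = mul (d (incl n (form K A p as))) y
        \<oplus>\<^bsub>Om\<^esub> sgn_pow K n \<odot>\<^bsub>Om\<^esub> mul (incl n (form K A p as)) (d y)"
        using d_mul_wform[of as p y] y by (auto simp: words_def wform_def)
    qed
    then show ?thesis using u y lin_closed[OF incl_lin u(1)] by (simp add: Om_mult)
  qed
  show "\<exists>!f. (\<forall>n. f n \<in> Omega_gr K A n) \<and> finite {n. f n \<noteq> \<zero>\<^bsub>Om\<^esub>} \<and>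
      x = (\<Oplus>\<^bsub>Om\<^esub>n\<in>{n. f n \<noteq> \<zero>\<^bsub>Om\<^esub>}. f n)" if x: "x \<in> carrier Om" for x
  proof -
    have c: "x n \<in> carrier (deg n)" for n using x by (simp add: Om_carrier)
    have nz: "incl n u \<noteq> \<zero>\<^bsub>Om\<^esub> \<longleftrightarrow> u \<noteq> \<zero>\<^bsub>deg n\<^esub>" for n u
      by (auto simp: Om_zero Omega_incl_def fun_eq_iff)
    have f: "finite {n. x n \<noteq> \<zero>\<^bsub>deg n\<^esub>}" using x by (simp add: Om_carrier)
    show ?thesis
    proof (rule ex1I[of _ "\<lambda>n. incl n (x n)"])
      show "(\<forall>n. incl n (x n) \<in> Omega_gr K A n) \<and> finite {n. incl n (x n) \<noteq> \<zero>\<^bsub>Om\<^esub>} \<and>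
        x = (\<Oplus>\<^bsub>Om\<^esub>n\<in>{n. incl n (x n) \<noteq> \<zero>\<^bsub>Om\<^esub>}. incl n (x n))"
        unfolding nz Om_expand[OF x f subset_refl] using gr_mem[OF c] f by blast
      fix g assume g: "(\<forall>n. g n \<in> Omega_gr K A n) \<and> finite {n. g n \<noteq> \<zero>\<^bsub>Om\<^esub>} \<and>
        x = (\<Oplus>\<^bsub>Om\<^esub>n\<in>{n. g n \<noteq> \<zero>\<^bsub>Om\<^esub>}. g n)"
      have gn: "incl n (g n n) = g n" "g n n \<in> carrier (deg n)" for n
      proof -
        have "g n \<in> incl n ` carrier (deg n)" using g by (auto simp: Omega_gr_def)
        then obtain u where u: "g n = incl n u" "u \<in> carrier (deg n)" by blast
        then have "g n n = u" by simp
        with u show "incl n (g n n) = g n" "g n n \<in> carrier (deg n)" by simp_all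
      qed
      define z where "z = (\<lambda>n. g n n)"
      have gz: "g = (\<lambda>n. incl n (z n))" using gn(1) by (auto simp: z_def)
      have s: "{n. g n \<noteq> \<zero>\<^bsub>Om\<^esub>} = {n. z n \<noteq> \<zero>\<^bsub>deg n\<^esub>}" by (simp add: gz nz)
      have fz: "finite {n. z n \<noteq> \<zero>\<^bsub>deg n\<^esub>}" using g by (simp add: s)
      have z: "z \<in> carrier Om" using gn(2) fz by (simp add: Om_carrier z_def)
      have "x = (\<Oplus>\<^bsub>Om\<^esub>n\<in>{n. z n \<noteq> \<zero>\<^bsub>deg n\<^esub>}. g n)" using g unfolding s by blast
      also have "\<dots> = z" unfolding gz by (rule Om_expand[OF z fz subset_refl])
      finally show "g = (\<lambda>n. incl n (x n))" by (simp only: gz)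
    qed
  qed
qed

end

context scalars begin

section \<open>Entwining axioms, one algebra element at a time\<close>

text \<open>
  Conditions of the form \<open>f\<^sub>i x = g\<^sub>i x\<close> for all \<open>i\<close>, such as the entwining axioms for a fixed algebra
  element \<open>x\<close>, define subspaces.
\<close>

lemma submod_eq_all:
  assumes "vs M" "\<And>i. i \<in> I \<Longrightarrow> lin M (P i) (f i)" "\<And>i. i \<in> I \<Longrightarrow> lin M (P i) (g i)"
  shows "submodule {x \<in> carrier M. \<forall>i\<in>I. f i x = g i x} K M"
proof (rule submodI[OF assms(1)])
  show "\<zero>\<^bsub>M\<^esub> \<in> {x \<in> carrier M. \<forall>i\<in>I. f i x = g i x}"
    using assms(1) lin_zero[OF assms(2)] lin_zero[OF assms(3)] by simp
  show "a \<oplus>\<^bsub>M\<^esub> b \<in> {x \<in> carrier M. \<forall>i\<in>I. f i x = g i x}"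
    if "a \<in> {x \<in> carrier M. \<forall>i\<in>I. f i x = g i x}" "b \<in> {x \<in> carrier M. \<forall>i\<in>I. f i x = g i x}" for a b
    using that assms(1) lin_add[OF assms(2)] lin_add[OF assms(3)] by simp
  show "r \<odot>\<^bsub>M\<^esub> a \<in> {x \<in> carrier M. \<forall>i\<in>I. f i x = g i x}"
    if "r \<in> carrier K" "a \<in> {x \<in> carrier M. \<forall>i\<in>I. f i x = g i x}" for r a
    using that assms(1) lin_smult[OF assms(2)] lin_smult[OF assms(3)] by simp
qed auto

lemma nonunital_algebra_bilin: "nonunital_algebra K R \<Longrightarrow> bilin R R R (\<lambda>x y. x \<otimes>\<^bsub>R\<^esub> y)"
  by (intro bilinI linI)
    (auto simp: nonunital_algebra.mult_closed nonunital_algebra.mult_l_distr nonunital_algebra_def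
      nonunital_algebra.mult_r_distr nonunital_algebra.mult_smult_l nonunital_algebra.mult_smult_r)

lemma tmap_cong:
  assumes f: "lin M M' f" and g: "lin N N' g" and t: "t \<in> carrier (tensor K M N)"
    and eq: "\<And>x. x \<in> carrier M \<Longrightarrow> f' x = f x" "\<And>y. y \<in> carrier N \<Longrightarrow> g' y = g y"
  shows "tmap K M' N' f' g' t = tmap K M' N' f g t"
  unfolding tmap_def by (rule tlift_cong[OF t tmap_bilin[OF f g]]) (simp add: eq)

lemma tmap_family_bilin:
  assumes f: "bilin L M M' f" and N: "vs N"
  shows "bilin L (tensor K M N) (tensor K M' N) (\<lambda>l t. tmap K M' N (f l) (\<lambda>y. y) t)"
proof -
  note D = bilinD[OF f]
  show ?thesis
  proof (rule bilinI)
    show "lin (tensor K M N) (tensor K M' N) (\<lambda>t. tmap K M' N (f l) (\<lambda>y. y) t)" if "l \<in> carrier L" for l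
      by (rule tmap_lin[OF D(4)[OF that] lin_id[OF N]])
    show "lin L (tensor K M' N) (\<lambda>l. tmap K M' N (f l) (\<lambda>y. y) t)" if "t \<in> carrier (tensor K M N)" for t
      unfolding tmap_def
      by (rule lin_tlift_fun[OF that D(1,2) N tensor_vs[OF D(3) N]])
        (auto intro!: lin_pure1 D(5) N tmap_bilin[OF D(4) lin_id])
  qed (use D N in \<open>auto intro: tensor_vs\<close>)
qed

lemma tlift_add_fun:
  assumes b: "bilin M N P \<beta>" and c: "bilin M N P \<gamma>" and t: "t \<in> carrier (tensor K M N)"
  shows "tlift P (\<lambda>x y. \<beta> x y \<oplus>\<^bsub>P\<^esub> \<gamma> x y) t = tlift P \<beta> t \<oplus>\<^bsub>P\<^esub> tlift P \<gamma> t"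
proof -
  note B = bilinD[OF b] and C = bilinD[OF c]
  have bc: "bilin M N P (\<lambda>x y. \<beta> x y \<oplus>\<^bsub>P\<^esub> \<gamma> x y)"
    by (intro bilinI B(1-3) lin_add_fun B(4,5) C(4,5))
  show ?thesis
    by (rule tensor_eqI[OF B(1,2) tlift_lin[OF bc] lin_add_fun[OF tlift_lin[OF b] tlift_lin[OF c]] _ t])
      (simp add: tlift_pure[OF bc] tlift_pure[OF b] tlift_pure[OF c])
qed

lemma tlift_smult_fun:
  assumes b: "bilin M N P \<beta>" and r: "r \<in> carrier K" and t: "t \<in> carrier (tensor K M N)"
  shows "tlift P (\<lambda>x y. r \<odot>\<^bsub>P\<^esub> \<beta> x y) t = r \<odot>\<^bsub>P\<^esub> tlift P \<beta> t"
  by (rule tlift_fusion[OF lin_smult_fun[OF r lin_id[OF bilinD(3)[OF b]]] b t, symmetric])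

lemma tlift_minus_fun:
  assumes b: "bilin M N P \<beta>" and c: "bilin M N P \<gamma>" and t: "t \<in> carrier (tensor K M N)"
  shows "tlift P (\<lambda>x y. \<beta> x y \<ominus>\<^bsub>P\<^esub> \<gamma> x y) t = tlift P \<beta> t \<ominus>\<^bsub>P\<^esub> tlift P \<gamma> t"
proof -
  note B = bilinD[OF b] and C = bilinD[OF c]
  have bc: "bilin M N P (\<lambda>x y. \<beta> x y \<ominus>\<^bsub>P\<^esub> \<gamma> x y)"
    by (intro bilinI B(1-3) lin_minus_fun B(4,5) C(4,5))
  show ?thesis
    by (rule tensor_eqI[OF B(1,2) tlift_lin[OF bc] lin_minus_fun[OF tlift_lin[OF b] tlift_lin[OF c]] _ t])
      (simp add: tlift_pure[OF bc] tlift_pure[OF b] tlift_pure[OF c])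
qed

end

text \<open>
  The data of an entwining structure, before any of the axioms on the entwining map. It will be
  instantiated for \<open>A\<close> and for \<open>\<Omega>A\<close>.
\<close>

locale entwining_data = scalars K for K :: "'k ring" +
  fixes R :: "('k, 'r) module" and C :: "('k, 'c) module"
    and Delta :: "'c \<Rightarrow> ('k, 'c, 'c) tens" and eps :: "'c \<Rightarrow> 'k"
    and Psi :: "('k, 'c, 'r) tens \<Rightarrow> ('k, 'r, 'c) tens"
  assumes R_alg: "nonunital_algebra K R" and C_coalg: "coalgebra K C Delta eps"
    and Psi_lin: "linear_map K (tensor K C R) (tensor K R C) Psi"
begin

abbreviation RC where "RC \<equiv> tensor K R C"
abbreviation CC where "CC \<equiv> tensor K C C"
abbreviation RCC where "RCC \<equiv> tensor K R CC"

lemma R_vs [simp]: "vs R" using R_alg by (simp add: nonunital_algebra_def)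
lemma C_vs [simp]: "vs C" using C_coalg by (simp add: coalgebra_def)
lemma RC_vs [simp]: "vs RC" and CC_vs [simp]: "vs CC" and RCC_vs [simp]: "vs RCC"
  by (auto intro!: tensor_vs)

lemma Delta_lin: "lin C CC Delta"
  using C_coalg by (simp add: lin_def coalgebra_def coalgebra_axioms_def)

lemma eps_lin: "lin C (ground K) eps"
  using C_coalg by (simp add: lin_def coalgebra_def coalgebra_axioms_def)

lemma Psi_lin': "lin (tensor K C R) RC Psi"
  using Psi_lin by (simp add: lin_def tensor_vs)

lemma R_bilin: "bilin R R R (\<lambda>x y. x \<otimes>\<^bsub>R\<^esub> y)"
  by (rule nonunital_algebra_bilin[OF R_alg])

lemma R_closed [simp]: "x \<in> carrier R \<Longrightarrow> y \<in> carrier R \<Longrightarrow> x \<otimes>\<^bsub>R\<^esub> y \<in> carrier R"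
  by (rule bilinD(6)[OF R_bilin])

text \<open>
  The element \<open>x\<^sub>\<psi> \<otimes> c\<^sup>\<psi>\<close>.
\<close>

definition cross where "cross c x = Psi (pure K C R c x)"

lemma cross_bilin: "bilin C R RC cross"
  unfolding cross_def[abs_def]
  by (intro bilinI lin_comp[OF Psi_lin'] lin_pure1 lin_pure2 lin_id C_vs R_vs RC_vs)

lemma cross_closed [simp]: "c \<in> carrier C \<Longrightarrow> x \<in> carrier R \<Longrightarrow> cross c x \<in> carrier RC"
  by (rule bilinD(6)[OF cross_bilin])

lemmas cross_lin = bilinD(4)[OF cross_bilin] and cross_lin1 = bilinD(5)[OF cross_bilin]

definition act where "act x t = tmap K R C (\<lambda>y. x \<otimes>\<^bsub>R\<^esub> y) (\<lambda>c. c) t"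
definition act2 where "act2 x t = tmap K R CC (\<lambda>y. x \<otimes>\<^bsub>R\<^esub> y) (\<lambda>c. c) t"

lemma act_bilin: "bilin R RC RC act"
  unfolding act_def[abs_def] by (rule tmap_family_bilin[OF R_bilin C_vs])

lemma act2_bilin: "bilin R RCC RCC act2"
  unfolding act2_def[abs_def] by (rule tmap_family_bilin[OF R_bilin CC_vs])

lemma act_closed [simp]: "x \<in> carrier R \<Longrightarrow> t \<in> carrier RC \<Longrightarrow> act x t \<in> carrier RC"
  by (rule bilinD(6)[OF act_bilin])

lemmas act_lin = bilinD(4)[OF act_bilin] and act_lin1 = bilinD(5)[OF act_bilin]
lemmas act2_lin = bilinD(4)[OF act2_bilin] and act2_lin1 = bilinD(5)[OF act2_bilin]

lemma act_pure: "x \<in> carrier R \<Longrightarrow> y \<in> carrier R \<Longrightarrow> c \<in> carrier C \<Longrightarrow>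
    act x (pure K R C y c) = pure K R C (x \<otimes>\<^bsub>R\<^esub> y) c"
  unfolding act_def by (rule tmap_pure[OF bilinD(4)[OF R_bilin] lin_id]) auto

lemma act2_pure: "x \<in> carrier R \<Longrightarrow> y \<in> carrier R \<Longrightarrow> u \<in> carrier CC \<Longrightarrow>
    act2 x (pure K R CC y u) = pure K R CC (x \<otimes>\<^bsub>R\<^esub> y) u"
  unfolding act2_def by (rule tmap_pure[OF bilinD(4)[OF R_bilin] lin_id]) auto

lemma act_act:
  assumes "x \<in> carrier R" "y \<in> carrier R" "t \<in> carrier RC"
  shows "act x (act y t) = act (x \<otimes>\<^bsub>R\<^esub> y) t"
  by (rule tensor_eqI[OF R_vs C_vs lin_comp[OF act_lin act_lin] act_lin _ assms(3)])
    (use assms nonunital_algebra.mult_assoc[OF R_alg] in \<open>auto simp: act_pure\<close>)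

section \<open>Multiplicativity of the entwining map\<close>

lemma act_cross_bilin: "y \<in> carrier R \<Longrightarrow> bilin R C RC (\<lambda>x c. act x (cross c y))"
  by (intro bilinI R_vs C_vs RC_vs lin_comp[OF act_lin cross_lin1] act_lin1) auto

text \<open>
  Multiplicativity of the entwining map with first factor \<open>x\<close>:
  \<open>(x y)\<^sub>\<psi> \<otimes> c\<^sup>\<psi> = x\<^sub>\<psi> y\<^sub>\<phi> \<otimes> c\<^sup>\<psi>\<^sup>\<phi>\<close>, where \<open>c\<close> moves past \<open>x\<close> by \<open>\<psi>\<close> and then past \<open>y\<close> by a second
  copy \<open>\<phi>\<close> of the same map.
\<close>

definition mult_law where
  "mult_law x \<longleftrightarrow> (\<forall>c\<in>carrier C. \<forall>y\<in>carrier R.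
     cross c (x \<otimes>\<^bsub>R\<^esub> y) = tlift RC (\<lambda>x' c'. act x' (cross c' y)) (cross c x))"

lemma mult_lawD: "mult_law x \<Longrightarrow> c \<in> carrier C \<Longrightarrow> y \<in> carrier R \<Longrightarrow>
    cross c (x \<otimes>\<^bsub>R\<^esub> y) = tlift RC (\<lambda>x' c'. act x' (cross c' y)) (cross c x)"
  by (simp add: mult_law_def)

lemma mult_law_submod: "submodule {x \<in> carrier R. mult_law x} K R"
proof -
  have "submodule {x \<in> carrier R. \<forall>i\<in>carrier C \<times> carrier R. cross (fst i) (x \<otimes>\<^bsub>R\<^esub> snd i) =
      tlift RC (\<lambda>x' c'. act x' (cross c' (snd i))) (cross (fst i) x)} K R"
    by (rule submod_eq_all[OF R_vs, where P = "\<lambda>_. RC"])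
      (auto intro!: lin_comp[OF cross_lin bilinD(5)[OF R_bilin]] lin_tlift_arg[OF cross_lin act_cross_bilin])
  then show ?thesis by (simp add: mult_law_def)
qed

lemma product_map_lin: "lin (tensor K R R) R (product_map K R)"
  unfolding product_map_def by (rule tlift_lin[OF R_bilin])

lemma product_map_pure: "x \<in> carrier R \<Longrightarrow> y \<in> carrier R \<Longrightarrow> product_map K R (pure K R R x y) = x \<otimes>\<^bsub>R\<^esub> y"
  unfolding product_map_def by (rule tlift_pure[OF R_bilin])

lemma mult_axiom_iff:
  "(\<forall>u \<in> carrier (tensor K (tensor K C R) R).
      Psi (tmap K C R (\<lambda>c. c) (product_map K R) (assoc K C R R u)) =
      tmap K R C (product_map K R) (\<lambda>c. c)
        (assoc_inv K R R C
          (tmap K R (tensor K R C) (\<lambda>x. x) Psi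
            (assoc K R C R (tmap K (tensor K R C) R Psi (\<lambda>x. x) u))))) \<longleftrightarrow>
   (\<forall>x\<in>carrier R. mult_law x)"
proof -
  let ?CR = "tensor K C R"
  let ?l = "\<lambda>u. Psi (tmap K C R (\<lambda>c. c) (product_map K R) (assoc K C R R u))"
  let ?r1 = "\<lambda>v. tmap K R C (product_map K R) (\<lambda>c. c)
        (assoc_inv K R R C (tmap K R (tensor K R C) (\<lambda>x. x) Psi (assoc K R C R v)))"
  let ?r = "\<lambda>u. ?r1 (tmap K (tensor K R C) R Psi (\<lambda>x. x) u)"
  have CR: "vs ?CR" by (intro tensor_vs) auto
  have l: "lin (tensor K ?CR R) RC ?l"
    by (intro lin_comp[OF Psi_lin'] lin_comp[OF tmap_lin[OF lin_id product_map_lin]] assoc_lin C_vs R_vs)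
  have r1: "lin (tensor K RC R) RC ?r1"
    by (intro lin_comp[OF tmap_lin[OF product_map_lin lin_id]] lin_comp[OF assoc_inv_lin]
        lin_comp[OF tmap_lin[OF lin_id Psi_lin']] assoc_lin C_vs R_vs)
  have r: "lin (tensor K ?CR R) RC ?r"
    by (intro lin_comp[OF r1] tmap_lin Psi_lin' lin_id R_vs)
  have lp: "?l (pure K ?CR R (pure K C R c x) y) = cross c (x \<otimes>\<^bsub>R\<^esub> y)"
    if "c \<in> carrier C" "x \<in> carrier R" "y \<in> carrier R" for c x y
    using that pure_closed[OF R_vs R_vs, of x y]
    by (simp add: assoc_pure[OF C_vs R_vs R_vs] tmap_pure[OF lin_id product_map_lin] product_map_pure cross_def)
  have step: "tmap K R C (product_map K R) (\<lambda>c. c) (assoc_inv K R R C (pure K R RC x t)) = act x t"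
    if x: "x \<in> carrier R" and t: "t \<in> carrier RC" for x t
    by (rule tensor_eqI[OF R_vs C_vs
          lin_comp[OF tmap_lin[OF product_map_lin lin_id[OF C_vs]] lin_comp[OF assoc_inv_lin[OF R_vs R_vs C_vs]
             bilinD(4)[OF pure_bilin[OF R_vs RC_vs] x]]] act_lin[OF x] _ t])
      (use x in \<open>simp add: assoc_inv_pure[OF R_vs R_vs C_vs] tmap_pure[OF product_map_lin lin_id]
          pure_closed product_map_pure act_pure\<close>)
  have rp: "?r (pure K ?CR R (pure K C R c x) y) = tlift RC (\<lambda>x' c'. act x' (cross c' y)) (cross c x)"
    if c: "c \<in> carrier C" and x: "x \<in> carrier R" and y: "y \<in> carrier R" for c x y
  proof -
    have "?r (pure K ?CR R (pure K C R c x) y) = ?r1 (pure K RC R (cross c x) y)"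
      using tmap_pure[OF Psi_lin' lin_id[OF R_vs] pure_closed[OF C_vs R_vs c x] y] by (simp add: cross_def)
    also have "\<dots> = tlift RC (\<lambda>x' c'. act x' (cross c' y)) (cross c x)"
    proof (rule tensor_eqI[OF R_vs C_vs lin_comp[OF r1 bilinD(5)[OF pure_bilin[OF RC_vs R_vs] y]]
            tlift_lin[OF act_cross_bilin[OF y]] _ cross_closed[OF c x]])
      fix x' c' assume x': "x' \<in> carrier R" and c': "c' \<in> carrier C"
      have "?r1 (pure K RC R (pure K R C x' c') y)
        = tmap K R C (product_map K R) (\<lambda>c. c) (assoc_inv K R R C (pure K R RC x' (cross c' y)))"
        using x' c' y tmap_pure[OF lin_id[OF R_vs] Psi_lin', of x' "pure K C R c' y"]
        by (simp add: assoc_pure[OF R_vs C_vs R_vs] pure_closed cross_def)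
      then show "?r1 (pure K RC R (pure K R C x' c') y)
        = tlift RC (\<lambda>x' c'. act x' (cross c' y)) (pure K R C x' c')"
        using x' c' y by (simp add: step tlift_pure[OF act_cross_bilin])
    qed
    finally show ?thesis .
  qed
  show ?thesis
  proof (intro iffI ballI)
    assume a: "\<forall>u \<in> carrier (tensor K ?CR R). ?l u = ?r u"
    show "mult_law x" if x: "x \<in> carrier R" for x
      unfolding mult_law_def
    proof (intro ballI)
      fix c y assume c: "c \<in> carrier C" and y: "y \<in> carrier R"
      have "pure K ?CR R (pure K C R c x) y \<in> carrier (tensor K ?CR R)"
        using c x y CR by (intro pure_closed) auto
      from a[rule_format, OF this] show "cross c (x \<otimes>\<^bsub>R\<^esub> y) = tlift RC (\<lambda>x' c'. act x' (cross c' y)) (cross c x)"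
        unfolding lp[OF c x y] rp[OF c x y] .
    qed
  next
    assume a: "\<forall>x\<in>carrier R. mult_law x"
    fix u assume u: "u \<in> carrier (tensor K ?CR R)"
    show "?l u = ?r u"
    proof (rule tensor_eqI[OF CR R_vs l r _ u])
      fix t y assume t: "t \<in> carrier ?CR" and y: "y \<in> carrier R"
      show "?l (pure K ?CR R t y) = ?r (pure K ?CR R t y)"
      proof (rule tensor_eqI[OF C_vs R_vs lin_comp[OF l bilinD(5)[OF pure_bilin[OF CR R_vs] y]]
              lin_comp[OF r bilinD(5)[OF pure_bilin[OF CR R_vs] y]] _ t])
        fix c x assume c: "c \<in> carrier C" and x: "x \<in> carrier R"
        show "?l (pure K ?CR R (pure K C R c x) y) = ?r (pure K ?CR R (pure K C R c x) y)"
          unfolding lp[OF c x y] rp[OF c x y] using a c x y by (simp add: mult_law_def)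
      qed
    qed
  qed
qed

text \<open>
  Moving \<open>c\<close> past \<open>(x y) z = x (y z)\<close> amounts to moving it past \<open>x\<close>, then \<open>y\<close>, then \<open>z\<close>, for either
  bracketing.
\<close>

lemma mult_law_mult:
  assumes x: "x \<in> carrier R" "mult_law x" and y: "y \<in> carrier R" "mult_law y"
  shows "mult_law (x \<otimes>\<^bsub>R\<^esub> y)"
  unfolding mult_law_def
proof (intro ballI)
  fix c z assume c: "c \<in> carrier C" and z: "z \<in> carrier R"
  note Z = act_cross_bilin[OF z]
  have inner: "act x' (cross c' (y \<otimes>\<^bsub>R\<^esub> z)) = tlift RC (\<lambda>w c''. act w (cross c'' z)) (act x' (cross c' y))"
    if x': "x' \<in> carrier R" and c': "c' \<in> carrier C" for x' c'
  proof -
    have "act x' (cross c' (y \<otimes>\<^bsub>R\<^esub> z)) = act x' (tlift RC (\<lambda>y' c''. act y' (cross c'' z)) (cross c' y))"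
      using mult_lawD[OF y(2) c' z] by simp
    also have "\<dots> = tlift RC (\<lambda>y' c''. act x' (act y' (cross c'' z))) (cross c' y)"
      by (rule tlift_fusion[OF act_lin[OF x'] Z cross_closed[OF c' y(1)]])
    also have "\<dots> = tlift RC (\<lambda>y' c''. act (x' \<otimes>\<^bsub>R\<^esub> y') (cross c'' z)) (cross c' y)"
      by (rule tlift_cong[OF cross_closed[OF c' y(1)]])
        (use x' z in \<open>auto simp: act_act intro!: bilinI lin_comp[OF act_lin cross_lin1]
            lin_comp[OF act_lin1 bilinD(4)[OF R_bilin]]\<close>)
    also have "\<dots> = tlift RC (\<lambda>w c''. act w (cross c'' z)) (act x' (cross c' y))"
      unfolding act_def[of x']
      by (rule tlift_tmap[OF bilinD(4)[OF R_bilin x'] lin_id[OF C_vs] Z cross_closed[OF c' y(1)], symmetric])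
    finally show ?thesis .
  qed
  have "cross c (x \<otimes>\<^bsub>R\<^esub> y \<otimes>\<^bsub>R\<^esub> z) = cross c (x \<otimes>\<^bsub>R\<^esub> (y \<otimes>\<^bsub>R\<^esub> z))"
    using nonunital_algebra.mult_assoc[OF R_alg] x y z by simp
  also have "\<dots> = tlift RC (\<lambda>x' c'. act x' (cross c' (y \<otimes>\<^bsub>R\<^esub> z))) (cross c x)"
    by (rule mult_lawD[OF x(2) c]) (use y z in simp)
  also have "\<dots> = tlift RC (\<lambda>x' c'. tlift RC (\<lambda>w c''. act w (cross c'' z)) (act x' (cross c' y))) (cross c x)"
  proof (rule tlift_cong[OF cross_closed[OF c x(1)]])
    show "bilin R C RC (\<lambda>x' c'. tlift RC (\<lambda>w c''. act w (cross c'' z)) (act x' (cross c' y)))"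
      using y by (intro bilinI lin_tlift_arg[OF lin_comp[OF act_lin cross_lin1]] lin_tlift_arg[OF act_lin1] Z) auto
  qed (rule inner)
  also have "\<dots> = tlift RC (\<lambda>w c''. act w (cross c'' z)) (tlift RC (\<lambda>x' c'. act x' (cross c' y)) (cross c x))"
    by (rule tlift_fusion[OF tlift_lin[OF Z] act_cross_bilin[OF y(1)] cross_closed[OF c x(1)], symmetric])
  also have "\<dots> = tlift RC (\<lambda>w c''. act w (cross c'' z)) (cross c (x \<otimes>\<^bsub>R\<^esub> y))"
    using mult_lawD[OF x(2) c y(1)] by simp
  finally show "cross c (x \<otimes>\<^bsub>R\<^esub> y \<otimes>\<^bsub>R\<^esub> z)
    = tlift RC (\<lambda>w c''. act w (cross c'' z)) (cross c (x \<otimes>\<^bsub>R\<^esub> y))" .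
qed

section \<open>The counit law\<close>

lemma eps_closed [simp]: "c \<in> carrier C \<Longrightarrow> eps c \<in> carrier K"
  using lin_closed[OF eps_lin] by simp

lemma eps_bilin: "bilin R C R (\<lambda>x c. eps c \<odot>\<^bsub>R\<^esub> x)"
  by (intro bilinI R_vs C_vs lin_scale eps_lin lin_smult_fun lin_id) auto

lemma eps_bilin': "bilin C R R (\<lambda>c x. eps c \<odot>\<^bsub>R\<^esub> x)"
  by (intro bilinI R_vs C_vs lin_scale eps_lin lin_smult_fun lin_id) auto

definition counit_law where
  "counit_law x \<longleftrightarrow> (\<forall>c\<in>carrier C. tlift R (\<lambda>x' c'. eps c' \<odot>\<^bsub>R\<^esub> x') (cross c x) = eps c \<odot>\<^bsub>R\<^esub> x)"

lemma counit_lawD: "counit_law x \<Longrightarrow> c \<in> carrier C \<Longrightarrow>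
    tlift R (\<lambda>x' c'. eps c' \<odot>\<^bsub>R\<^esub> x') (cross c x) = eps c \<odot>\<^bsub>R\<^esub> x"
  by (simp add: counit_law_def)

lemma counit_law_submod: "submodule {x \<in> carrier R. counit_law x} K R"
  unfolding counit_law_def
  by (rule submod_eq_all[OF R_vs, where P = "\<lambda>_. R"])
    (auto intro!: lin_tlift_arg[OF cross_lin eps_bilin] lin_smult_fun lin_id)

lemma counit_axiom_iff:
  "(\<forall>t \<in> carrier (tensor K C R).
      tlift R (\<lambda>x c. eps c \<odot>\<^bsub>R\<^esub> x) (Psi t) = tlift R (\<lambda>c x. eps c \<odot>\<^bsub>R\<^esub> x) t) \<longleftrightarrow>
   (\<forall>x\<in>carrier R. counit_law x)"
proof (intro iffI ballI)
  assume a: "\<forall>t \<in> carrier (tensor K C R). tlift R (\<lambda>x c. eps c \<odot>\<^bsub>R\<^esub> x) (Psi t) = tlift R (\<lambda>c x. eps c \<odot>\<^bsub>R\<^esub> x) t"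
  show "counit_law x" if x: "x \<in> carrier R" for x
    unfolding counit_law_def using a pure_closed[OF C_vs R_vs _ x] x
    by (auto simp: cross_def tlift_pure[OF eps_bilin'])
next
  assume a: "\<forall>x\<in>carrier R. counit_law x"
  show "tlift R (\<lambda>x c. eps c \<odot>\<^bsub>R\<^esub> x) (Psi t) = tlift R (\<lambda>c x. eps c \<odot>\<^bsub>R\<^esub> x) t"
    if t: "t \<in> carrier (tensor K C R)" for t
    by (rule tensor_eqI[OF C_vs R_vs lin_tlift_arg[OF Psi_lin' eps_bilin] tlift_lin[OF eps_bilin'] _ t])
      (use a in \<open>simp add: tlift_pure[OF eps_bilin'] counit_law_def cross_def\<close>)
qed

text \<open>
  \<open>x\<^sub>\<psi> y\<^sub>\<phi> \<epsilon>(c\<^sup>\<psi>\<^sup>\<phi>) = x\<^sub>\<psi> \<epsilon>(c\<^sup>\<psi>) y = \<epsilon>(c) x y\<close>.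
\<close>

lemma counit_law_mult:
  assumes x: "x \<in> carrier R" "mult_law x" "counit_law x" and y: "y \<in> carrier R" "counit_law y"
  shows "counit_law (x \<otimes>\<^bsub>R\<^esub> y)"
  unfolding counit_law_def
proof (intro ballI)
  fix c assume c: "c \<in> carrier C"
  let ?e = "tlift R (\<lambda>x' c'. eps c' \<odot>\<^bsub>R\<^esub> x')"
  have act_e: "?e (act x' t) = x' \<otimes>\<^bsub>R\<^esub> ?e t" if x': "x' \<in> carrier R" and t: "t \<in> carrier RC" for x' t
    by (rule tensor_eqI[OF R_vs C_vs lin_comp[OF tlift_lin[OF eps_bilin] act_lin[OF x']]
          lin_comp[OF bilinD(4)[OF R_bilin x'] tlift_lin[OF eps_bilin]] _ t])
      (use x' in \<open>simp add: act_pure tlift_pure[OF eps_bilin] lin_smult[OF bilinD(4)[OF R_bilin x']]\<close>)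
  have "?e (cross c (x \<otimes>\<^bsub>R\<^esub> y)) = ?e (tlift RC (\<lambda>x' c'. act x' (cross c' y)) (cross c x))"
    using mult_lawD[OF x(2) c y(1)] by simp
  also have "\<dots> = tlift R (\<lambda>x' c'. ?e (act x' (cross c' y))) (cross c x)"
    by (rule tlift_fusion[OF tlift_lin[OF eps_bilin] act_cross_bilin[OF y(1)] cross_closed[OF c x(1)]])
  also have "\<dots> = tlift R (\<lambda>x' c'. (eps c' \<odot>\<^bsub>R\<^esub> x') \<otimes>\<^bsub>R\<^esub> y) (cross c x)"
  proof (rule tlift_cong[OF cross_closed[OF c x(1)]])
    show "bilin R C R (\<lambda>x' c'. (eps c' \<odot>\<^bsub>R\<^esub> x') \<otimes>\<^bsub>R\<^esub> y)"
      using y bilinD[OF eps_bilin] by (intro bilinI lin_comp[OF bilinD(5)[OF R_bilin]]) auto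
    show "?e (act x' (cross c' y)) = (eps c' \<odot>\<^bsub>R\<^esub> x') \<otimes>\<^bsub>R\<^esub> y" if "x' \<in> carrier R" "c' \<in> carrier C" for x' c'
      using that y counit_lawD[OF y(2)]
      by (simp add: act_e lin_smult[OF bilinD(4)[OF R_bilin]] lin_smult[OF bilinD(5)[OF R_bilin]])
  qed
  also have "\<dots> = ?e (cross c x) \<otimes>\<^bsub>R\<^esub> y"
    by (rule tlift_fusion[OF bilinD(5)[OF R_bilin y(1)] eps_bilin cross_closed[OF c x(1)], symmetric])
  also have "\<dots> = eps c \<odot>\<^bsub>R\<^esub> (x \<otimes>\<^bsub>R\<^esub> y)"
    using x y c counit_lawD[OF x(3) c] by (simp add: lin_smult[OF bilinD(5)[OF R_bilin]])
  finally show "?e (cross c (x \<otimes>\<^bsub>R\<^esub> y)) = eps c \<odot>\<^bsub>R\<^esub> (x \<otimes>\<^bsub>R\<^esub> y)" .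
qed

section \<open>The comultiplication law\<close>

text \<open>
  The element \<open>x\<^sub>\<psi> \<otimes> (c\<^sup>\<psi> \<otimes> f)\<close>: only the left one of two coalgebra elements moves past \<open>x\<close>.
\<close>

definition shuffle where
  "shuffle c x f = tlift RCC (\<lambda>x' c'. pure K R CC x' (pure K C C c' f)) (cross c x)"

lemma pair_bilin: "f \<in> carrier C \<Longrightarrow> bilin R C RCC (\<lambda>x c. pure K R CC x (pure K C C c f))"
  by (intro bilinI lin_pure2 lin_pure1 lin_id R_vs C_vs CC_vs RCC_vs pure_closed)

lemma shuffle_lin1: "x \<in> carrier R \<Longrightarrow> f \<in> carrier C \<Longrightarrow> lin C RCC (\<lambda>c. shuffle c x f)"
  unfolding shuffle_def by (rule lin_tlift_arg[OF cross_lin1 pair_bilin])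

lemma shuffle_lin2: "c \<in> carrier C \<Longrightarrow> f \<in> carrier C \<Longrightarrow> lin R RCC (\<lambda>x. shuffle c x f)"
  unfolding shuffle_def by (rule lin_tlift_arg[OF cross_lin pair_bilin])

lemma shuffle_lin3: "c \<in> carrier C \<Longrightarrow> x \<in> carrier R \<Longrightarrow> lin C RCC (\<lambda>f. shuffle c x f)"
  unfolding shuffle_def
  by (intro lin_tlift_fun[OF cross_closed] pair_bilin lin_pure2 lin_id C_vs R_vs CC_vs RCC_vs)

lemma shuffle_closed [simp]:
  "c \<in> carrier C \<Longrightarrow> x \<in> carrier R \<Longrightarrow> f \<in> carrier C \<Longrightarrow> shuffle c x f \<in> carrier RCC"
  by (rule lin_closed[OF shuffle_lin3])

lemma shuffle_bilin: "c \<in> carrier C \<Longrightarrow> bilin R C RCC (\<lambda>x f. shuffle c x f)"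
  by (intro bilinI shuffle_lin2 shuffle_lin3 R_vs C_vs RCC_vs)

text \<open>
  Two coalgebra elements move past \<open>x\<close>, first \<open>c2\<close> and then \<open>c1\<close>.
\<close>

definition cross2 where "cross2 x c1 c2 = tlift RCC (\<lambda>x' f. shuffle c1 x' f) (cross c2 x)"

lemma cross2_bilin: "x \<in> carrier R \<Longrightarrow> bilin C C RCC (\<lambda>c1 c2. cross2 x c1 c2)"
  unfolding cross2_def
  by (intro bilinI lin_tlift_arg[OF cross_lin1 shuffle_bilin]
      lin_tlift_fun[OF cross_closed] shuffle_lin1 shuffle_bilin C_vs R_vs RCC_vs)

lemma cross2_lin: "c1 \<in> carrier C \<Longrightarrow> c2 \<in> carrier C \<Longrightarrow> lin R RCC (\<lambda>x. cross2 x c1 c2)"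
  unfolding cross2_def by (rule lin_tlift_arg[OF cross_lin shuffle_bilin])

lemma cross2_closed [simp]:
  "c1 \<in> carrier C \<Longrightarrow> c2 \<in> carrier C \<Longrightarrow> x \<in> carrier R \<Longrightarrow> cross2 x c1 c2 \<in> carrier RCC"
  by (rule lin_closed[OF cross2_lin])

definition comult_law where
  "comult_law x \<longleftrightarrow> (\<forall>c\<in>carrier C. tmap K R CC (\<lambda>x. x) Delta (cross c x) = tlift RCC (cross2 x) (Delta c))"

lemma comult_lawD: "comult_law x \<Longrightarrow> c \<in> carrier C \<Longrightarrow>
    tmap K R CC (\<lambda>x. x) Delta (cross c x) = tlift RCC (cross2 x) (Delta c)"
  by (simp add: comult_law_def)

lemma Delta_closed [simp]: "c \<in> carrier C \<Longrightarrow> Delta c \<in> carrier CC"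
  by (rule lin_closed[OF Delta_lin])

lemma comult_law_submod: "submodule {x \<in> carrier R. comult_law x} K R"
  unfolding comult_law_def
  by (rule submod_eq_all[OF R_vs, where P = "\<lambda>_. RCC"])
    (auto intro!: lin_comp[OF tmap_lin[OF lin_id Delta_lin] cross_lin] lin_tlift_fun[OF Delta_closed]
      cross2_lin cross2_bilin)

lemma comult_axiom_iff:
  "(\<forall>t \<in> carrier (tensor K C R).
      tmap K R (tensor K C C) (\<lambda>x. x) Delta (Psi t) =
      assoc K R C C
        (tmap K (tensor K R C) C Psi (\<lambda>c. c)
          (assoc_inv K C R C
            (tmap K C (tensor K R C) (\<lambda>c. c) Psi
              (assoc K C C R (tmap K (tensor K C C) R Delta (\<lambda>x. x) t)))))) \<longleftrightarrow>
   (\<forall>x\<in>carrier R. comult_law x)"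
proof -
  let ?CR = "tensor K C R"
  let ?l = "\<lambda>t. tmap K R CC (\<lambda>x. x) Delta (Psi t)"
  let ?r3 = "\<lambda>v. assoc K R C C (tmap K RC C Psi (\<lambda>c. c) (assoc_inv K C R C v))"
  let ?r1 = "\<lambda>v. ?r3 (tmap K C RC (\<lambda>c. c) Psi (assoc K C C R v))"
  let ?r = "\<lambda>t. ?r1 (tmap K CC R Delta (\<lambda>x. x) t)"
  have l: "lin ?CR RCC ?l"
    by (intro lin_comp[OF tmap_lin[OF lin_id Delta_lin]] Psi_lin' R_vs)
  have r3: "lin (tensor K C RC) RCC ?r3"
    by (intro lin_comp[OF assoc_lin] lin_comp[OF tmap_lin[OF Psi_lin' lin_id]] assoc_inv_lin C_vs R_vs)
  have r1: "lin (tensor K CC R) RCC ?r1"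
    by (intro lin_comp[OF r3] lin_comp[OF tmap_lin[OF lin_id Psi_lin']] assoc_lin C_vs R_vs)
  have r: "lin ?CR RCC ?r"
    by (intro lin_comp[OF r1] tmap_lin Delta_lin lin_id R_vs)
  have s: "?r3 (pure K C RC c1 t) = tlift RCC (\<lambda>x' f. shuffle c1 x' f) t"
    if c1: "c1 \<in> carrier C" and t: "t \<in> carrier RC" for c1 t
  proof (rule tensor_eqI[OF R_vs C_vs lin_comp[OF r3 bilinD(4)[OF pure_bilin[OF C_vs RC_vs] c1]]
          tlift_lin[OF shuffle_bilin[OF c1]] _ t])
    fix x' f assume x': "x' \<in> carrier R" and f: "f \<in> carrier C"
    have "?r3 (pure K C RC c1 (pure K R C x' f)) = assoc K R C C (pure K RC C (cross c1 x') f)"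
      using c1 x' f by (simp add: assoc_inv_pure[OF C_vs R_vs C_vs] tmap_pure[OF Psi_lin' lin_id[OF C_vs]]
          pure_closed cross_def)
    also have "\<dots> = shuffle c1 x' f"
      unfolding shuffle_def using c1 x' f by (intro assoc_pure2 R_vs C_vs) auto
    finally show "?r3 (pure K C RC c1 (pure K R C x' f)) = tlift RCC (\<lambda>x' f. shuffle c1 x' f) (pure K R C x' f)"
      using c1 x' f by (simp add: tlift_pure[OF shuffle_bilin])
  qed
  have r1p: "?r1 (pure K CC R u x) = tlift RCC (cross2 x) u"
    if u: "u \<in> carrier CC" and x: "x \<in> carrier R" for u x
  proof (rule tensor_eqI[OF C_vs C_vs lin_comp[OF r1 bilinD(5)[OF pure_bilin[OF CC_vs R_vs] x]]
          tlift_lin[OF cross2_bilin[OF x]] _ u])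
    fix c1 c2 assume c: "c1 \<in> carrier C" "c2 \<in> carrier C"
    have "tmap K C RC (\<lambda>c. c) Psi (assoc K C C R (pure K CC R (pure K C C c1 c2) x)) = pure K C RC c1 (cross c2 x)"
      using c x by (simp add: assoc_pure[OF C_vs C_vs R_vs] tmap_pure[OF lin_id[OF C_vs] Psi_lin']
          pure_closed cross_def)
    then show "?r1 (pure K CC R (pure K C C c1 c2) x) = tlift RCC (cross2 x) (pure K C C c1 c2)"
      using c x by (simp add: s tlift_pure[OF cross2_bilin]) (simp add: cross2_def)
  qed
  have rp: "?r (pure K C R c x) = tlift RCC (cross2 x) (Delta c)" if "c \<in> carrier C" "x \<in> carrier R" for c x
    using that by (simp add: tmap_pure[OF Delta_lin lin_id[OF R_vs]] r1p)
  show ?thesis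
  proof (intro iffI ballI)
    assume a: "\<forall>t\<in>carrier ?CR. ?l t = ?r t"
    show "comult_law x" if x: "x \<in> carrier R" for x
      unfolding comult_law_def
    proof
      fix c assume c: "c \<in> carrier C"
      show "tmap K R CC (\<lambda>x. x) Delta (cross c x) = tlift RCC (cross2 x) (Delta c)"
        using a[rule_format, OF pure_closed[OF C_vs R_vs c x]] rp[OF c x] by (simp add: cross_def)
    qed
  next
    assume a: "\<forall>x\<in>carrier R. comult_law x"
    show "?l t = ?r t" if t: "t \<in> carrier ?CR" for t
      by (rule tensor_eqI[OF C_vs R_vs l r _ t], subst rp)
        (use a in \<open>auto simp: comult_law_def cross_def\<close>)
  qed
qed

lemma act2_shuffle_mult:
  assumes x: "x \<in> carrier R" "mult_law x" and y: "y \<in> carrier R" and c: "c \<in> carrier C" and f: "f \<in> carrier C"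
  shows "shuffle c (x \<otimes>\<^bsub>R\<^esub> y) f = tlift RCC (\<lambda>x' c'. act2 x' (shuffle c' y f)) (cross c x)"
proof -
  note B = pair_bilin[OF f]
  have i: "tlift RCC (\<lambda>x c. pure K R CC x (pure K C C c f)) (act x' (cross c' y)) = act2 x' (shuffle c' y f)"
    if x': "x' \<in> carrier R" and c': "c' \<in> carrier C" for x' c'
  proof -
    have "tlift RCC (\<lambda>x c. pure K R CC x (pure K C C c f)) (act x' t)
      = act2 x' (tlift RCC (\<lambda>x c. pure K R CC x (pure K C C c f)) t)" if t: "t \<in> carrier RC" for t
      by (rule tensor_eqI[OF R_vs C_vs lin_comp[OF tlift_lin[OF B] act_lin[OF x']]
            lin_comp[OF act2_lin[OF x'] tlift_lin[OF B]] _ t])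
        (use x' f in \<open>simp add: act_pure tlift_pure[OF B] act2_pure pure_closed\<close>)
    then show ?thesis using c' y by (simp add: shuffle_def)
  qed
  have "shuffle c (x \<otimes>\<^bsub>R\<^esub> y) f = tlift RCC (\<lambda>x c. pure K R CC x (pure K C C c f))
      (tlift RC (\<lambda>x' c'. act x' (cross c' y)) (cross c x))"
    unfolding shuffle_def using mult_lawD[OF x(2) c y] by simp
  also have "\<dots> = tlift RCC (\<lambda>x' c'. tlift RCC (\<lambda>x c. pure K R CC x (pure K C C c f)) (act x' (cross c' y))) (cross c x)"
    by (rule tlift_fusion[OF tlift_lin[OF B] act_cross_bilin[OF y] cross_closed[OF c x(1)]])
  also have "\<dots> = tlift RCC (\<lambda>x' c'. act2 x' (shuffle c' y f)) (cross c x)"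
    by (rule tlift_cong[OF cross_closed[OF c x(1)]])
      (use y f in \<open>auto simp: i intro!: bilinI lin_comp[OF act2_lin shuffle_lin1] act2_lin1\<close>)
  finally show ?thesis .
qed

text \<open>
  Comultiplying after moving \<open>c\<close> past \<open>x\<close> and \<open>y\<close> gives, by the law for \<open>y\<close> and then for \<open>x\<close>, the
  result of comultiplying first and moving both \<open>c\<^sub>1\<close> and \<open>c\<^sub>2\<close> past \<open>x\<close> and then both past \<open>y\<close>. Here
  \<open>c\<^sub>1\<close> crosses \<open>x\<close> before \<open>c\<^sub>2\<close> crosses \<open>y\<close>, whereas moving them past \<open>x y\<close> one after the other has
  \<open>c\<^sub>2\<close> cross \<open>y\<close> first. These two crossings involve disjoint tensor factors, so they can be exchanged;
  this is \<open>key\<close> in the proof.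
\<close>

lemma comult_law_mult:
  assumes mult: "\<forall>x\<in>carrier R. mult_law x" and x: "x \<in> carrier R" "comult_law x"
    and y: "y \<in> carrier R" "comult_law y"
  shows "comult_law (x \<otimes>\<^bsub>R\<^esub> y)"
  unfolding comult_law_def
proof (intro ballI)
  fix c assume c: "c \<in> carrier C"
  define G where "G x' u = act2 x' (tlift RCC (cross2 y) u)" for x' u
  have G: "bilin R CC RCC G"
    unfolding G_def[abs_def]
    by (intro bilinI R_vs CC_vs RCC_vs lin_comp[OF act2_lin tlift_lin[OF cross2_bilin[OF y(1)]]] act2_lin1
        lin_closed[OF tlift_lin[OF cross2_bilin[OF y(1)]]])
  have da: "tmap K R CC (\<lambda>x. x) Delta (act x' t) = act2 x' (tmap K R CC (\<lambda>x. x) Delta t)"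
    if x': "x' \<in> carrier R" and t: "t \<in> carrier RC" for x' t
    unfolding act_def act2_def
    by (simp add: tmap_comp[OF bilinD(4)[OF R_bilin x'] lin_id[OF C_vs] lin_id[OF R_vs] Delta_lin t]
        tmap_comp[OF lin_id[OF R_vs] Delta_lin bilinD(4)[OF R_bilin x'] lin_id[OF CC_vs] t])
  have key: "tlift RCC G (cross2 x c1 c2) = cross2 (x \<otimes>\<^bsub>R\<^esub> y) c1 c2"
    if c1: "c1 \<in> carrier C" and c2: "c2 \<in> carrier C" for c1 c2
  proof -
    have g1: "tlift RCC G (shuffle c1 x' e2) = tlift RCC (\<lambda>x'' e1. act2 x'' (cross2 y e1 e2)) (cross c1 x')"
      if x': "x' \<in> carrier R" and e2: "e2 \<in> carrier C" for x' e2
    proof -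
      have gp: "tlift RCC G (pure K R CC x'' (pure K C C e1 e2)) = act2 x'' (cross2 y e1 e2)"
        if "x'' \<in> carrier R" "e1 \<in> carrier C" for x'' e1
        using that e2 y(1) tlift_pure[OF cross2_bilin[OF y(1)], of e1 e2]
        by (simp add: tlift_pure[OF G] pure_closed) (simp add: G_def)
      have "tlift RCC G (shuffle c1 x' e2)
        = tlift RCC (\<lambda>x'' e1. tlift RCC G (pure K R CC x'' (pure K C C e1 e2))) (cross c1 x')"
        unfolding shuffle_def
        by (rule tlift_fusion[OF tlift_lin[OF G] pair_bilin[OF e2] cross_closed[OF c1 x']])
      also have "\<dots> = tlift RCC (\<lambda>x'' e1. act2 x'' (cross2 y e1 e2)) (cross c1 x')"
        by (rule tlift_cong[OF cross_closed[OF c1 x']])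
          (use e2 y in \<open>auto simp: gp
            intro!: bilinI lin_comp[OF act2_lin bilinD(5)[OF cross2_bilin]] act2_lin1\<close>)
      finally show ?thesis .
    qed
    have g2: "tlift RCC (\<lambda>x'' e1. act2 x'' (cross2 y e1 e2)) (cross c1 x')
        = tlift RCC (\<lambda>y' f. shuffle c1 (x' \<otimes>\<^bsub>R\<^esub> y') f) (cross e2 y)"
      if x': "x' \<in> carrier R" and e2: "e2 \<in> carrier C" for x' e2
    proof -
      have b: "bilin R C RCC (\<lambda>y' f. act2 x'' (shuffle e1 y' f))" if "x'' \<in> carrier R" "e1 \<in> carrier C" for x'' e1
        using that by (intro bilinI R_vs C_vs RCC_vs lin_comp[OF act2_lin shuffle_lin2] lin_comp[OF act2_lin shuffle_lin3])
      have b': "bilin R C RCC (\<lambda>x'' e1. act2 x'' (shuffle e1 y' f))" if "y' \<in> carrier R" "f \<in> carrier C" for y' f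
        using that by (intro bilinI R_vs C_vs RCC_vs lin_comp[OF act2_lin shuffle_lin1] act2_lin1) auto
      have "tlift RCC (\<lambda>x'' e1. act2 x'' (cross2 y e1 e2)) (cross c1 x')
        = tlift RCC (\<lambda>x'' e1. tlift RCC (\<lambda>y' f. act2 x'' (shuffle e1 y' f)) (cross e2 y)) (cross c1 x')"
      proof (rule tlift_cong[OF cross_closed[OF c1 x']])
        show "bilin R C RCC (\<lambda>x'' e1. tlift RCC (\<lambda>y' f. act2 x'' (shuffle e1 y' f)) (cross e2 y))"
          using e2 y by (intro bilinI R_vs C_vs RCC_vs lin_tlift_fun[OF cross_closed[OF e2 y(1)]] b
              lin_comp[OF act2_lin shuffle_lin1] act2_lin1) auto
        show "act2 x'' (cross2 y e1 e2) = tlift RCC (\<lambda>y' f. act2 x'' (shuffle e1 y' f)) (cross e2 y)"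
          if "x'' \<in> carrier R" "e1 \<in> carrier C" for x'' e1
          unfolding cross2_def
          by (rule tlift_fusion[OF act2_lin[OF that(1)] shuffle_bilin[OF that(2)] cross_closed[OF e2 y(1)]])
      qed
      also have "\<dots> = tlift RCC (\<lambda>y' f. tlift RCC (\<lambda>x'' e1. act2 x'' (shuffle e1 y' f)) (cross c1 x')) (cross e2 y)"
        by (rule tlift_swap[OF cross_closed[OF c1 x'] cross_closed[OF e2 y(1)] R_vs C_vs R_vs C_vs RCC_vs b b'])
      also have "\<dots> = tlift RCC (\<lambda>y' f. shuffle c1 (x' \<otimes>\<^bsub>R\<^esub> y') f) (cross e2 y)"
        by (rule tlift_cong[OF cross_closed[OF e2 y(1)]])
          (use x' c1 mult in \<open>auto simp: act2_shuffle_mult intro!: bilinI lin_comp[OF shuffle_lin2 bilinD(4)[OF R_bilin]]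
            shuffle_lin3\<close>)
      finally show ?thesis .
    qed
    have bg: "bilin R C RCC (\<lambda>x' e2. tlift RCC (\<lambda>y' f. shuffle c1 (x' \<otimes>\<^bsub>R\<^esub> y') f) (cross e2 y))"
    proof -
      have b: "bilin R C RCC (\<lambda>y' f. shuffle c1 (x' \<otimes>\<^bsub>R\<^esub> y') f)" if "x' \<in> carrier R" for x'
        using that c1 by (intro bilinI lin_comp[OF shuffle_lin2 bilinD(4)[OF R_bilin]] shuffle_lin3 R_vs C_vs RCC_vs) auto
      show ?thesis using y c1
        by (intro bilinI lin_tlift_arg[OF cross_lin1 b] lin_tlift_fun[OF cross_closed] b
            lin_comp[OF shuffle_lin2 bilinD(5)[OF R_bilin]] R_vs C_vs RCC_vs) auto
    qed
    have "tlift RCC G (cross2 x c1 c2) = tlift RCC (\<lambda>x' e2. tlift RCC G (shuffle c1 x' e2)) (cross c2 x)"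
      unfolding cross2_def by (rule tlift_fusion[OF tlift_lin[OF G] shuffle_bilin[OF c1] cross_closed[OF c2 x(1)]])
    also have "\<dots> = tlift RCC (\<lambda>x' e2. tlift RCC (\<lambda>y' f. shuffle c1 (x' \<otimes>\<^bsub>R\<^esub> y') f) (cross e2 y)) (cross c2 x)"
      by (rule tlift_cong[OF cross_closed[OF c2 x(1)] bg]) (simp add: g1 g2)
    also have "\<dots> = tlift RCC (\<lambda>x' e2. tlift RCC (\<lambda>z f. shuffle c1 z f) (act x' (cross e2 y))) (cross c2 x)"
    proof (rule tlift_cong[OF cross_closed[OF c2 x(1)] bg, symmetric])
      show "tlift RCC (\<lambda>z f. shuffle c1 z f) (act x' (cross e2 y))
        = tlift RCC (\<lambda>y' f. shuffle c1 (x' \<otimes>\<^bsub>R\<^esub> y') f) (cross e2 y)"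
        if "x' \<in> carrier R" "e2 \<in> carrier C" for x' e2
        unfolding act_def
        by (rule tlift_tmap[OF bilinD(4)[OF R_bilin that(1)] lin_id[OF C_vs] shuffle_bilin[OF c1]
              cross_closed[OF that(2) y(1)]])
    qed
    also have "\<dots> = tlift RCC (\<lambda>z f. shuffle c1 z f) (tlift RC (\<lambda>x' e2. act x' (cross e2 y)) (cross c2 x))"
      by (rule tlift_fusion[OF tlift_lin[OF shuffle_bilin[OF c1]] act_cross_bilin[OF y(1)] cross_closed[OF c2 x(1)], symmetric])
    also have "\<dots> = cross2 (x \<otimes>\<^bsub>R\<^esub> y) c1 c2"
      unfolding cross2_def using mult x(1) mult_lawD[OF _ c2 y(1), of x] by simp
    finally show ?thesis .
  qed
  have "tmap K R CC (\<lambda>x. x) Delta (cross c (x \<otimes>\<^bsub>R\<^esub> y))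
    = tmap K R CC (\<lambda>x. x) Delta (tlift RC (\<lambda>x' c'. act x' (cross c' y)) (cross c x))"
    using mult x(1) mult_lawD[OF _ c y(1), of x] by simp
  also have "\<dots> = tlift RCC (\<lambda>x' c'. tmap K R CC (\<lambda>x. x) Delta (act x' (cross c' y))) (cross c x)"
    by (rule tlift_fusion[OF tmap_lin[OF lin_id[OF R_vs] Delta_lin] act_cross_bilin[OF y(1)] cross_closed[OF c x(1)]])
  also have "\<dots> = tlift RCC (\<lambda>x' c'. G x' (Delta c')) (cross c x)"
  proof (rule tlift_cong[OF cross_closed[OF c x(1)]])
    show "bilin R C RCC (\<lambda>x' c'. G x' (Delta c'))"
      by (intro bilinI R_vs C_vs RCC_vs lin_comp[OF bilinD(4)[OF G] Delta_lin] bilinD(5)[OF G] Delta_closed)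
    show "tmap K R CC (\<lambda>x. x) Delta (act x' (cross c' y)) = G x' (Delta c')"
      if "x' \<in> carrier R" "c' \<in> carrier C" for x' c'
      using da[OF that(1) cross_closed[OF that(2) y(1)]] comult_lawD[OF y(2) that(2)] by (simp add: G_def)
  qed
  also have "\<dots> = tlift RCC G (tmap K R CC (\<lambda>x. x) Delta (cross c x))"
    by (rule tlift_tmap[OF lin_id[OF R_vs] Delta_lin G cross_closed[OF c x(1)], symmetric])
  also have "\<dots> = tlift RCC G (tlift RCC (cross2 x) (Delta c))"
    using comult_lawD[OF x(2) c] by simp
  also have "\<dots> = tlift RCC (\<lambda>c1 c2. tlift RCC G (cross2 x c1 c2)) (Delta c)"
    by (rule tlift_fusion[OF tlift_lin[OF G] cross2_bilin[OF x(1)] Delta_closed[OF c]])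
  also have "\<dots> = tlift RCC (cross2 (x \<otimes>\<^bsub>R\<^esub> y)) (Delta c)"
    by (rule tlift_cong[OF Delta_closed[OF c] cross2_bilin]) (use x y key in auto)
  finally show "tmap K R CC (\<lambda>x. x) Delta (cross c (x \<otimes>\<^bsub>R\<^esub> y)) = tlift RCC (cross2 (x \<otimes>\<^bsub>R\<^esub> y)) (Delta c)" .
qed

lemma entwiningI:
  assumes "field K" "\<And>x. x \<in> carrier R \<Longrightarrow> mult_law x" "\<And>x. x \<in> carrier R \<Longrightarrow> comult_law x"
    "\<And>x. x \<in> carrier R \<Longrightarrow> counit_law x"
  shows "nonunital_entwining K R C Delta eps Psi"
  by (intro nonunital_entwining.intro nonunital_entwining_axioms.intro R_alg C_coalg Psi_lin
      mult_axiom_iff[THEN iffD2, rule_format] comult_axiom_iff[THEN iffD2, rule_format]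
      counit_axiom_iff[THEN iffD2, rule_format] assms)

end

text \<open>
  The comultiplication and counit laws involve one algebra element only. So they are transported by
  any linear map through which coalgebra elements pass unchanged; a differential is such a map.
\<close>

locale entwining_morphism =
  src: entwining_data K R C Delta eps Psi + tgt: entwining_data K R' C Delta eps Psi'
  for K :: "'k ring" and R :: "('k, 'r) module" and C :: "('k, 'c) module" and Delta eps Psi
    and R' :: "('k, 's) module" and Psi' +
  fixes f :: "'r \<Rightarrow> 's"
  assumes f_lin: "src.lin R R' f"
    and f_cross: "c \<in> carrier C \<Longrightarrow> x \<in> carrier R \<Longrightarrow>
      tgt.cross c (f x) = tmap K R' C f (\<lambda>c. c) (src.cross c x)"
begin

lemma f_closed [simp]: "x \<in> carrier R \<Longrightarrow> f x \<in> carrier R'"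
  by (rule src.lin_closed[OF f_lin])

lemma counit_law_image:
  assumes x: "x \<in> carrier R" "src.counit_law x" shows "tgt.counit_law (f x)"
  unfolding tgt.counit_law_def
proof
  fix c assume c: "c \<in> carrier C"
  have "src.tlift R' (\<lambda>x' c'. eps c' \<odot>\<^bsub>R'\<^esub> x') (tgt.cross c (f x))
    = src.tlift R' (\<lambda>x' c'. eps c' \<odot>\<^bsub>R'\<^esub> f x') (src.cross c x)"
    unfolding f_cross[OF c x(1)]
    by (rule src.tlift_tmap[OF f_lin src.lin_id[OF src.C_vs] tgt.eps_bilin src.cross_closed[OF c x(1)]])
  also have "\<dots> = src.tlift R' (\<lambda>x' c'. f (eps c' \<odot>\<^bsub>R\<^esub> x')) (src.cross c x)"
    by (rule src.tlift_cong[OF src.cross_closed[OF c x(1)]])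
      (auto simp: src.lin_smult[OF f_lin] intro!: src.bilinI src.lin_comp[OF f_lin] src.bilinD(4,5)[OF src.eps_bilin])
  also have "\<dots> = f (src.tlift R (\<lambda>x' c'. eps c' \<odot>\<^bsub>R\<^esub> x') (src.cross c x))"
    by (rule src.tlift_fusion[OF f_lin src.eps_bilin src.cross_closed[OF c x(1)], symmetric])
  also have "\<dots> = eps c \<odot>\<^bsub>R'\<^esub> f x"
    using src.counit_lawD[OF x(2) c] c x by (simp add: src.lin_smult[OF f_lin])
  finally show "src.tlift R' (\<lambda>x' c'. eps c' \<odot>\<^bsub>R'\<^esub> x') (tgt.cross c (f x)) = eps c \<odot>\<^bsub>R'\<^esub> f x" .
qed

abbreviation f2 where "f2 \<equiv> tmap K R' src.CC f (\<lambda>u. u)"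

lemma f2_lin: "src.lin src.RCC tgt.RCC f2"
  by (rule src.tmap_lin[OF f_lin src.lin_id[OF src.CC_vs]])

lemma shuffle_image:
  assumes c: "c \<in> carrier C" and x: "x \<in> carrier R" and e: "e \<in> carrier C"
  shows "tgt.shuffle c (f x) e = f2 (src.shuffle c x e)"
proof -
  have "tgt.shuffle c (f x) e
    = src.tlift tgt.RCC (\<lambda>x' c'. pure K R' src.CC (f x') (pure K C C c' e)) (src.cross c x)"
    unfolding tgt.shuffle_def f_cross[OF c x]
    by (rule src.tlift_tmap[OF f_lin src.lin_id[OF src.C_vs] tgt.pair_bilin[OF e] src.cross_closed[OF c x]])
  also have "\<dots> = src.tlift tgt.RCC (\<lambda>x' c'. f2 (pure K R src.CC x' (pure K C C c' e))) (src.cross c x)"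
    by (rule src.tlift_cong[OF src.cross_closed[OF c x]])
      (use e in \<open>auto simp: src.tmap_pure[OF f_lin src.lin_id] src.pure_closed
        intro!: src.bilinI src.lin_comp[OF f2_lin] src.bilinD(4,5)[OF src.pair_bilin]\<close>)
  also have "\<dots> = f2 (src.shuffle c x e)"
    unfolding src.shuffle_def
    by (rule src.tlift_fusion[OF f2_lin src.pair_bilin[OF e] src.cross_closed[OF c x], symmetric])
  finally show ?thesis .
qed

lemma cross2_image:
  assumes c: "c1 \<in> carrier C" "c2 \<in> carrier C" and x: "x \<in> carrier R"
  shows "tgt.cross2 (f x) c1 c2 = f2 (src.cross2 x c1 c2)"
proof -
  have "tgt.cross2 (f x) c1 c2 = src.tlift tgt.RCC (\<lambda>x' e. tgt.shuffle c1 (f x') e) (src.cross c2 x)"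
    unfolding tgt.cross2_def f_cross[OF c(2) x]
    by (rule src.tlift_tmap[OF f_lin src.lin_id[OF src.C_vs] tgt.shuffle_bilin[OF c(1)] src.cross_closed[OF c(2) x]])
  also have "\<dots> = src.tlift tgt.RCC (\<lambda>x' e. f2 (src.shuffle c1 x' e)) (src.cross c2 x)"
    by (rule src.tlift_cong[OF src.cross_closed[OF c(2) x]])
      (use c in \<open>auto simp: shuffle_image intro!: src.bilinI src.lin_comp[OF f2_lin] src.shuffle_lin2 src.shuffle_lin3\<close>)
  also have "\<dots> = f2 (src.cross2 x c1 c2)"
    unfolding src.cross2_def
    by (rule src.tlift_fusion[OF f2_lin src.shuffle_bilin[OF c(1)] src.cross_closed[OF c(2) x], symmetric])
  finally show ?thesis .
qed

lemma comult_law_image: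
  assumes x: "x \<in> carrier R" "src.comult_law x" shows "tgt.comult_law (f x)"
  unfolding tgt.comult_law_def
proof
  fix c assume c: "c \<in> carrier C"
  note t = src.cross_closed[OF c x(1)]
  have "tmap K R' src.CC (\<lambda>x. x) Delta (tgt.cross c (f x)) = f2 (tmap K R src.CC (\<lambda>x. x) Delta (src.cross c x))"
    unfolding f_cross[OF c x(1)]
    by (simp add: src.tmap_comp[OF f_lin src.lin_id[OF src.C_vs] src.lin_id[OF tgt.R_vs] src.Delta_lin t]
        src.tmap_comp[OF src.lin_id[OF src.R_vs] src.Delta_lin f_lin src.lin_id[OF src.CC_vs] t])
  also have "\<dots> = f2 (src.tlift src.RCC (src.cross2 x) (Delta c))"
    using src.comult_lawD[OF x(2) c] by simp
  also have "\<dots> = src.tlift tgt.RCC (\<lambda>c1 c2. f2 (src.cross2 x c1 c2)) (Delta c)"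
    by (rule src.tlift_fusion[OF f2_lin src.cross2_bilin[OF x(1)] src.Delta_closed[OF c]])
  also have "\<dots> = src.tlift tgt.RCC (tgt.cross2 (f x)) (Delta c)"
    by (rule src.tlift_cong[OF src.Delta_closed[OF c] tgt.cross2_bilin]) (use x cross2_image in auto)
  finally show "tmap K R' src.CC (\<lambda>x. x) Delta (tgt.cross c (f x)) = src.tlift tgt.RCC (tgt.cross2 (f x)) (Delta c)" .
qed

end

context scalars begin

section \<open>Iterated entwining maps\<close>

lemma mlin_tlift_fun:
  assumes t: "t \<in> carrier (tensor K M N)" and V: "vs L" "vs M" "vs N" "vs P"
    and a: "\<And>a b. a \<in> carrier M \<Longrightarrow> b \<in> carrier N \<Longrightarrow> mlin L n P (\<lambda>as. \<beta> as a b)"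
    and b: "\<And>as. as \<in> words L n \<Longrightarrow> bilin M N P (\<beta> as)"
  shows "mlin L n P (\<lambda>as. tlift P (\<beta> as) t)"
proof (rule mlinI[OF V(1,4)])
  show "tlift P (\<beta> as) t \<in> carrier P" if "as \<in> words L n" for as
    by (rule lin_closed[OF tlift_lin[OF b[OF that]] t])
  fix xs zs assume xz: "set xs \<subseteq> carrier L" "set zs \<subseteq> carrier L" "length xs + length zs + 1 = n"
  show "lin L P (\<lambda>y. tlift P (\<beta> (xs @ y # zs)) t)"
    by (rule lin_tlift_fun[OF t V mlinD(4)[OF a xz] b]) (use xz in \<open>auto simp: words_def\<close>)
qed

lemma mlin_add_fun: "mlin M n P f \<Longrightarrow> mlin M n P g \<Longrightarrow> mlin M n P (\<lambda>xs. f xs \<oplus>\<^bsub>P\<^esub> g xs)"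
  by (rule mlinI) (auto intro!: vs_add lin_add_fun intro: mlinD)

lemma tcons_facts:
  assumes M: "vs M"
  shows tcons_bilin: "bilin M (tpow K M n) (tpow K M (Suc n)) (tcons K M n)"
    and tcons_word: "\<And>x xs. x \<in> carrier M \<Longrightarrow> xs \<in> words M n \<Longrightarrow>
      tcons K M n x (tword K M xs) = tword K M (x # xs)"
proof -
  have m: "mlin M n (tpow K M (Suc n)) (\<lambda>xs. tword K M (x # xs))" if "x \<in> carrier M" for x
    by (rule mlin_ConsD[OF tword_mlin[OF M] that])
  have l: "lin M (tpow K M (Suc n)) (\<lambda>x. tword K M (x # xs))" if "xs \<in> words M n" for xs
    using mlinD(4)[OF tword_mlin[OF M], of "[]" xs "Suc n"] that by (simp add: words_def)
  show "bilin M (tpow K M n) (tpow K M (Suc n)) (tcons K M n)"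
    unfolding tcons_def[abs_def]
    by (intro bilinI M tpow_vs mlift_lin m lin_mlift_fun l) (auto intro: M m)
  show "tcons K M n x (tword K M xs) = tword K M (x # xs)" if "x \<in> carrier M" "xs \<in> words M n" for x xs
    unfolding tcons_def by (rule mlift_word[OF m[OF that(1)] that(2)])
qed

end

locale entwined_forms = universal_forms K A + src: entwining_data K A C Delta eps psi
  for K :: "'k ring" and A :: "('k, 'a) module" and C :: "('k, 'c) module" and Delta eps psi
begin

abbreviation iter where "iter \<equiv> psi_iter K A C psi"
abbreviation OmC where "OmC \<equiv> tensor K Om C"

lemma C_vs [simp]: "vs C" by (rule src.C_vs)
lemma OmC_vs [simp]: "vs OmC" by (intro tensor_vs) auto
lemma AC_vs [simp]: "vs (tensor K (tpow K A n) C)" by (intro tensor_vs tpow_vs) auto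

lemma iter_step_bilin:
  assumes "lin C (tensor K (tpow K A n) C) (iter as)"
  shows "bilin A C (tensor K (tpow K A (Suc n)) C)
    (\<lambda>a' c'. tmap K (tpow K A (Suc n)) C (tcons K A n a') (\<lambda>x. x) (iter as c'))"
  using assms
  by (intro bilinI A_vs C_vs AC_vs lin_comp[OF tmap_lin[OF bilinD(4)[OF tcons_bilin] lin_id] assms]
      bilinD(5)[OF tmap_family_bilin[OF tcons_bilin]] lin_closed[OF assms])

lemma iter_Cons:
  "as \<in> words A n \<Longrightarrow> iter (a # as) c = tlift (tensor K (tpow K A (Suc n)) C)
    (\<lambda>a' c'. tmap K (tpow K A (Suc n)) C (tcons K A n a') (\<lambda>x. x) (iter as c')) (src.cross c a)"
  by (auto simp: words_def Let_def src.cross_def)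

text \<open>
  Linearity in the coalgebra element and multilinearity in the word need each other in the
  recursion, since the element moved past the head enters the iteration over the tail.
\<close>

lemma iter_multilinear:
  "(\<forall>c\<in>carrier C. mlin A n (tensor K (tpow K A n) C) (\<lambda>as. iter as c)) \<and>
   (\<forall>as\<in>words A n. lin C (tensor K (tpow K A n) C) (iter as))"
proof (induction n)
  case 0
  have l: "lin C (tensor K (tpow K A 0) C) (iter [])"
    unfolding psi_iter.simps by (intro lin_pure2 lin_id C_vs tpow_vs A_vs tword_closed) (simp add: words_def)
  then show ?case using lin_closed[OF l] by (auto simp: words_def simp del: psi_iter.simps intro!: mlin_0)
next
  case (Suc n)
  let ?T = "tensor K (tpow K A (Suc n)) C"
  let ?b = "\<lambda>as a' c'. tmap K (tpow K A (Suc n)) C (tcons K A n a') (\<lambda>x. x) (iter as c')"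
  have b: "bilin A C ?T (?b as)" if "as \<in> words A n" for as
    by (rule iter_step_bilin) (use Suc that in blast)
  have m: "mlin A n ?T (\<lambda>as. ?b as a' c')" if "a' \<in> carrier A" "c' \<in> carrier C" for a' c'
    using Suc that by (intro mlin_comp[OF tmap_lin[OF bilinD(4)[OF tcons_bilin] lin_id]] A_vs C_vs) auto
  have "lin C ?T (iter as)" if as: "as \<in> words A (Suc n)" for as
  proof -
    obtain a bs where as': "as = a # bs" "a \<in> carrier A" "bs \<in> words A n"
      using as by (cases as) (auto simp: words_def)
    show ?thesis
      unfolding as'(1)
      by (rule lin_cong[OF lin_tlift_arg[OF src.cross_lin1[OF as'(2)] b[OF as'(3)]]])
        (rule iter_Cons[OF as'(3), symmetric])
  qed
  moreover have "mlin A (Suc n) ?T (\<lambda>as. iter as c)" if c: "c \<in> carrier C" for c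
  proof (rule mlin_Cons[OF A_vs AC_vs])
    fix a assume a: "a \<in> carrier A"
    show "mlin A n ?T (\<lambda>as. iter (a # as) c)"
      by (rule mlin_cong[OF mlin_tlift_fun[OF src.cross_closed[OF c a] A_vs A_vs C_vs AC_vs m b] iter_Cons])
  next
    fix as assume as: "as \<in> words A n"
    show "lin A ?T (\<lambda>a. iter (a # as) c)"
      unfolding iter_Cons[OF as] by (rule lin_tlift_arg[OF src.cross_lin[OF c] b[OF as]])
  qed
  ultimately show ?case by blast
qed

lemma iter_mlin: "c \<in> carrier C \<Longrightarrow> mlin A n (tensor K (tpow K A n) C) (\<lambda>as. iter as c)"
  and iter_lin: "as \<in> words A n \<Longrightarrow> lin C (tensor K (tpow K A n) C) (iter as)"
  using iter_multilinear by blast+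

lemma iter_closed: "c \<in> carrier C \<Longrightarrow> as \<in> words A n \<Longrightarrow> iter as c \<in> carrier (tensor K (tpow K A n) C)"
  by (rule lin_closed[OF iter_lin])

lemma iter_lin_hd: "c \<in> carrier C \<Longrightarrow> as \<in> words A n \<Longrightarrow>
    lin A (tensor K (tpow K A (Suc n)) C) (\<lambda>a. iter (a # as) c)"
  using mlinD(4)[OF iter_mlin, of c "[]" as "Suc n"] by (simp add: words_def del: psi_iter.simps)

text \<open>
  The linear map \<open>b\<^sub>0 \<otimes> b\<^sub>1 \<otimes> \<dots> \<otimes> b\<^sub>n \<mapsto> b\<^sub>0 db\<^sub>1 \<dots> db\<^sub>n\<close>.
\<close>

definition word_form where
  "word_form n = lift K Om (\<lambda>bs. incl n (form K A (hd bs, \<zero>\<^bsub>K\<^esub>) (tl bs)))"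

text \<open>
  The linear map \<open>b\<^sub>1 \<otimes> \<dots> \<otimes> b\<^sub>n \<mapsto> db\<^sub>1 \<dots> db\<^sub>n\<close>; it is \<open>0\<close> for \<open>n = 0\<close>.
\<close>

definition word_dform where
  "word_dform n = lift K Om (\<lambda>bs. incl n (form K A unit_U bs))"

lemma word_form_mlin: "mlin A (Suc n) Om (\<lambda>bs. incl n (form K A (hd bs, \<zero>\<^bsub>K\<^esub>) (tl bs)))"
proof (rule mlin_Cons[OF A_vs Om_vs])
  show "mlin A n Om (\<lambda>bs. incl n (form K A (hd (b # bs), \<zero>\<^bsub>K\<^esub>) (tl (b # bs))))" if "b \<in> carrier A" for b
    by (rule mlin_cong[OF wmlD(1)[OF wform_wml, of "(b, \<zero>\<^bsub>K\<^esub>)"]]) (use that in \<open>auto simp: wform_def words_def\<close>)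
  show "lin A Om (\<lambda>b. incl n (form K A (hd (b # bs), \<zero>\<^bsub>K\<^esub>) (tl (b # bs))))" if "bs \<in> words A n" for bs
    using lin_comp[OF lin_wform lin_inl, of bs] that by (simp add: wform_def words_def)
qed

lemma word_dform_mlin: "mlin A n Om (\<lambda>bs. incl n (form K A unit_U bs))"
  by (rule mlin_cong[OF wmlD(1)[OF wform_wml, of unit_U]]) (auto simp: wform_def words_def)

lemma word_form_lin: "lin (tpow K A (Suc n)) Om (word_form n)"
  unfolding word_form_def by (rule mlift_lin[OF word_form_mlin])

lemma word_dform_lin: "lin (tpow K A n) Om (word_dform n)"
  unfolding word_dform_def by (rule mlift_lin[OF word_dform_mlin])

lemma word_form_word: "b \<in> carrier A \<Longrightarrow> bs \<in> words A n \<Longrightarrow> word_form n (tword K A (b # bs)) = wform (b, \<zero>\<^bsub>K\<^esub>) bs"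
  unfolding word_form_def by (subst mlift_word[OF word_form_mlin]) (auto simp: words_def wform_def)

lemma word_dform_word: "bs \<in> words A n \<Longrightarrow> word_dform n (tword K A bs) = wform unit_U bs"
  unfolding word_dform_def by (subst mlift_word[OF word_dform_mlin]) (auto simp: words_def wform_def)

abbreviation hat0 where "hat0 n t \<equiv> tmap K Om C (word_form n) (\<lambda>x. x) t"
abbreviation hat1 where "hat1 n t \<equiv> tmap K Om C (word_dform n) (\<lambda>x. x) t"

lemma hat0_lin: "lin (tensor K (tpow K A (Suc n)) C) OmC (\<lambda>t. hat0 n t)"
  by (rule tmap_lin[OF word_form_lin lin_id[OF C_vs]])

lemma hat1_lin: "lin (tensor K (tpow K A n) C) OmC (\<lambda>t. hat1 n t)"
  by (rule tmap_lin[OF word_dform_lin lin_id[OF C_vs]])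

abbreviation hform where "hform \<equiv> psi_hat_form K A C psi"

text \<open>
  The two parts of \<open>\<psi>\<close>-hat: the coefficient \<open>a\<^sub>0\<close> takes part in the iteration, the scalar \<open>\<mu>\<close> does not.
\<close>

lemma hform_eq:
  "as \<in> words A n \<Longrightarrow> hform c p as = hat0 n (iter (fst p # as) c) \<oplus>\<^bsub>OmC\<^esub> snd p \<odot>\<^bsub>OmC\<^esub> hat1 n (iter as c)"
  by (auto simp: psi_hat_form_def Let_def case_prod_beta word_form_def word_dform_def words_def
      simp del: psi_iter.simps)

lemma hform_wml:
  assumes c: "c \<in> carrier C" shows "wml n OmC (hform c)"
proof (rule wml_cong[OF wmlI hform_eq])
  show "mlin A n OmC (\<lambda>as. hat0 n (iter (fst p # as) c) \<oplus>\<^bsub>OmC\<^esub> snd p \<odot>\<^bsub>OmC\<^esub> hat1 n (iter as c))"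
    if p: "p \<in> carrier U" for p
    by (intro mlin_add_fun mlin_comp[OF hat0_lin mlin_ConsD[OF iter_mlin[OF c] fst_mem[OF p]]]
        mlin_comp[OF lin_smult_fun[OF snd_mem[OF p] hat1_lin] iter_mlin[OF c]])
  show "lin U OmC (\<lambda>p. hat0 n (iter (fst p # as) c) \<oplus>\<^bsub>OmC\<^esub> snd p \<odot>\<^bsub>OmC\<^esub> hat1 n (iter as c))"
    if as: "as \<in> words A n" for as
    by (intro lin_add_fun lin_comp[OF hat0_lin lin_comp[OF iter_lin_hd[OF c as] lin_fst]]
        lin_scale[OF lin_snd OmC_vs] lin_closed[OF hat1_lin] iter_closed c as)
qed

lemma hform_lin:
  assumes as: "as \<in> words A n" and p: "p \<in> carrier U" shows "lin C OmC (\<lambda>c. hform c p as)"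
proof -
  have "fst p # as \<in> words A (Suc n)" using as p by (auto simp: words_def)
  then show ?thesis
    unfolding hform_eq[OF as]
    by (intro lin_add_fun lin_comp[OF hat0_lin iter_lin] lin_smult_fun[OF snd_mem[OF p]]
        lin_comp[OF hat1_lin iter_lin[OF as]])
qed

lemma psi_hat_eq: "psi_hat K A C psi = lift K OmC (\<lambda>(c, x). wlift OmC (hform c) x)"
  by (simp add: psi_hat_def wlift_def Let_def)

lemma psi_hat_bilin: "bilin C Om OmC (\<lambda>c x. wlift OmC (hform c) x)"
  by (intro bilinI C_vs Om_vs OmC_vs wlift_lin hform_wml lin_wlift_fun hform_lin[where n = "length _"])
    (auto simp: valid_def words_def)

lemma psi_hat_data: "entwining_data K Om C Delta eps (psi_hat K A C psi)"
  using Om_algebra src.C_coalg tlift_lin[OF psi_hat_bilin]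
  by (auto intro!: entwining_data.intro entwining_data_axioms.intro scalars_axioms simp: psi_hat_eq lin_def)

sublocale tgt: entwining_data K "Omega K A" C Delta eps "psi_hat K A C psi"
  by (rule psi_hat_data)

lemma tgt_cross: "c \<in> carrier C \<Longrightarrow> x \<in> carrier Om \<Longrightarrow> tgt.cross c x = wlift OmC (hform c) x"
  unfolding tgt.cross_def unfolding psi_hat_eq by (rule tlift_pure[OF psi_hat_bilin])

lemma tgt_cross_wform:
  "c \<in> carrier C \<Longrightarrow> set as \<subseteq> carrier A \<Longrightarrow> valid (length as) p \<Longrightarrow> tgt.cross c (wform p as) = hform c p as"
  by (simp add: tgt_cross wform_closed validD wlift_wform[OF hform_wml])

section \<open>Compatibility with degree-zero forms, the differential and left multiplication\<close>

abbreviation iota where "iota \<equiv> Omega_id K A"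

lemma iota_eq: "iota a = wform (a, \<zero>\<^bsub>K\<^esub>) []"
  by (simp add: Omega_id_def wform_def form_def)

lemma iota_lin: "lin A Om iota"
  unfolding iota_eq[abs_def] by (rule lin_comp[OF lin_wform lin_inl]) simp

lemma nil_word [simp]: "[] \<in> words A 0" by (simp add: words_def)

lemma hform_pair:
  assumes c: "c \<in> carrier C" and a: "a \<in> carrier A" and as: "as \<in> words A n"
  shows "hform c (a, \<zero>\<^bsub>K\<^esub>) as = hat0 n (iter (a # as) c)"
  using hform_eq[OF as, of c "(a, \<zero>\<^bsub>K\<^esub>)"] lin_closed[OF hat1_lin iter_closed[OF c as]]
    lin_closed[OF hat0_lin iter_closed[OF c, of "a # as"]] a as
  by (simp add: words_def del: psi_iter.simps)

text \<open>
  The recursion of the iterated map, followed by the passage from words to forms.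
\<close>

lemma hat0_iter:
  assumes c: "c \<in> carrier C" and a: "a \<in> carrier A" and as: "as \<in> words A n"
  shows "hat0 n (iter (a # as) c) =
    tlift OmC (\<lambda>a' c'. tmap K Om C (\<lambda>s. word_form n (tcons K A n a' s)) (\<lambda>x. x) (iter as c')) (src.cross c a)"
proof -
  note b = iter_step_bilin[OF iter_lin[OF as]]
  have m: "bilin A (tpow K A n) Om (\<lambda>a' s. word_form n (tcons K A n a' s))"
    by (intro bilinI A_vs tpow_vs Om_vs lin_comp[OF word_form_lin] bilinD(4,5)[OF tcons_bilin])
  have "hat0 n (iter (a # as) c) =
    tlift OmC (\<lambda>a' c'. hat0 n (tmap K (tpow K A (Suc n)) C (tcons K A n a') (\<lambda>x. x) (iter as c'))) (src.cross c a)"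
    unfolding iter_Cons[OF as] by (rule tlift_fusion[OF hat0_lin b src.cross_closed[OF c a]])
  also have "\<dots> = tlift OmC (\<lambda>a' c'. tmap K Om C (\<lambda>s. word_form n (tcons K A n a' s)) (\<lambda>x. x) (iter as c')) (src.cross c a)"
  proof (rule tlift_cong[OF src.cross_closed[OF c a]])
    show "bilin A C OmC (\<lambda>a' c'. tmap K Om C (\<lambda>s. word_form n (tcons K A n a' s)) (\<lambda>x. x) (iter as c'))"
      by (intro bilinI A_vs C_vs OmC_vs lin_comp[OF tmap_lin[OF bilinD(4)[OF m] lin_id] iter_lin[OF as]]
          bilinD(5)[OF tmap_family_bilin[OF m]] iter_closed as)
    show "hat0 n (tmap K (tpow K A (Suc n)) C (tcons K A n a') (\<lambda>x. x) (iter as c')) =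
      tmap K Om C (\<lambda>s. word_form n (tcons K A n a' s)) (\<lambda>x. x) (iter as c')"
      if "a' \<in> carrier A" "c' \<in> carrier C" for a' c'
      by (rule tmap_comp[OF bilinD(4)[OF tcons_bilin[OF A_vs] that(1)] lin_id[OF C_vs] word_form_lin
            lin_id[OF C_vs] iter_closed[OF that(2) as]])
  qed
  finally show ?thesis .
qed

lemma cross_iota:
  assumes c: "c \<in> carrier C" and a: "a \<in> carrier A"
  shows "tgt.cross c (iota a) = tmap K Om C iota (\<lambda>c. c) (src.cross c a)"
proof -
  have "tgt.cross c (iota a) = hat0 0 (iter [a] c)"
    using c a by (simp add: iota_eq tgt_cross_wform valid_def hform_pair del: psi_iter.simps)
  also have "\<dots> = tlift OmC (\<lambda>a' c'. tmap K Om C (\<lambda>s. word_form 0 (tcons K A 0 a' s)) (\<lambda>x. x) (iter [] c')) (src.cross c a)"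
    by (rule hat0_iter[OF c a nil_word])
  also have "\<dots> = tlift OmC (\<lambda>a' c'. pure K Om C (iota a') c') (src.cross c a)"
  proof (rule tlift_cong[OF src.cross_closed[OF c a] tmap_bilin[OF iota_lin lin_id[OF C_vs]]])
    fix a' c' assume a': "a' \<in> carrier A" and c': "c' \<in> carrier C"
    show "tmap K Om C (\<lambda>s. word_form 0 (tcons K A 0 a' s)) (\<lambda>x. x) (iter [] c') = pure K Om C (iota a') c'"
      using tmap_pure[OF lin_comp[OF word_form_lin bilinD(4)[OF tcons_bilin[OF A_vs] a']] lin_id[OF C_vs]
          tword_closed[OF A_vs nil_word] c']
      by (simp add: tcons_word[OF A_vs a'] word_form_word[OF a'] iota_eq)
  qed
  finally show ?thesis by (simp add: tmap_def)
qed

lemma iter_zero: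
  "c \<in> carrier C \<Longrightarrow> as \<in> words A n \<Longrightarrow> iter (\<zero>\<^bsub>A\<^esub> # as) c = \<zero>\<^bsub>tensor K (tpow K A (Suc n)) C\<^esub>"
  by (rule lin_zero[OF iter_lin_hd])

lemma hform_unit:
  assumes c: "c \<in> carrier C" and as: "as \<in> words A n"
  shows "hform c unit_U as = hat1 n (iter as c)"
  using hform_eq[OF as, of c unit_U] lin_closed[OF hat1_lin iter_closed[OF c as]]
  by (simp add: iter_zero[OF c as] lin_zero[OF hat0_lin] del: psi_iter.simps)

lemma d_word_form: "s \<in> carrier (tpow K A (Suc n)) \<Longrightarrow> d (word_form n s) = word_dform (Suc n) s"
proof (rule tpow_eqI[OF A_vs lin_comp[OF d_lin word_form_lin] word_dform_lin])
  fix xs assume xs: "xs \<in> words A (Suc n)"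
  then obtain b bs where b: "xs = b # bs" "b \<in> carrier A" "bs \<in> words A n"
    by (cases xs) (auto simp: words_def)
  then show "d (word_form n (tword K A xs)) = word_dform (Suc n) (tword K A xs)"
    using xs by (simp add: word_form_word word_dform_word d_wform words_def valid_def)
qed

lemma d_word_dform: "s \<in> carrier (tpow K A n) \<Longrightarrow> 0 < n \<Longrightarrow> d (word_dform n s) = \<zero>\<^bsub>Om\<^esub>"
  by (rule tpow_eqI[OF A_vs lin_comp[OF d_lin word_dform_lin] lin_const0[OF tpow_vs[OF A_vs] Om_vs]])
    (auto simp: word_dform_word d_wform words_def valid_def wform_0)

text \<open>
  Prefixing \<open>1 \<cdot> d\<close> turns \<open>a\<^sub>0 da\<^sub>1 \<dots> da\<^sub>n\<close> into \<open>da\<^sub>0 da\<^sub>1 \<dots> da\<^sub>n\<close> without changing the underlying word,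
  so it does not matter whether this happens before or after the iteration. The \<open>\<mu>\<close>-part is killed
  on both sides, since \<open>d(da\<^sub>1 \<dots> da\<^sub>n) = 0\<close>.
\<close>

lemma cross_d:
  assumes c: "c \<in> carrier C" and x: "x \<in> carrier Om"
  shows "tgt.cross c (d x) = tmap K Om C d (\<lambda>c. c) (tgt.cross c x)"
proof (rule Om_eqI[OF lin_comp[OF tgt.cross_lin[OF c] d_lin]
      lin_comp[OF tmap_lin[OF d_lin lin_id[OF C_vs]] tgt.cross_lin[OF c]] _ x])
  fix p as assume as: "set as \<subseteq> carrier A" and p: "valid (length as) p"
  let ?n = "length as"
  note p' = validD[OF p]
  have w: "as \<in> words A ?n" "fst p # as \<in> words A (Suc ?n)" using as p' by (auto simp: words_def)
  note i0 = iter_closed[OF c w(2)] and i1 = iter_closed[OF c w(1)]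
  note D = tmap_lin[OF d_lin lin_id[OF C_vs]]
  have 0: "tmap K Om C d (\<lambda>c. c) (hat0 ?n (iter (fst p # as) c)) = hat1 (Suc ?n) (iter (fst p # as) c)"
    unfolding tmap_comp[OF word_form_lin lin_id[OF C_vs] d_lin lin_id[OF C_vs] i0]
    by (rule tmap_cong[OF word_dform_lin lin_id[OF C_vs] i0]) (simp_all add: d_word_form)
  \<comment> \<open>The rule \<open>d(da\<^sub>1 \<dots> da\<^sub>n) = 0\<close> is about positive degrees; a form of degree 0 has \<open>\<mu> = 0\<close>.\<close>
  have 1: "snd p \<odot>\<^bsub>OmC\<^esub> tmap K Om C d (\<lambda>c. c) (hat1 ?n (iter as c)) = \<zero>\<^bsub>OmC\<^esub>"
  proof (cases "as = []")
    case True
    then have "snd p = \<zero>\<^bsub>K\<^esub>" using p by (simp add: valid_def)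
    then show ?thesis using lin_closed[OF D lin_closed[OF hat1_lin i1]] by simp
  next
    case False
    have z: "lin (tpow K A ?n) Om (\<lambda>s. \<zero>\<^bsub>Om\<^esub>)" by (intro lin_const0 tpow_vs A_vs Om_vs)
    have "tmap K Om C d (\<lambda>c. c) (hat1 ?n (iter as c)) = tmap K Om C (\<lambda>s. \<zero>\<^bsub>Om\<^esub>) (\<lambda>c. c) (iter as c)"
      unfolding tmap_comp[OF word_dform_lin lin_id[OF C_vs] d_lin lin_id[OF C_vs] i1]
      by (rule tmap_cong[OF z lin_id[OF C_vs] i1]) (use False in \<open>simp_all add: d_word_dform\<close>)
    also have "\<dots> = \<zero>\<^bsub>OmC\<^esub>"
      by (rule tensor_eqI[OF tpow_vs[OF A_vs] C_vs tmap_lin[OF z lin_id[OF C_vs]] lin_const0 _ i1])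
        (auto simp: tmap_pure[OF z lin_id] lin_zero[OF bilinD(5)[OF pure_bilin]])
    finally show ?thesis using p' by simp
  qed
  have "tmap K Om C d (\<lambda>c. c) (tgt.cross c (wform p as))
    = hat1 (Suc ?n) (iter (fst p # as) c) \<oplus>\<^bsub>OmC\<^esub> \<zero>\<^bsub>OmC\<^esub>"
    using c as p p' lin_closed[OF hat0_lin i0] lin_closed[OF hat1_lin i1] lin_closed[OF D]
    by (simp add: tgt_cross_wform hform_eq[OF w(1)] lin_add[OF D] lin_smult[OF D] 0 1 del: psi_iter.simps)
  also have "\<dots> = hat1 (Suc ?n) (iter (fst p # as) c)" using lin_closed[OF hat1_lin i0] by simp
  finally show "tgt.cross c (d (wform p as)) = tmap K Om C d (\<lambda>c. c) (tgt.cross c (wform p as))"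
    using c as p p' w hform_unit[OF c w(2)] tgt_cross_wform[of c "fst p # as" unit_U]
    by (simp add: d_wform valid_def del: psi_iter.simps)
qed

abbreviation lact where "lact a t \<equiv> tmap K Om C (lop (a, \<zero>\<^bsub>K\<^esub>)) (\<lambda>c. c) t"

lemma lop_bilin: "bilin A Om Om (\<lambda>a. lop (a, \<zero>\<^bsub>K\<^esub>))"
  by (intro bilinI A_vs Om_vs lop_lin lin_comp[OF lop_lin1 lin_inl] pair_mem zero_closed)

lemma lact_bilin: "bilin A OmC OmC (\<lambda>a t. lact a t)"
  by (rule tmap_family_bilin[OF lop_bilin C_vs])

lemma lop_word_form:
  assumes a: "a \<in> carrier A" and b: "b \<in> carrier A" and s: "s \<in> carrier (tpow K A n)"
  shows "lop (a, \<zero>\<^bsub>K\<^esub>) (word_form n (tcons K A n b s)) = word_form n (tcons K A n (a \<otimes>\<^bsub>A\<^esub> b) s)"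
  by (rule tpow_eqI[OF A_vs lin_comp[OF bilinD(4)[OF lop_bilin a] lin_comp[OF word_form_lin bilinD(4)[OF tcons_bilin b]]]
        lin_comp[OF word_form_lin bilinD(4)[OF tcons_bilin]] _ s])
    (use a b in \<open>simp_all add: tcons_word word_form_word lop_wform words_def valid_def U_mult\<close>)

lemma lop_word_dform:
  assumes a: "a \<in> carrier A" and s: "s \<in> carrier (tpow K A n)" and n: "0 < n"
  shows "lop (a, \<zero>\<^bsub>K\<^esub>) (word_dform n s) = word_form n (tcons K A n a s)"
  by (rule tpow_eqI[OF A_vs lin_comp[OF bilinD(4)[OF lop_bilin a] word_dform_lin]
        lin_comp[OF word_form_lin bilinD(4)[OF tcons_bilin a]] _ s])
    (use a n in \<open>auto simp: tcons_word word_form_word word_dform_word lop_wform words_def valid_def U_mult_one\<close>)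

text \<open>
  For \<open>x = (b + \<mu>) da\<^sub>1 \<dots> da\<^sub>n\<close> one has \<open>a x = (a b) da\<^sub>1 \<dots> da\<^sub>n + \<mu> a da\<^sub>1 \<dots> da\<^sub>n\<close>. In the first summand
  multiplicativity of \<open>\<psi>\<close> moves \<open>c\<close> past \<open>a\<close> and \<open>b\<close> separately; in the second one, \<open>c\<close> moves past \<open>a\<close>
  by the recursion of the iterated map.
\<close>

lemma cross_lop:
  assumes ml: "\<forall>a\<in>carrier A. src.mult_law a" and c: "c \<in> carrier C" and a: "a \<in> carrier A" and x: "x \<in> carrier Om"
  shows "tgt.cross c (lop (a, \<zero>\<^bsub>K\<^esub>) x) = tlift OmC (\<lambda>a' c'. lact a' (tgt.cross c' x)) (src.cross c a)"
proof -
  have bx: "bilin A C OmC (\<lambda>a' c'. lact a' (tgt.cross c' x))" if "x \<in> carrier Om" for x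
    using that by (intro bilinI A_vs C_vs OmC_vs lin_comp[OF bilinD(4)[OF lact_bilin] tgt.cross_lin1]
        bilinD(5)[OF lact_bilin] tgt.cross_closed)
  note ca = src.cross_closed[OF c a]
  have lhs: "lin Om OmC (\<lambda>x. tgt.cross c (lop (a, \<zero>\<^bsub>K\<^esub>) x))"
    by (intro lin_comp[OF tgt.cross_lin[OF c]] bilinD(4)[OF lop_bilin a])
  have rhs: "lin Om OmC (\<lambda>x. tlift OmC (\<lambda>a' c'. lact a' (tgt.cross c' x)) (src.cross c a))"
    by (intro lin_tlift_fun[OF ca] bx A_vs C_vs Om_vs OmC_vs lin_comp[OF bilinD(4)[OF lact_bilin] tgt.cross_lin])
  show ?thesis
  proof (rule Om_eqI[OF lhs rhs _ x])
    fix p as assume as: "set as \<subseteq> carrier A" and p: "valid (length as) p"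
    let ?n = "length as" let ?b = "fst p" let ?r = "snd p"
    let ?g = "\<lambda>z c'. tmap K Om C (\<lambda>s. word_form ?n (tcons K A ?n z s)) (\<lambda>x. x) (iter as c')"
    note p' = validD[OF p]
    have b: "?b \<in> carrier A" and r: "?r \<in> carrier K" using p' by auto
    have w: "as \<in> words A ?n" "?b # as \<in> words A (Suc ?n)" using as p' by (auto simp: words_def)
    have m: "bilin A (tpow K A ?n) Om (\<lambda>a' s. word_form ?n (tcons K A ?n a' s))"
      by (intro bilinI A_vs tpow_vs Om_vs lin_comp[OF word_form_lin] bilinD(4,5)[OF tcons_bilin])
    have g: "bilin A C OmC ?g"
      by (intro bilinI A_vs C_vs OmC_vs lin_comp[OF tmap_lin[OF bilinD(4)[OF m] lin_id] iter_lin[OF w(1)]]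
          bilinD(5)[OF tmap_family_bilin[OF m]] iter_closed w(1))
    have b0: "bilin A C OmC (\<lambda>a' c'. lact a' (hat0 ?n (iter (?b # as) c')))"
      by (intro bilinI A_vs C_vs OmC_vs lin_comp[OF bilinD(4)[OF lact_bilin] lin_comp[OF hat0_lin iter_lin[OF w(2)]]]
          bilinD(5)[OF lact_bilin] lin_closed[OF hat0_lin] iter_closed w(2))
    have b1: "bilin A C OmC (\<lambda>a' c'. lact a' (hat1 ?n (iter as c')))"
      by (intro bilinI A_vs C_vs OmC_vs lin_comp[OF bilinD(4)[OF lact_bilin] lin_comp[OF hat1_lin iter_lin[OF w(1)]]]
          bilinD(5)[OF lact_bilin] lin_closed[OF hat1_lin] iter_closed w(1))
    have first: "hat0 ?n (iter ((a \<otimes>\<^bsub>A\<^esub> ?b) # as) c)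
      = tlift OmC (\<lambda>a' c'. lact a' (hat0 ?n (iter (?b # as) c'))) (src.cross c a)"
    proof -
      have "hat0 ?n (iter ((a \<otimes>\<^bsub>A\<^esub> ?b) # as) c) = tlift OmC ?g (src.cross c (a \<otimes>\<^bsub>A\<^esub> ?b))"
        by (rule hat0_iter[OF c A_closed[OF a b] w(1)])
      also have "\<dots> = tlift OmC ?g (tlift src.RC (\<lambda>a' c'. src.act a' (src.cross c' ?b)) (src.cross c a))"
        using src.mult_lawD[OF bspec[OF ml a] c b] by simp
      also have "\<dots> = tlift OmC (\<lambda>a' c'. tlift OmC ?g (src.act a' (src.cross c' ?b))) (src.cross c a)"
        by (rule tlift_fusion[OF tlift_lin[OF g] src.act_cross_bilin[OF b] ca])
      also have "\<dots> = tlift OmC (\<lambda>a' c'. lact a' (hat0 ?n (iter (?b # as) c'))) (src.cross c a)"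
      proof (rule tlift_cong[OF ca b0])
        fix a' c' assume a': "a' \<in> carrier A" and c': "c' \<in> carrier C"
        note cb = src.cross_closed[OF c' b]
        have La: "lin Om Om (lop (a', \<zero>\<^bsub>K\<^esub>))" by (rule bilinD(4)[OF lop_bilin a'])
        have "lact a' (hat0 ?n (iter (?b # as) c')) = tlift OmC (\<lambda>z e. lact a' (?g z e)) (src.cross c' ?b)"
          unfolding hat0_iter[OF c' b w(1)]
          by (rule tlift_fusion[OF bilinD(4)[OF lact_bilin a'] g cb])
        also have "\<dots> = tlift OmC (\<lambda>z e. ?g (a' \<otimes>\<^bsub>A\<^esub> z) e) (src.cross c' ?b)"
        proof (rule tlift_cong[OF cb])
          show "bilin A C OmC (\<lambda>z e. ?g (a' \<otimes>\<^bsub>A\<^esub> z) e)"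
            using a' by (intro bilinI A_vs C_vs OmC_vs bilinD(4)[OF g] lin_comp[OF bilinD(5)[OF g] bilinD(4)[OF A_bilin]] A_closed)
          fix z e assume z: "z \<in> carrier A" and e: "e \<in> carrier C"
          note ie = iter_closed[OF e w(1)]
          show "lact a' (?g z e) = ?g (a' \<otimes>\<^bsub>A\<^esub> z) e"
            unfolding tmap_comp[OF bilinD(4)[OF m z] lin_id[OF C_vs] La lin_id[OF C_vs] ie]
            by (rule tmap_cong[OF bilinD(4)[OF m A_closed[OF a' z]] lin_id[OF C_vs] ie])
              (use a' z in \<open>simp_all add: lop_word_form\<close>)
        qed
        also have "\<dots> = tlift OmC ?g (src.act a' (src.cross c' ?b))"
          unfolding src.act_def
          by (rule tlift_tmap[OF bilinD(4)[OF A_bilin a'] lin_id[OF C_vs] g cb, symmetric])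
        finally show "tlift OmC ?g (src.act a' (src.cross c' ?b)) = lact a' (hat0 ?n (iter (?b # as) c'))" ..
      qed
      finally show ?thesis .
    qed
    \<comment> \<open>The identity without the factor \<open>\<mu>\<close> fails for the empty word, as \<open>word_dform 0\<close> is \<open>0\<close> and not a
      unit element; but then \<open>\<mu> = 0\<close>.\<close>
    have second: "?r \<odot>\<^bsub>OmC\<^esub> hat0 ?n (iter (a # as) c)
      = ?r \<odot>\<^bsub>OmC\<^esub> tlift OmC (\<lambda>a' c'. lact a' (hat1 ?n (iter as c'))) (src.cross c a)"
    proof (cases "as = []")
      case True
      then have "?r = \<zero>\<^bsub>K\<^esub>" using p by (simp add: valid_def)
      moreover have "a # as \<in> words A (Suc ?n)" using a as by (simp add: words_def)
      ultimately show ?thesis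
        using lin_closed[OF hat0_lin iter_closed[OF c]] lin_closed[OF tlift_lin[OF b1] ca]
        by (simp del: psi_iter.simps)
    next
      case False
      have "hat0 ?n (iter (a # as) c) = tlift OmC ?g (src.cross c a)" by (rule hat0_iter[OF c a w(1)])
      also have "\<dots> = tlift OmC (\<lambda>a' c'. lact a' (hat1 ?n (iter as c'))) (src.cross c a)"
      proof (rule tlift_cong[OF ca b1])
        fix a' c' assume a': "a' \<in> carrier A" and c': "c' \<in> carrier C"
        note ie = iter_closed[OF c' w(1)]
        show "?g a' c' = lact a' (hat1 ?n (iter as c'))"
          unfolding tmap_comp[OF word_dform_lin lin_id[OF C_vs] bilinD(4)[OF lop_bilin a'] lin_id[OF C_vs] ie]
          by (rule tmap_cong[OF bilinD(4)[OF m a'] lin_id[OF C_vs] ie, symmetric])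
            (use a' False in \<open>simp_all add: lop_word_dform\<close>)
      qed
      finally show ?thesis by simp
    qed
    have mult: "(a, \<zero>\<^bsub>K\<^esub>) \<otimes>\<^bsub>U\<^esub> p = (a \<otimes>\<^bsub>A\<^esub> ?b \<oplus>\<^bsub>A\<^esub> ?r \<odot>\<^bsub>A\<^esub> a, \<zero>\<^bsub>K\<^esub>)"
      using a b r by (simp add: U_mult)
    note L = lin_comp[OF hat0_lin iter_lin_hd[OF c w(1)]]
    have "tgt.cross c (lop (a, \<zero>\<^bsub>K\<^esub>) (wform p as)) = hat0 ?n (iter ((a \<otimes>\<^bsub>A\<^esub> ?b \<oplus>\<^bsub>A\<^esub> ?r \<odot>\<^bsub>A\<^esub> a) # as) c)"
      using a b r c as p by (simp add: lop_wform mult tgt_cross_wform valid_def hform_pair[OF c _ w(1)] del: psi_iter.simps)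
    also have "\<dots> = hat0 ?n (iter ((a \<otimes>\<^bsub>A\<^esub> ?b) # as) c) \<oplus>\<^bsub>OmC\<^esub> ?r \<odot>\<^bsub>OmC\<^esub> hat0 ?n (iter (a # as) c)"
      using lin_add[OF L, of "a \<otimes>\<^bsub>A\<^esub> ?b" "?r \<odot>\<^bsub>A\<^esub> a"] lin_smult[OF L r a] a b r by (simp del: psi_iter.simps)
    also have "\<dots> = tlift OmC (\<lambda>a' c'. lact a' (hat0 ?n (iter (?b # as) c'))) (src.cross c a)
      \<oplus>\<^bsub>OmC\<^esub> tlift OmC (\<lambda>a' c'. ?r \<odot>\<^bsub>OmC\<^esub> lact a' (hat1 ?n (iter as c'))) (src.cross c a)"
      unfolding first second tlift_smult_fun[OF b1 r ca] ..
    also have "\<dots> = tlift OmC (\<lambda>a' c'. lact a' (hat0 ?n (iter (?b # as) c'))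
      \<oplus>\<^bsub>OmC\<^esub> ?r \<odot>\<^bsub>OmC\<^esub> lact a' (hat1 ?n (iter as c'))) (src.cross c a)"
      by (rule tlift_add_fun[OF b0 _ ca, symmetric])
        (intro bilinI A_vs C_vs OmC_vs lin_smult_fun r bilinD(4,5)[OF b1])
    also have "\<dots> = tlift OmC (\<lambda>a' c'. lact a' (tgt.cross c' (wform p as))) (src.cross c a)"
    proof (rule tlift_cong[OF ca bx])
      fix a' c' assume a': "a' \<in> carrier A" and c': "c' \<in> carrier C"
      note L = bilinD(4)[OF lact_bilin a']
      show "lact a' (hat0 ?n (iter (?b # as) c')) \<oplus>\<^bsub>OmC\<^esub> ?r \<odot>\<^bsub>OmC\<^esub> lact a' (hat1 ?n (iter as c'))
        = lact a' (tgt.cross c' (wform p as))"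
        using c' as p r lin_closed[OF hat0_lin iter_closed[OF c' w(2)]] lin_closed[OF hat1_lin iter_closed[OF c' w(1)]]
        by (simp add: tgt_cross_wform hform_eq[OF w(1)] lin_add[OF L] lin_smult[OF L] del: psi_iter.simps)
    qed (use as p' in \<open>auto intro: wform_closed\<close>)
    finally show "tgt.cross c (lop (a, \<zero>\<^bsub>K\<^esub>) (wform p as))
      = tlift OmC (\<lambda>a' c'. lact a' (tgt.cross c' (wform p as))) (src.cross c a)" .
  qed
qed

section \<open>The laws hold on generators, hence everywhere\<close>

lemma iota_closed [simp]: "a \<in> carrier A \<Longrightarrow> iota a \<in> carrier Om"
  by (rule lin_closed[OF iota_lin])

lemma iota_mult: "a \<in> carrier A \<Longrightarrow> y \<in> carrier Om \<Longrightarrow> iota a \<otimes>\<^bsub>Om\<^esub> y = lop (a, \<zero>\<^bsub>K\<^esub>) y"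
  using mul_wform[of "[]" "(a, \<zero>\<^bsub>K\<^esub>)" y] by (simp add: Om_mult) (simp add: iota_eq valid_def lam_def)

lemma d_iota: "a \<in> carrier A \<Longrightarrow> d (iota a) = wform unit_U [a]"
  by (simp add: iota_eq d_wform valid_def)

lemma d_iota_mult: "a \<in> carrier A \<Longrightarrow> y \<in> carrier Om \<Longrightarrow> d (iota a) \<otimes>\<^bsub>Om\<^esub> y = delta a y"
  using mul_wform_one[of "[a]" y] wform_closed[of unit_U "[a]"] by (simp add: d_iota Om_mult)

text \<open>
  This holds because \<open>(a\<^sub>0 + \<mu>) da\<^sub>1 \<dots> da\<^sub>n = a\<^sub>0 (da\<^sub>1 \<dots> da\<^sub>n) + \<mu> da\<^sub>1 \<dots> da\<^sub>n\<close>.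
\<close>

lemma generation:
  assumes H: "submodule H K Om" and i: "\<And>a. a \<in> carrier A \<Longrightarrow> iota a \<in> H"
    and di: "\<And>a. a \<in> carrier A \<Longrightarrow> d (iota a) \<in> H"
    and m: "\<And>x y. x \<in> H \<Longrightarrow> y \<in> H \<Longrightarrow> x \<otimes>\<^bsub>Om\<^esub> y \<in> H" and x: "x \<in> carrier Om"
  shows "x \<in> H"
proof (rule Om_induct[OF H _ x])
  note D = submodD[OF Om_vs H]
  have 1: "wform unit_U as \<in> H" if "set as \<subseteq> carrier A" "as \<noteq> []" for as
    using that
  proof (induction as)
    case (Cons a as)
    show ?case
    proof (cases "as = []")
      case True
      then show ?thesis using di[of a] Cons by (simp add: d_iota)
    next
      case False
      then have "d (iota a) \<otimes>\<^bsub>Om\<^esub> wform unit_U as \<in> H" using Cons by (intro m di) auto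
      then show ?thesis using Cons False by (simp add: d_iota_mult wform_closed delta_unit)
    qed
  qed simp
  fix p as assume as: "set as \<subseteq> carrier A" and p: "valid (length as) p"
  note p' = validD[OF p]
  show "wform p as \<in> H"
  proof (cases "as = []")
    case True
    then have "wform p as = iota (fst p)" using p by (simp add: iota_eq wform_def form_def)
    then show ?thesis using i p' by simp
  next
    case False
    note w = wform_closed[OF one_mem as]
    have "wform p as = lop p (wform unit_U as)"
      using lop_wform[OF p' as, of unit_U] False p' by (simp add: valid_def U_mult_one)
    also have "\<dots> = iota (fst p) \<otimes>\<^bsub>Om\<^esub> wform unit_U as \<oplus>\<^bsub>Om\<^esub> snd p \<odot>\<^bsub>Om\<^esub> wform unit_U as"
      using w p' by (simp add: lop_split[OF p' w] iota_mult)
    finally show ?thesis using D(3,4) m i 1[OF as False] p' by simp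
  qed
qed

lemma mult_law_iota:
  assumes ml: "\<forall>a\<in>carrier A. src.mult_law a" and a: "a \<in> carrier A"
  shows "tgt.mult_law (iota a)"
  unfolding tgt.mult_law_def
proof (intro ballI)
  fix c y assume c: "c \<in> carrier C" and y: "y \<in> carrier Om"
  note ca = src.cross_closed[OF c a]
  have "tlift OmC (\<lambda>x' c'. tgt.act x' (tgt.cross c' y)) (tgt.cross c (iota a))
    = tlift OmC (\<lambda>a' c'. tgt.act (iota a') (tgt.cross c' y)) (src.cross c a)"
    unfolding cross_iota[OF c a]
    by (rule tlift_tmap[OF iota_lin lin_id[OF C_vs] tgt.act_cross_bilin[OF y] ca])
  also have "\<dots> = tlift OmC (\<lambda>a' c'. lact a' (tgt.cross c' y)) (src.cross c a)"
  proof (rule tlift_cong[OF ca])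
    show "bilin A C OmC (\<lambda>a' c'. lact a' (tgt.cross c' y))"
      using y by (intro bilinI A_vs C_vs OmC_vs lin_comp[OF bilinD(4)[OF lact_bilin] tgt.cross_lin1]
          bilinD(5)[OF lact_bilin] tgt.cross_closed)
    show "tgt.act (iota a') (tgt.cross c' y) = lact a' (tgt.cross c' y)"
      if "a' \<in> carrier A" "c' \<in> carrier C" for a' c'
      unfolding tgt.act_def
      by (rule tmap_cong[OF bilinD(4)[OF lop_bilin that(1)] lin_id[OF C_vs] tgt.cross_closed[OF that(2) y]])
        (simp_all add: iota_mult that)
  qed
  also have "\<dots> = tgt.cross c (iota a \<otimes>\<^bsub>Om\<^esub> y)"
    using cross_lop[OF ml c a y] a y by (simp add: iota_mult)
  finally show "tgt.cross c (iota a \<otimes>\<^bsub>Om\<^esub> y)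
    = tlift OmC (\<lambda>x' c'. tgt.act x' (tgt.cross c' y)) (tgt.cross c (iota a))" ..
qed

text \<open>
  Since \<open>da \<cdot> y = d(a y) - a dy\<close>, this follows from the law for \<open>a\<close> and from compatibility with \<open>d\<close>.
\<close>

lemma mult_law_d_iota:
  assumes ml: "\<forall>a\<in>carrier A. src.mult_law a" and a: "a \<in> carrier A"
  shows "tgt.mult_law (d (iota a))"
  unfolding tgt.mult_law_def
proof (intro ballI)
  fix c y assume c: "c \<in> carrier C" and y: "y \<in> carrier Om"
  note ca = src.cross_closed[OF c a]
  note dy = d_closed[OF y]
  let ?D = "\<lambda>t. tmap K Om C d (\<lambda>c. c) t"
  have D: "lin OmC OmC ?D" by (rule tmap_lin[OF d_lin lin_id[OF C_vs]])
  have b: "bilin A C OmC (\<lambda>a' c'. lact a' (tgt.cross c' y))" if "y \<in> carrier Om" for y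
    using that by (intro bilinI A_vs C_vs OmC_vs lin_comp[OF bilinD(4)[OF lact_bilin] tgt.cross_lin1]
        bilinD(5)[OF lact_bilin] tgt.cross_closed)
  have Db: "bilin A C OmC (\<lambda>a' c'. ?D (lact a' (tgt.cross c' y)))"
    by (intro bilinI A_vs C_vs OmC_vs lin_comp[OF D] bilinD(4,5)[OF b[OF y]])
  have "tlift OmC (\<lambda>x' c'. tgt.act x' (tgt.cross c' y)) (tgt.cross c (d (iota a)))
    = tlift OmC (\<lambda>a' c'. tgt.act (d (iota a')) (tgt.cross c' y)) (src.cross c a)"
    unfolding cross_d[OF c iota_closed[OF a]] cross_iota[OF c a]
      tmap_comp[OF iota_lin lin_id[OF C_vs] d_lin lin_id[OF C_vs] ca]
    by (rule tlift_tmap[OF lin_comp[OF d_lin iota_lin] lin_id[OF C_vs] tgt.act_cross_bilin[OF y] ca])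
  also have "\<dots> = tlift OmC (\<lambda>a' c'. ?D (lact a' (tgt.cross c' y)) \<ominus>\<^bsub>OmC\<^esub> lact a' (tgt.cross c' (d y))) (src.cross c a)"
  proof (rule tlift_cong[OF ca])
    show "bilin A C OmC (\<lambda>a' c'. ?D (lact a' (tgt.cross c' y)) \<ominus>\<^bsub>OmC\<^esub> lact a' (tgt.cross c' (d y)))"
      by (intro bilinI A_vs C_vs OmC_vs lin_minus_fun bilinD(4,5)[OF Db] bilinD(4,5)[OF b[OF dy]])
    fix a' c' assume a': "a' \<in> carrier A" and c': "c' \<in> carrier C"
    note L = bilinD(4)[OF lact_bilin a'] and l = bilinD(4)[OF lop_bilin a']
    have "tgt.act (d (iota a')) t = ?D (lact a' t) \<ominus>\<^bsub>OmC\<^esub> lact a' (?D t)" if t: "t \<in> carrier OmC" for t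
    proof (rule tensor_eqI[OF Om_vs C_vs tgt.act_lin lin_minus_fun[OF lin_comp[OF D L] lin_comp[OF L D]] _ t])
      fix z e assume z: "z \<in> carrier Om" and e: "e \<in> carrier C"
      have "tgt.act (d (iota a')) (pure K Om C z e) = pure K Om C (delta a' z) e"
        using a' z e by (simp add: tgt.act_pure d_iota_mult)
      also have "\<dots> = pure K Om C (d (lop (a', \<zero>\<^bsub>K\<^esub>) z)) e \<ominus>\<^bsub>OmC\<^esub> pure K Om C (lop (a', \<zero>\<^bsub>K\<^esub>) (d z)) e"
        unfolding delta_def using a' z e by (intro lin_minus[OF bilinD(5)[OF pure_bilin]]) auto
      also have "\<dots> = ?D (lact a' (pure K Om C z e)) \<ominus>\<^bsub>OmC\<^esub> lact a' (?D (pure K Om C z e))"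
        using a' z e by (simp add: tmap_pure[OF d_lin lin_id[OF C_vs]] tmap_pure[OF l lin_id[OF C_vs]])
      finally show "tgt.act (d (iota a')) (pure K Om C z e)
        = ?D (lact a' (pure K Om C z e)) \<ominus>\<^bsub>OmC\<^esub> lact a' (?D (pure K Om C z e))" .
    qed (use a' in simp)
    from this[OF tgt.cross_closed[OF c' y]]
    show "tgt.act (d (iota a')) (tgt.cross c' y)
      = ?D (lact a' (tgt.cross c' y)) \<ominus>\<^bsub>OmC\<^esub> lact a' (tgt.cross c' (d y))"
      by (simp add: cross_d[OF c' y])
  qed
  also have "\<dots> = tlift OmC (\<lambda>a' c'. ?D (lact a' (tgt.cross c' y))) (src.cross c a)
    \<ominus>\<^bsub>OmC\<^esub> tlift OmC (\<lambda>a' c'. lact a' (tgt.cross c' (d y))) (src.cross c a)"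
    by (rule tlift_minus_fun[OF Db b[OF dy] ca])
  also have "tlift OmC (\<lambda>a' c'. ?D (lact a' (tgt.cross c' y))) (src.cross c a)
    = ?D (tlift OmC (\<lambda>a' c'. lact a' (tgt.cross c' y)) (src.cross c a))"
    by (rule tlift_fusion[OF D b[OF y] ca, symmetric])
  also have "\<dots> = tgt.cross c (d (lop (a, \<zero>\<^bsub>K\<^esub>) y))"
    using cross_lop[OF ml c a y] cross_d[OF c, of "lop (a, \<zero>\<^bsub>K\<^esub>) y"] a y by simp
  also have "tlift OmC (\<lambda>a' c'. lact a' (tgt.cross c' (d y))) (src.cross c a) = tgt.cross c (lop (a, \<zero>\<^bsub>K\<^esub>) (d y))"
    by (rule cross_lop[OF ml c a dy, symmetric])
  also have "tgt.cross c (d (lop (a, \<zero>\<^bsub>K\<^esub>) y)) \<ominus>\<^bsub>OmC\<^esub> tgt.cross c (lop (a, \<zero>\<^bsub>K\<^esub>) (d y)) = tgt.cross c (delta a y)"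
    unfolding delta_def using a y by (intro lin_minus[OF tgt.cross_lin[OF c], symmetric]) auto
  also have "\<dots> = tgt.cross c (d (iota a) \<otimes>\<^bsub>Om\<^esub> y)"
    using a y by (simp add: d_iota_mult)
  finally show "tgt.cross c (d (iota a) \<otimes>\<^bsub>Om\<^esub> y)
    = tlift OmC (\<lambda>x' c'. tgt.act x' (tgt.cross c' y)) (tgt.cross c (d (iota a)))" ..
qed

lemma iota_morphism: "entwining_morphism K A C Delta eps psi Om (psi_hat K A C psi) iota"
  by (intro entwining_morphism.intro entwining_morphism_axioms.intro src.entwining_data_axioms
      tgt.entwining_data_axioms iota_lin cross_iota)

lemma d_morphism: "entwining_morphism K Om C Delta eps (psi_hat K A C psi) Om (psi_hat K A C psi) d"
  by (intro entwining_morphism.intro entwining_morphism_axioms.intro tgt.entwining_data_axioms d_lin cross_d)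

lemma laws_all:
  assumes ml: "\<forall>a\<in>carrier A. src.mult_law a" and cl: "\<forall>a\<in>carrier A. src.comult_law a"
    and el: "\<forall>a\<in>carrier A. src.counit_law a" and x: "x \<in> carrier Om"
  shows "tgt.mult_law x" "tgt.comult_law x" "tgt.counit_law x"
proof -
  have m: "tgt.mult_law x" if "x \<in> carrier Om" for x
    using generation[OF tgt.mult_law_submod _ _ _ that] mult_law_iota[OF ml] mult_law_d_iota[OF ml]
      tgt.mult_law_mult by auto
  then show "tgt.mult_law x" using x .
  have ic: "tgt.comult_law (iota a)" "tgt.counit_law (iota a)" if "a \<in> carrier A" for a
    using entwining_morphism.comult_law_image[OF iota_morphism that]
      entwining_morphism.counit_law_image[OF iota_morphism that] cl el that by auto
  have dc: "tgt.comult_law (d (iota a))" "tgt.counit_law (d (iota a))" if "a \<in> carrier A" for a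
    using entwining_morphism.comult_law_image[OF d_morphism iota_closed[OF that]]
      entwining_morphism.counit_law_image[OF d_morphism iota_closed[OF that]] ic[OF that] by auto
  show "tgt.comult_law x"
    using generation[OF tgt.comult_law_submod _ _ _ x] ic dc tgt.comult_law_mult m by auto
  show "tgt.counit_law x"
    using generation[OF tgt.counit_law_submod _ _ _ x] ic dc tgt.counit_law_mult m by auto
qed

lemma gr_submod: "submodule (Omega_gr K A n) K Om"
  using Om_dg by (simp add: dg_algebra_def dg_algebra_axioms_def)

text \<open>
  Iterating \<open>\<psi>\<close> preserves the length of words, and \<open>word_form n\<close> and \<open>word_dform n\<close> have values in
  degree \<open>n\<close>.
\<close>

lemma hat_degree:
  assumes c: "c \<in> carrier C" and x: "x \<in> Omega_gr K A n"
  shows "psi_hat K A C psi (pure K C Om c x) \<in>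
    lin_span K OmC {pure K Om C x' c' | x' c'. x' \<in> Omega_gr K A n \<and> c' \<in> carrier C}"
    (is "_ \<in> lin_span K OmC ?S")
proof -
  obtain u where u: "u \<in> carrier (deg n)" "x = incl n u" using x by (auto simp: Omega_gr_def)
  have S: "?S \<subseteq> carrier OmC" using submodD(1)[OF Om_vs gr_submod] by (auto intro!: pure_closed)
  note sp = lin_span_submod[OF OmC_vs S]
  have w0: "word_form n s \<in> Omega_gr K A n" if s: "s \<in> carrier (tpow K A (Suc n))" for s
  proof -
    have "s \<in> {s \<in> carrier (tpow K A (Suc n)). word_form n s \<in> Omega_gr K A n}"
    proof (rule tpow_induct[OF A_vs submod_lin_vimage[OF word_form_lin gr_submod] _ s])
      fix xs assume xs: "xs \<in> words A (Suc n)"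
      then obtain b bs where b: "xs = b # bs" "b \<in> carrier A" "bs \<in> words A n"
        by (cases xs) (auto simp: words_def)
      then have "word_form n (tword K A xs) = incl n (form K A (b, \<zero>\<^bsub>K\<^esub>) bs)"
        by (simp add: word_form_word wform_def words_def)
      then show "tword K A xs \<in> {s \<in> carrier (tpow K A (Suc n)). word_form n s \<in> Omega_gr K A n}"
        using gr_mem[OF form_closed[of "(b, \<zero>\<^bsub>K\<^esub>)" bs n]] b tword_closed[OF A_vs xs] by simp
    qed
    then show ?thesis by simp
  qed
  have w1: "word_dform n s \<in> Omega_gr K A n" if s: "s \<in> carrier (tpow K A n)" for s
  proof -
    have "s \<in> {s \<in> carrier (tpow K A n). word_dform n s \<in> Omega_gr K A n}"
    proof (rule tpow_induct[OF A_vs submod_lin_vimage[OF word_dform_lin gr_submod] _ s])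
      fix xs assume xs: "xs \<in> words A n"
      then have "word_dform n (tword K A xs) = incl n (form K A unit_U xs)"
        by (simp add: word_dform_word wform_def words_def)
      then show "tword K A xs \<in> {s \<in> carrier (tpow K A n). word_dform n s \<in> Omega_gr K A n}"
        using gr_mem[OF form_closed[OF one_mem xs]] tword_closed[OF A_vs xs] by simp
    qed
    then show ?thesis by simp
  qed
  note L = lin_comp[OF tgt.cross_lin[OF c] incl_lin]
  have "u \<in> {u \<in> carrier (deg n). tgt.cross c (incl n u) \<in> lin_span K OmC ?S}"
  proof (rule deg_induct[OF submod_lin_vimage[OF L sp] _ u(1)])
    fix p as assume as: "as \<in> words A n" and p: "valid n p"
    note p' = validD[OF p]
    have fa: "fst p # as \<in> words A (Suc n)" using as p' by (auto simp: words_def)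
    have "tgt.cross c (incl n (form K A p as)) = hform c p as"
      using tgt_cross_wform[OF c, of as p] as p by (simp add: wform_def words_def)
    also have "\<dots> \<in> lin_span K OmC ?S"
      unfolding hform_eq[OF as]
    proof (intro submodD(3,4)[OF OmC_vs sp] snd_mem[OF p'])
      show "hat0 n (iter (fst p # as) c) \<in> lin_span K OmC ?S"
        by (rule tmap_mem_span[OF word_form_lin lin_id[OF C_vs] iter_closed[OF c fa] _ S]) (use w0 in auto)
      show "hat1 n (iter as c) \<in> lin_span K OmC ?S"
        by (rule tmap_mem_span[OF word_dform_lin lin_id[OF C_vs] iter_closed[OF c as] _ S]) (use w1 in auto)
    qed
    finally show "form K A p as \<in> {u \<in> carrier (deg n). tgt.cross c (incl n u) \<in> lin_span K OmC ?S}"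
      using form_closed[OF p' as] by simp
  qed
  then show ?thesis using u by (simp add: tgt.cross_def)
qed

end

theorem proposition3p3:
  fixes K :: "'k ring" and A :: "('k, 'a) module" and C :: "('k, 'c) module"
    and Delta :: "'c \<Rightarrow> ('k, 'c, 'c) tens" and eps :: "'c \<Rightarrow> 'k"
    and psi :: "('k, 'c, 'a) tens \<Rightarrow> ('k, 'a, 'c) tens"
  assumes "entwining_structure K A C Delta eps psi"
  shows "dg_entwining_over K A C Delta eps psi
           (Omega K A) (Omega_gr K A) (Omega_d K A) (psi_hat K A C psi) (Omega_id K A)"
proof -
  interpret E: entwining_structure K A C Delta eps psi by fact
  have field: "field K" by (rule E.field_K)
  interpret scalars K using E.R.is_cring by (rule scalars.intro)
  have alg: "nonunital_algebra K A" and coalg: "coalgebra K C Delta eps"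
    by (rule E.nonunital_algebra_axioms E.coalgebra_axioms)+
  interpret entwined_forms K A C Delta eps psi
    by (intro entwined_forms.intro universal_forms.intro universal_forms_axioms.intro entwining_data.intro
        entwining_data_axioms.intro scalars_axioms alg coalg E.Psi_linear)
  have laws: "\<forall>a\<in>carrier A. src.mult_law a" "\<forall>a\<in>carrier A. src.comult_law a" "\<forall>a\<in>carrier A. src.counit_law a"
    using src.mult_axiom_iff src.comult_axiom_iff src.counit_axiom_iff E.Psi_mult E.Psi_comult E.Psi_counit
    by blast+
  have ent: "nonunital_entwining K (Omega K A) C Delta eps (psi_hat K A C psi)"
    by (rule tgt.entwiningI[OF field]) (rule laws_all[OF laws]; assumption)+
  have D: "tmap K Om C d (\<lambda>c. c) (psi_hat K A C psi t) = psi_hat K A C psi (tmap K C Om (\<lambda>c. c) d t)"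
    if t: "t \<in> carrier (tensor K C Om)" for t
    by (rule tensor_eqI[OF C_vs Om_vs lin_comp[OF tmap_lin[OF d_lin lin_id[OF C_vs]] tgt.Psi_lin']
          lin_comp[OF tgt.Psi_lin' tmap_lin[OF lin_id[OF C_vs] d_lin]] _ t])
      (simp add: tmap_pure[OF lin_id[OF C_vs] d_lin] cross_d[unfolded tgt.cross_def])
  have rho: "tmap K Om C iota (\<lambda>c. c) (psi t) = psi_hat K A C psi (tmap K C Om (\<lambda>c. c) iota t)"
    if t: "t \<in> carrier (tensor K C A)" for t
    by (rule tensor_eqI[OF C_vs A_vs lin_comp[OF tmap_lin[OF iota_lin lin_id[OF C_vs]] src.Psi_lin']
          lin_comp[OF tgt.Psi_lin' tmap_lin[OF lin_id[OF C_vs] iota_lin]] _ t])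
      (simp add: tmap_pure[OF lin_id[OF C_vs] iota_lin] cross_iota[unfolded tgt.cross_def src.cross_def])
  have dg: "dg_entwining K Om (Omega_gr K A) d C Delta eps (psi_hat K A C psi)"
    by (intro dg_entwining.intro dg_entwining_axioms.intro Om_dg ent hat_degree D)
  show ?thesis
  proof (intro dg_entwining_over.intro dg_entwining_over_axioms.intro assms dg rho)
    show "iota a \<in> Omega_gr K A 0" if "a \<in> carrier A" for a
      using gr_mem[OF form_closed[of "(a, \<zero>\<^bsub>K\<^esub>)" "[]" 0]] that by (simp add: iota_eq wform_def)
    show "linear_map K A Om iota" using iota_lin by (simp add: lin_def)
    show "iota (a \<otimes>\<^bsub>A\<^esub> b) = iota a \<otimes>\<^bsub>Om\<^esub> iota b" if "a \<in> carrier A" "b \<in> carrier A" for a b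
      using that by (simp add: iota_mult) (simp add: iota_eq lop_wform valid_def U_mult)
  qed
qed

end
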